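(* Let $M$ be an $n$-dimensional $C^\infty$ manifold, let $D\subseteq TM\oplus T^*M$ be a Dirac structure on $M$, and let $\underline{D}$ be the sheaf of germs of differentiable cross sections of $D$. Then the sheaf $\underline{D}^{tg}$ of $\underline{C^\infty(TM)}$-modules on the manifold $TM$ that is spanned by the germs $(X^C,\alpha^C)$ and $(X^V,\alpha^V)$, for all $(X,\alpha)\in\underline{D}$, is locally free of rank $2n$, and it is isomorphic with the sheaf of germs of cross sections of a Dirac structure $D^{tg}$ on $TM$.
   Context: Everything is $C^\infty$, and the Einstein summation convention is used. For a manifold $M$ put $E(M)=TM\oplus T^*M$, with the nondegenerate metric $g((X,\alpha),(Y,\beta))=\frac12(\alpha(Y)+\beta(X))$ and the 2-form $\omega((X,\alpha),(Y,\beta))=\frac12(\alpha(Y)-\beta(X))$. An almost Dirac structure on $M$ is a maximal $g$-isotropic vector subbundle of $E(M)$ (so its rank is $\dim M$). The Courant bracket on $\Gamma E(M)$ is $$[(X,\alpha),(Y,\beta)]=\big([X,Y],\,L_X\beta-L_Y\alpha+d(\omega((X,\alpha),(Y,\beta)))\big).$$ A Dirac structure is an almost Dirac structure $D$ such that $\Gamma D$ is closed under the Courant bracket. $\underline{C^\infty(TM)}$ is the sheaf of germs of differentiable functions on the total space $TM$ of the tangent bundle $\pi:TM\to M$. Lifts: let $x^i$ be local coordinates on $M$ and $v^i$ the corresponding natural fiber coordinates on $TM$. For a function $f$, $f^V=f\circ\pi$ and $f^C=v^i\,\partial f/\partial x^i$. For a vector field $X=\xi^i\frac{\partial}{\partial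 x^i}$ the vertical and complete lifts are $$X^V=\xi^i\frac{\partial}{\partial v^i},\qquad X^C=\xi^i\frac{\partial}{\partial x^i}+v^i\frac{\partial \xi^j}{\partial x^i}\frac{\partial}{\partial v^j}.$$ For a 1-form $\alpha=\alpha_i dx^i$ they are $$\alpha^V=\pi^*\alpha=\alpha_i dx^i,\qquad \alpha^C=v^j\frac{\partial\alpha_i}{\partial x^j}dx^i+\alpha_i dv^i.$$ The sheaf $\underline{D}^{tg}$ is a subsheaf of the sheaf of germs of sections of $E(TM)=T(TM)\oplus T^*(TM)$, and $D^{tg}$ is the vector subbundle of $E(TM)$ whose germs of sections form this subsheaf. *)

theory Defs
  imports "HOL-Analysis.Analysis"
begin

section \<open>Smooth maps between Euclidean spaces\<close>

primrec Ck_on :: "nat \<Rightarrow> 'e::euclidean_space set \<Rightarrow> ('e \<Rightarrow> 'f::real_normed_vector) \<Rightarrow> bool" where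
  "Ck_on 0 S f \<longleftrightarrow> continuous_on S f"
| "Ck_on (Suc k) S f \<longleftrightarrow>
     (\<forall>x\<in>S. f differentiable (at x)) \<and> (\<forall>v. Ck_on k S (\<lambda>x. frechet_derivative f (at x) v))"

text \<open>Only used for open sets.\<close>

definition smooth_on :: "'e::euclidean_space set \<Rightarrow> ('e \<Rightarrow> 'f::real_normed_vector) \<Rightarrow> bool" where
  "smooth_on S f \<longleftrightarrow> (\<forall>k. Ck_on k S f)"


section \<open>Smooth manifolds\<close>

text \<open>A chart is a pair of its domain and its coordinate map (whose values outside the domain are
  irrelevant). A manifold is given by a smooth atlas, together with a choice of a preferred chart
  around each point. The choice is arbitrary and only serves to represent tangent vectors: a
  tangent vector at \<open>p\<close> is represented by its components with respect to the preferred chart at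
  \<open>p\<close>, so that each tangent space is a copy of the model space \<open>'e\<close>, and each cotangent space is
  its dual \<open>'e \<Rightarrow>\<^sub>L real\<close>. The dimension of the manifold is \<open>DIM('e)\<close>.\<close>

type_synonym ('a, 'e) chart = "'a set \<times> ('a \<Rightarrow> 'e)"

record ('a, 'e) charted_space =
  atlas :: "('a, 'e) chart set"
  chart_at :: "'a \<Rightarrow> ('a, 'e) chart"

definition carrier :: "('a, 'e) charted_space \<Rightarrow> 'a set" where
  "carrier M = \<Union> (fst ` atlas M)"

definition chart_inv :: "('a, 'e) chart \<Rightarrow> 'e \<Rightarrow> 'a" where
  "chart_inv c = inv_into (fst c) (snd c)"

definition manifold_top :: "('a, 'e::euclidean_space) charted_space \<Rightarrow> 'a topology" where
  "manifold_top M = topology_generated_by {fst c \<inter> snd c -` W |c W. c \<in> atlas M \<and> open W}"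

definition smooth_atlas :: "('a, 'e::euclidean_space) chart set \<Rightarrow> bool" where
  "smooth_atlas A \<longleftrightarrow>
     (\<forall>c\<in>A. inj_on (snd c) (fst c) \<and> open (snd c ` fst c)) \<and>
     (\<forall>c\<in>A. \<forall>c'\<in>A. open (snd c ` (fst c \<inter> fst c')) \<and>
        smooth_on (snd c ` (fst c \<inter> fst c')) (snd c' \<circ> chart_inv c))"

definition smooth_manifold :: "('a, 'e::euclidean_space) charted_space \<Rightarrow> bool" where
  "smooth_manifold M \<longleftrightarrow>
     smooth_atlas (atlas M) \<and>
     (\<forall>p\<in>carrier M. chart_at M p \<in> atlas M \<and> p \<in> fst (chart_at M p)) \<and>
     Hausdorff_space (manifold_top M) \<and> second_countable (manifold_top M)"


section \<open>Tangent vectors, covectors and fields\<close>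

text \<open>The derivative at \<open>p\<close> of the coordinate change from \<open>c\<close> to \<open>c'\<close>.\<close>

definition jacobian :: "('a, 'e::euclidean_space) chart \<Rightarrow> ('a, 'e) chart \<Rightarrow> 'a \<Rightarrow> 'e \<Rightarrow>\<^sub>L 'e" where
  "jacobian c c' p = Blinfun (frechet_derivative (snd c' \<circ> chart_inv c) (at (snd c p)))"

text \<open>Components, with respect to the chart \<open>c\<close>, of a vector and of a covector at \<open>p\<close>.\<close>

definition vec_comp ::
  "('a, 'e::euclidean_space) charted_space \<Rightarrow> ('a, 'e) chart \<Rightarrow> 'a \<Rightarrow> 'e \<Rightarrow> 'e" where
  "vec_comp M c p v = blinfun_apply (jacobian (chart_at M p) c p) v"

definition covec_comp ::
  "('a, 'e::euclidean_space) charted_space \<Rightarrow> ('a, 'e) chart \<Rightarrow> 'a \<Rightarrow> ('e \<Rightarrow>\<^sub>L real) \<Rightarrow> ('e \<Rightarrow>\<^sub>L real)"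
  where "covec_comp M c p a = a o\<^sub>L jacobian c (chart_at M p) p"

text \<open>Coordinate representations, as functions of \<open>x \<in> snd c ` fst c\<close>: these are
  \<open>x \<mapsto> (\<xi>\<^sup>i(x))\<close> and \<open>x \<mapsto> (\<alpha>\<^sub>i(x))\<close>.\<close>

definition vf_rep ::
  "('a, 'e::euclidean_space) charted_space \<Rightarrow> ('a, 'e) chart \<Rightarrow> ('a \<Rightarrow> 'e) \<Rightarrow> 'e \<Rightarrow> 'e" where
  "vf_rep M c X x = vec_comp M c (chart_inv c x) (X (chart_inv c x))"

definition form_rep ::
  "('a, 'e::euclidean_space) charted_space \<Rightarrow> ('a, 'e) chart \<Rightarrow> ('a \<Rightarrow> 'e \<Rightarrow>\<^sub>L real) \<Rightarrow> 'e \<Rightarrow> 'e \<Rightarrow>\<^sub>L real"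
  where "form_rep M c \<alpha> x = covec_comp M c (chart_inv c x) (\<alpha> (chart_inv c x))"

definition smooth_fun ::
  "('a, 'e::euclidean_space) charted_space \<Rightarrow> 'a set \<Rightarrow> ('a \<Rightarrow> real) \<Rightarrow> bool" where
  "smooth_fun M U f \<longleftrightarrow> (\<forall>c\<in>atlas M. smooth_on (snd c ` (U \<inter> fst c)) (f \<circ> chart_inv c))"

definition smooth_vf ::
  "('a, 'e::euclidean_space) charted_space \<Rightarrow> 'a set \<Rightarrow> ('a \<Rightarrow> 'e) \<Rightarrow> bool" where
  "smooth_vf M U X \<longleftrightarrow> (\<forall>c\<in>atlas M. smooth_on (snd c ` (U \<inter> fst c)) (vf_rep M c X))"

definition smooth_form ::
  "('a, 'e::euclidean_space) charted_space \<Rightarrow> 'a set \<Rightarrow> ('a \<Rightarrow> 'e \<Rightarrow>\<^sub>L real) \<Rightarrow> bool" where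
  "smooth_form M U \<alpha> \<longleftrightarrow> (\<forall>c\<in>atlas M. smooth_on (snd c ` (U \<inter> fst c)) (form_rep M c \<alpha>))"


section \<open>The bundle \<open>E(M)\<close> and Dirac structures\<close>

text \<open>The fibre of \<open>E(M)\<close>; a section of \<open>E(M)\<close> is a function from points to this type.\<close>

type_synonym 'e gvec = "'e \<times> ('e \<Rightarrow>\<^sub>L real)"

definition smooth_section ::
  "('a, 'e::euclidean_space) charted_space \<Rightarrow> 'a set \<Rightarrow> ('a \<Rightarrow> 'e gvec) \<Rightarrow> bool" where
  "smooth_section M U s \<longleftrightarrow> smooth_vf M U (fst \<circ> s) \<and> smooth_form M U (snd \<circ> s)"

definition metric_E :: "'e::euclidean_space gvec \<Rightarrow> 'e gvec \<Rightarrow> real" where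
  "metric_E a b = (blinfun_apply (snd a) (fst b) + blinfun_apply (snd b) (fst a)) / 2"

definition omega_E :: "'e::euclidean_space gvec \<Rightarrow> 'e gvec \<Rightarrow> real" where
  "omega_E a b = (blinfun_apply (snd a) (fst b) - blinfun_apply (snd b) (fst a)) / 2"

definition isotropic :: "'e::euclidean_space gvec set \<Rightarrow> bool" where
  "isotropic L \<longleftrightarrow> subspace L \<and> (\<forall>a\<in>L. \<forall>b\<in>L. metric_E a b = 0)"

definition maximal_isotropic :: "'e::euclidean_space gvec set \<Rightarrow> bool" where
  "maximal_isotropic L \<longleftrightarrow> isotropic L \<and> (\<forall>L'. isotropic L' \<and> L \<subseteq> L' \<longrightarrow> L' = L)"

text \<open>A smooth vector subbundle of \<open>E(M)\<close>, given by its fibres (over points of the carrier):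
  locally it is spanned by a smooth frame.\<close>

definition vector_subbundle ::
  "('a, 'e::euclidean_space) charted_space \<Rightarrow> ('a \<Rightarrow> 'e gvec set) \<Rightarrow> bool" where
  "vector_subbundle M D \<longleftrightarrow>
     (\<forall>p\<in>carrier M. \<exists>U (r::nat) e. openin (manifold_top M) U \<and> p \<in> U \<and>
        (\<forall>i<r. smooth_section M U (e i)) \<and>
        (\<forall>q\<in>U. inj_on (\<lambda>i. e i q) {..<r} \<and> independent ((\<lambda>i. e i q) ` {..<r}) \<and>
           span ((\<lambda>i. e i q) ` {..<r}) = D q))"

definition almost_dirac ::
  "('a, 'e::euclidean_space) charted_space \<Rightarrow> ('a \<Rightarrow> 'e gvec set) \<Rightarrow> bool" where
  "almost_dirac M D \<longleftrightarrow> vector_subbundle M D \<and> (\<forall>p\<in>carrier M. maximal_isotropic (D p))"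

definition section_of ::
  "('a, 'e::euclidean_space) charted_space \<Rightarrow> ('a \<Rightarrow> 'e gvec set) \<Rightarrow> 'a set \<Rightarrow> ('a \<Rightarrow> 'e gvec) \<Rightarrow> bool"
  where "section_of M D U s \<longleftrightarrow> smooth_section M U s \<and> (\<forall>p\<in>U. s p \<in> D p)"

text \<open>The following operations are computed at \<open>p\<close> in the coordinates of the preferred chart at
  \<open>p\<close>, with respect to which the values are represented. In coordinates:
  \<open>(df)\<^sub>i = \<partial>\<^sub>i f\<close>, \<open>[X,Y]\<^sup>i = \<xi>\<^sup>j \<partial>\<^sub>j \<eta>\<^sup>i - \<eta>\<^sup>j \<partial>\<^sub>j \<xi>\<^sup>i\<close> and
  \<open>(L\<^sub>X \<beta>)\<^sub>i = \<xi>\<^sup>j \<partial>\<^sub>j \<beta>\<^sub>i + \<beta>\<^sub>j \<partial>\<^sub>i \<xi>\<^sup>j\<close>.\<close>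

definition ext_deriv ::
  "('a, 'e::euclidean_space) charted_space \<Rightarrow> ('a \<Rightarrow> real) \<Rightarrow> 'a \<Rightarrow> 'e \<Rightarrow>\<^sub>L real" where
  "ext_deriv M f p = (let c = chart_at M p in
     Blinfun (frechet_derivative (f \<circ> chart_inv c) (at (snd c p))))"

definition lie_bracket ::
  "('a, 'e::euclidean_space) charted_space \<Rightarrow> ('a \<Rightarrow> 'e) \<Rightarrow> ('a \<Rightarrow> 'e) \<Rightarrow> 'a \<Rightarrow> 'e" where
  "lie_bracket M X Y p = (let c = chart_at M p; x = snd c p; \<xi> = vf_rep M c X; \<eta> = vf_rep M c Y in
     frechet_derivative \<eta> (at x) (\<xi> x) - frechet_derivative \<xi> (at x) (\<eta> x))"

definition lie_deriv_form ::
  "('a, 'e::euclidean_space) charted_space \<Rightarrow> ('a \<Rightarrow> 'e) \<Rightarrow> ('a \<Rightarrow> 'e \<Rightarrow>\<^sub>L real) \<Rightarrow> 'a \<Rightarrow> 'e \<Rightarrow>\<^sub>L real"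
  where
  "lie_deriv_form M X \<beta> p = (let c = chart_at M p; x = snd c p; \<xi> = vf_rep M c X; b = form_rep M c \<beta> in
     frechet_derivative b (at x) (\<xi> x) + (b x o\<^sub>L Blinfun (frechet_derivative \<xi> (at x))))"

definition courant_bracket ::
  "('a, 'e::euclidean_space) charted_space \<Rightarrow> ('a \<Rightarrow> 'e gvec) \<Rightarrow> ('a \<Rightarrow> 'e gvec) \<Rightarrow> 'a \<Rightarrow> 'e gvec"
  where
  "courant_bracket M s t p =
     (lie_bracket M (fst \<circ> s) (fst \<circ> t) p,
      lie_deriv_form M (fst \<circ> s) (snd \<circ> t) p - lie_deriv_form M (fst \<circ> t) (snd \<circ> s) p
        + ext_deriv M (\<lambda>q. omega_E (s q) (t q)) p)"

definition dirac_structure ::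
  "('a, 'e::euclidean_space) charted_space \<Rightarrow> ('a \<Rightarrow> 'e gvec set) \<Rightarrow> bool" where
  "dirac_structure M D \<longleftrightarrow> almost_dirac M D \<and>
     (\<forall>s t. section_of M D (carrier M) s \<and> section_of M D (carrier M) t \<longrightarrow>
        section_of M D (carrier M) (courant_bracket M s t))"


section \<open>The tangent bundle and lifts\<close>

definition tangent_chart ::
  "('a, 'e::euclidean_space) charted_space \<Rightarrow> ('a, 'e) chart \<Rightarrow> ('a \<times> 'e, 'e \<times> 'e) chart" where
  "tangent_chart M c = (fst c \<times> UNIV, \<lambda>(p, v). (snd c p, vec_comp M c p v))"

definition tangent_bundle ::
  "('a, 'e::euclidean_space) charted_space \<Rightarrow> ('a \<times> 'e, 'e \<times> 'e) charted_space" where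
  "tangent_bundle M =
     \<lparr>atlas = tangent_chart M ` atlas M, chart_at = (\<lambda>(p, v). tangent_chart M (chart_at M p))\<rparr>"

text \<open>A vector of \<open>T(TM)\<close> at \<open>(p, v)\<close> is represented by its components with respect to the natural
  coordinates \<open>(x\<^sup>i, v\<^sup>i)\<close> of \<open>TM\<close> induced by the preferred chart at \<open>p\<close>. In these coordinates, the
  lifts are given by the classical formulas; covectors act on \<open>(dx, dv)\<close>.\<close>

definition vf_vlift :: "('a, 'e::euclidean_space) charted_space \<Rightarrow> ('a \<Rightarrow> 'e) \<Rightarrow> 'a \<times> 'e \<Rightarrow> 'e \<times> 'e" where
  "vf_vlift M X = (\<lambda>(p, v). (0, X p))"

definition vf_clift :: "('a, 'e::euclidean_space) charted_space \<Rightarrow> ('a \<Rightarrow> 'e) \<Rightarrow> 'a \<times> 'e \<Rightarrow> 'e \<times> 'e" where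
  "vf_clift M X = (\<lambda>(p, v). let c = chart_at M p in
     (X p, frechet_derivative (vf_rep M c X) (at (snd c p)) v))"

definition form_vlift ::
  "('a, 'e::euclidean_space) charted_space \<Rightarrow> ('a \<Rightarrow> 'e \<Rightarrow>\<^sub>L real) \<Rightarrow> 'a \<times> 'e \<Rightarrow> ('e \<times> 'e) \<Rightarrow>\<^sub>L real"
  where "form_vlift M \<alpha> = (\<lambda>(p, v). \<alpha> p o\<^sub>L fst_blinfun)"

definition form_clift ::
  "('a, 'e::euclidean_space) charted_space \<Rightarrow> ('a \<Rightarrow> 'e \<Rightarrow>\<^sub>L real) \<Rightarrow> 'a \<times> 'e \<Rightarrow> ('e \<times> 'e) \<Rightarrow>\<^sub>L real"
  where
  "form_clift M \<alpha> = (\<lambda>(p, v). let c = chart_at M p in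
     (frechet_derivative (form_rep M c \<alpha>) (at (snd c p)) v o\<^sub>L fst_blinfun) + (\<alpha> p o\<^sub>L snd_blinfun))"

definition vertical_lift ::
  "('a, 'e::euclidean_space) charted_space \<Rightarrow> ('a \<Rightarrow> 'e gvec) \<Rightarrow> 'a \<times> 'e \<Rightarrow> ('e \<times> 'e) gvec" where
  "vertical_lift M s z = (vf_vlift M (fst \<circ> s) z, form_vlift M (snd \<circ> s) z)"

definition complete_lift ::
  "('a, 'e::euclidean_space) charted_space \<Rightarrow> ('a \<Rightarrow> 'e gvec) \<Rightarrow> 'a \<times> 'e \<Rightarrow> ('e \<times> 'e) gvec" where
  "complete_lift M s z = (vf_clift M (fst \<circ> s) z, form_clift M (snd \<circ> s) z)"


section \<open>Germs and sheaves of germs\<close>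

text \<open>The germ at \<open>p\<close> of a function defined near \<open>p\<close>. Germs are classes of functions
  on the whole type, whose values away from \<open>p\<close> are irrelevant.\<close>

definition germ :: "('a, 'e::euclidean_space) charted_space \<Rightarrow> 'a \<Rightarrow> ('a \<Rightarrow> 'v) \<Rightarrow> ('a \<Rightarrow> 'v) set" where
  "germ M p s = {t. \<exists>U. openin (manifold_top M) U \<and> p \<in> U \<and> (\<forall>q\<in>U. t q = s q)}"

text \<open>A sheaf of germs is given by its stalks.\<close>

type_synonym ('a, 'v) germ_sheaf = "'a \<Rightarrow> ('a \<Rightarrow> 'v) set set"

definition function_germs :: "('a, 'e::euclidean_space) charted_space \<Rightarrow> ('a, real) germ_sheaf" where
  "function_germs M p =
     {germ M p f |f U. openin (manifold_top M) U \<and> p \<in> U \<and> smooth_fun M U f}"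

definition section_germs ::
  "('a, 'e::euclidean_space) charted_space \<Rightarrow> ('a \<Rightarrow> 'e gvec set) \<Rightarrow> ('a, 'e gvec) germ_sheaf" where
  "section_germs M D p =
     {germ M p s |s U. openin (manifold_top M) U \<and> p \<in> U \<and> section_of M D U s}"

definition germ_add :: "('a \<Rightarrow> 'v::real_vector) set \<Rightarrow> ('a \<Rightarrow> 'v) set \<Rightarrow> ('a \<Rightarrow> 'v) set" where
  "germ_add g h = {\<lambda>q. s q + t q |s t. s \<in> g \<and> t \<in> h}"

definition germ_scale :: "('a \<Rightarrow> real) set \<Rightarrow> ('a \<Rightarrow> 'v::real_vector) set \<Rightarrow> ('a \<Rightarrow> 'v) set" where
  "germ_scale \<phi> g = {\<lambda>q. f q *\<^sub>R s q |f s. f \<in> \<phi> \<and> s \<in> g}"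

text \<open>The module, over the germs of smooth functions at \<open>p\<close>, spanned by a set of germs at \<open>p\<close>.\<close>

inductive_set germ_span ::
  "('a, 'e::euclidean_space) charted_space \<Rightarrow> 'a \<Rightarrow> ('a \<Rightarrow> 'v::real_vector) set set \<Rightarrow>
     ('a \<Rightarrow> 'v) set set"
  for M p G where
  zero: "germ M p (\<lambda>_. 0) \<in> germ_span M p G"
| add: "\<phi> \<in> function_germs M p \<Longrightarrow> g \<in> G \<Longrightarrow> h \<in> germ_span M p G \<Longrightarrow>
     germ_add (germ_scale \<phi> g) h \<in> germ_span M p G"

primrec germ_lincomb ::
  "('a, 'e::euclidean_space) charted_space \<Rightarrow> 'a \<Rightarrow> (nat \<Rightarrow> ('a \<Rightarrow> real) set) \<Rightarrow>
     (nat \<Rightarrow> ('a \<Rightarrow> 'v::real_vector) set) \<Rightarrow> nat \<Rightarrow> ('a \<Rightarrow> 'v) set" where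
  "germ_lincomb M p \<phi> g 0 = germ M p (\<lambda>_. 0)"
| "germ_lincomb M p \<phi> g (Suc k) = germ_add (germ_lincomb M p \<phi> g k) (germ_scale (\<phi> k) (g k))"

text \<open>Locally there are \<open>r\<close> sections of the sheaf whose germs form a basis of each stalk, i.e., the
  restriction of the sheaf is isomorphic to the \<open>r\<close>-th power of the sheaf of germs of functions.\<close>

definition locally_free ::
  "('a, 'e::euclidean_space) charted_space \<Rightarrow> nat \<Rightarrow> ('a, 'v::real_vector) germ_sheaf \<Rightarrow> bool" where
  "locally_free M r S \<longleftrightarrow>
     (\<forall>p\<in>carrier M. \<exists>U e. openin (manifold_top M) U \<and> p \<in> U \<and>
        (\<forall>q\<in>U. (\<forall>i<r. germ M q (e i) \<in> S q) \<and>
           bij_betw (\<lambda>\<phi>. germ_lincomb M q \<phi> (\<lambda>i. germ M q (e i)) r)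
             ({..<r} \<rightarrow>\<^sub>E function_germs M q) (S q)))"

text \<open>Isomorphism of sheaves of modules over the germs of smooth functions: module isomorphisms of
  the stalks that map local sections to local sections.\<close>

definition sheaf_isomorphic ::
  "('a, 'e::euclidean_space) charted_space \<Rightarrow> ('a, 'v::real_vector) germ_sheaf \<Rightarrow>
     ('a, 'w::real_vector) germ_sheaf \<Rightarrow> bool" where
  "sheaf_isomorphic M S S' \<longleftrightarrow>
     (\<exists>\<Phi>. (\<forall>p\<in>carrier M.
          bij_betw (\<Phi> p) (S p) (S' p) \<and>
          (\<forall>g\<in>S p. \<forall>h\<in>S p. \<Phi> p (germ_add g h) = germ_add (\<Phi> p g) (\<Phi> p h)) \<and>
          (\<forall>\<phi>\<in>function_germs M p. \<forall>g\<in>S p. \<Phi> p (germ_scale \<phi> g) = germ_scale \<phi> (\<Phi> p g))) \<and>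
        (\<forall>U s. openin (manifold_top M) U \<and> (\<forall>q\<in>U. germ M q s \<in> S q) \<longrightarrow>
          (\<forall>p\<in>U. \<exists>W t. openin (manifold_top M) W \<and> p \<in> W \<and> W \<subseteq> U \<and>
             (\<forall>q\<in>W. \<Phi> q (germ M q s) = germ M q t))))"

text \<open>The sheaf on \<open>TM\<close> spanned by the germs of the lifts of local sections of \<open>D\<close>.\<close>

definition tangent_lift_sheaf ::
  "('a, 'e::euclidean_space) charted_space \<Rightarrow> ('a \<Rightarrow> 'e gvec set) \<Rightarrow>
     ('a \<times> 'e, ('e \<times> 'e) gvec) germ_sheaf" where
  "tangent_lift_sheaf M D z = germ_span (tangent_bundle M) z
     ({germ (tangent_bundle M) z (complete_lift M s) |s U.
         openin (manifold_top M) U \<and> fst z \<in> U \<and> section_of M D U s} \<union>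
      {germ (tangent_bundle M) z (vertical_lift M s) |s U.
         openin (manifold_top M) U \<and> fst z \<in> U \<and> section_of M D U s})"

end

theory Submission
  imports Defs
begin

text \<open>
  The lifts identify \<open>E(TM)\<close> with the tangent bundle of the manifold \<open>E(M)\<close>. In the coordinates
  \<open>(x, v)\<close> of \<open>TM\<close> the lifts \<open>s\<^sup>C\<close> and \<open>t\<^sup>V\<close> are \<open>(s(x), Ds(x)v)\<close> and \<open>(0, t(x))\<close>, up to a fixed
  rearrangement of the four components (\<open>lift_pair\<close>), and the metric of \<open>(p, q)\<close> and \<open>(p', q')\<close> is
  \<open>g(p, q') + g(q, p')\<close>, the derivative of \<open>g(p, p')\<close> in the direction \<open>(q, q')\<close>. So every identity between sections of \<open>D\<close>
  gives, when it is differentiated in the direction \<open>v\<close>, the corresponding identity between lifts.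

  The fibre of \<open>D\<^sup>t\<^sup>g\<close> at \<open>(p, v)\<close> consists of the values \<open>s\<^sup>C + t\<^sup>V\<close> for local sections \<open>s, t\<close> of \<open>D\<close>.
  It is isotropic, because \<open>g(s, s') = 0\<close> may be differentiated. If \<open>e\<^sub>1, \<dots>, e\<^sub>n\<close> is a local frame of \<open>D\<close>,
  the \<open>2n\<close> lifts \<open>e\<^sub>i\<^sup>C, e\<^sub>i\<^sup>V\<close> are independent; since the metric has split signature, an isotropic space
  of half the dimension is maximal (\<open>maximal_isotropic_iff\<close>), so these lifts form a frame of \<open>D\<^sup>t\<^sup>g\<close>.
  The coefficients of a smooth section with respect to a smooth frame are smooth
  (\<open>smooth_frame_coefficients\<close>). Therefore the sections of \<open>D\<^sup>t\<^sup>g\<close> form a locally free sheaf of rank \<open>2n\<close>,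
  and it is the sheaf spanned by the lifts (\<open>tangent_lift_sheaf_eq\<close>); the isomorphism is the identity.

  For the brackets: if \<open>s, t, u\<close> are pairwise orthogonal, then in coordinates
  \<open>g([s,t], u)\<close> is the cyclic sum of \<open>g(\<partial>\<^bsub>\<rho>s\<^esub> t, u)\<close>, where \<open>\<rho>s\<close> is the vector component of \<open>s\<close>
  (\<open>metric_coord_bracket\<close>). By isotropy this expression depends only on the values of the sections
  at the point (\<open>courant_tensor_cong1\<close>). Three sections of \<open>D\<^sup>t\<^sup>g\<close> may therefore be replaced, at a
  given point, by sections \<open>s\<^sup>C + t\<^sup>V\<close>, and for these the cyclic sum is the derivative along \<open>v\<close> of the
  one for \<open>D\<close> plus three values of the latter (\<open>courant_tensor_lift\<close>). The one for \<open>D\<close> vanishes, as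
  \<open>D\<close> is a Dirac structure. Hence \<open>[S,T]\<close> is orthogonal to \<open>D\<^sup>t\<^sup>g\<close>, and a maximal isotropic space is
  its own orthogonal space.

  Two further points need work. Involutivity of \<open>D\<close> is assumed for global sections but is used for
  local ones; bump functions and the Hausdorff property make the passage (\<open>extend_section\<close>). And
  brackets and lifts are computed at each point in a preferred chart, so that their smoothness rests
  on their naturality (\<open>sec_rep_courant_bracket\<close>, \<open>sec_rep_lift_section\<close>), which in turn rests on
  the symmetry of second derivatives.
\<close>

section \<open>Smooth functions\<close>

abbreviation der :: "('a::real_normed_vector \<Rightarrow> 'b::real_normed_vector) \<Rightarrow> 'a \<Rightarrow> 'a \<Rightarrow> 'b" where
  "der f x \<equiv> frechet_derivative f (at x)"

lemma Ck_on_subset: "Ck_on k S f \<Longrightarrow> T \<subseteq> S \<Longrightarrow> Ck_on k T f"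
  by (induction k arbitrary: f) (auto intro: continuous_on_subset)

lemma Ck_on_Suc_imp: "Ck_on (Suc k) S f \<Longrightarrow> Ck_on k S f"
proof (induction k arbitrary: f)
  case 0
  then show ?case
    by (simp add: differentiable_imp_continuous_on differentiable_on_def differentiable_at_withinI)
next
  case (Suc k)
  then show ?case by simp
qed

lemma frechet_derivative_eqI:
  "(f has_derivative f') (at x) \<Longrightarrow> der f x = f'"
  using frechet_derivative_at by metis

lemma frechet_has_derivative:
  "f differentiable (at x) \<Longrightarrow> (f has_derivative der f x) (at x)"
  by (simp add: frechet_derivative_works)

lemma differentiable_cong_open:
  assumes "open S" "x \<in> S" "\<And>y. y \<in> S \<Longrightarrow> f y = g y"
  shows "f differentiable (at x) \<longleftrightarrow> g differentiable (at x)"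
  unfolding differentiable_def
  using has_derivative_transform_within_open[of f _ x UNIV S g]
    has_derivative_transform_within_open[of g _ x UNIV S f] assms by metis

lemma frechet_derivative_cong_open:
  assumes "open S" "x \<in> S" "\<And>y. y \<in> S \<Longrightarrow> f y = g y"
  shows "der f x = der g x"
proof -
  have "(f has_derivative D) (at x) \<longleftrightarrow> (g has_derivative D) (at x)" for D
    using has_derivative_transform_within_open[of f _ x UNIV S g]
      has_derivative_transform_within_open[of g _ x UNIV S f] assms by metis
  then show ?thesis
    by (simp add: frechet_derivative_def)
qed

lemma Ck_on_cong:
  assumes "open S" "Ck_on k S f" "\<And>x. x \<in> S \<Longrightarrow> f x = g x"
  shows "Ck_on k S g"
  using assms(2,3)
proof (induction k arbitrary: f g)
  case 0
  then show ?case by (simp cong: continuous_on_cong)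
next
  case (Suc k)
  have "g differentiable (at x)" if "x \<in> S" for x
    using Suc.prems that differentiable_cong_open[OF assms(1) that, of f g] by auto
  moreover have "Ck_on k S (\<lambda>x. der g x v)" for v
    by (rule Suc.IH[of "\<lambda>x. der f x v"])
      (use Suc.prems frechet_derivative_cong_open[OF assms(1), of _ f g] in auto)
  ultimately show ?case by simp
qed

lemma Ck_on_local:
  assumes "\<And>x. x \<in> S \<Longrightarrow> \<exists>T. open T \<and> x \<in> T \<and> Ck_on k T f"
  shows "Ck_on k S f"
  using assms
proof (induction k arbitrary: f)
  case 0
  have "continuous (at x) f" if x: "x \<in> S" for x
    using 0[OF x] continuous_on_eq_continuous_at by auto
  then show ?case
    by (simp add: continuous_at_imp_continuous_on)
next
  case (Suc k)
  have "Ck_on k S (\<lambda>x. der f x v)" for v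
  proof (rule Suc.IH)
    fix x assume "x \<in> S"
    then show "\<exists>T. open T \<and> x \<in> T \<and> Ck_on k T (\<lambda>x. der f x v)"
      using Suc.prems[of x] by auto
  qed
  then show ?case
    using Suc.prems by force
qed

lemma Ck_on_const: "Ck_on k S (\<lambda>_. c)"
  by (induction k arbitrary: c) auto

lemma Ck_on_bounded_linear:
  assumes L: "bounded_linear L" and S: "open S" and "Ck_on k S f"
  shows "Ck_on k S (\<lambda>x. L (f x))"
  using assms(3)
proof (induction k arbitrary: f)
  case 0
  then show ?case by (auto intro: bounded_linear.continuous_on[OF L])
next
  case (Suc k)
  have D: "((\<lambda>x. L (f x)) has_derivative (\<lambda>v. L (der f x v))) (at x)"
    if "x \<in> S" for x
    using Suc.prems that
    by (intro bounded_linear.has_derivative[OF L]) (auto intro: frechet_has_derivative)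
  have "Ck_on k S (\<lambda>x. der (\<lambda>x. L (f x)) x v)" for v
    by (rule Ck_on_cong[OF S Suc.IH[of "\<lambda>x. der f x v"]])
      (use Suc.prems frechet_derivative_eqI[OF D] in auto)
  then show ?case using D by (auto simp: differentiable_def)
qed

lemma Ck_on_add:
  assumes S: "open S" and "Ck_on k S f" "Ck_on k S g"
  shows "Ck_on k S (\<lambda>x. f x + g x)"
  using assms(2,3)
proof (induction k arbitrary: f g)
  case 0
  then show ?case by (auto intro: continuous_intros)
next
  case (Suc k)
  have D: "((\<lambda>x. f x + g x) has_derivative
      (\<lambda>v. der f x v + der g x v)) (at x)"
    if "x \<in> S" for x
    using Suc.prems that
    by (intro has_derivative_add) (auto intro: frechet_has_derivative)
  have "Ck_on k S (\<lambda>x. der (\<lambda>x. f x + g x) x v)" for v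
    by (rule Ck_on_cong[OF S Suc.IH[of "\<lambda>x. der f x v"
            "\<lambda>x. der g x v"]])
      (use Suc.prems frechet_derivative_eqI[OF D] in auto)
  then show ?case using D by (auto simp: differentiable_def)
qed

lemma Ck_on_sum:
  assumes "open S" "\<And>i. i \<in> I \<Longrightarrow> Ck_on k S (f i)"
  shows "Ck_on k S (\<lambda>x. \<Sum>i\<in>I. f i x)"
  using assms(2)
  by (induction I rule: infinite_finite_induct) (auto intro: Ck_on_const Ck_on_add[OF assms(1)])

lemma Ck_on_bilinear:
  assumes B: "bounded_bilinear B" and S: "open S" and "Ck_on k S f" "Ck_on k S g"
  shows "Ck_on k S (\<lambda>x. B (f x) (g x))"
  using assms(3,4)
proof (induction k arbitrary: f g)
  case 0
  then show ?case by (auto intro: bounded_bilinear.continuous_on[OF B])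
next
  case (Suc k)
  have D: "((\<lambda>x. B (f x) (g x)) has_derivative
      (\<lambda>v. B (f x) (der g x v) + B (der f x v) (g x))) (at x)"
    if "x \<in> S" for x
    using Suc.prems that
    by (intro bounded_bilinear.FDERIV[OF B]) (auto intro: frechet_has_derivative)
  have fg: "Ck_on k S f" "Ck_on k S g"
    using Suc.prems Ck_on_Suc_imp by metis+
  have "Ck_on k S (\<lambda>x. der (\<lambda>x. B (f x) (g x)) x v)" for v
  proof (rule Ck_on_cong[OF S Ck_on_add[OF S]])
    show "Ck_on k S (\<lambda>x. B (f x) (der g x v))"
      using Suc.prems fg by (intro Suc.IH) auto
    show "Ck_on k S (\<lambda>x. B (der f x v) (g x))"
      using Suc.prems fg by (intro Suc.IH) auto
  qed (use frechet_derivative_eqI[OF D] in auto)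
  then show ?case using D by (auto simp: differentiable_def)
qed

lemma linear_eq_sum_Basis:
  fixes L :: "'e::euclidean_space \<Rightarrow> 'f::real_vector"
  assumes "linear L"
  shows "L w = (\<Sum>b\<in>Basis. (w \<bullet> b) *\<^sub>R L b)"
  using linear_sum[OF assms, of "\<lambda>b. (w \<bullet> b) *\<^sub>R b" Basis]
  by (simp add: euclidean_representation linear_cmul[OF assms])

lemma linear_frechet_derivative:
  "f differentiable (at x) \<Longrightarrow> linear (der f x)"
  by (simp add: frechet_derivative_works has_derivative_linear)

text \<open>The derivative of \<open>f \<circ> g\<close> applies \<open>Df(g x)\<close> in a direction that moves with \<open>x\<close>. Expanding the
  direction in a basis leaves partial derivatives of \<open>f\<close> composed with \<open>g\<close>, to which the induction
  hypothesis applies.\<close>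

lemma Ck_on_compose:
  fixes g :: "'d::euclidean_space \<Rightarrow> 'e::euclidean_space"
  assumes S: "open S" and g: "Ck_on k S g" and f: "Ck_on k T f" and gST: "g ` S \<subseteq> T"
  shows "Ck_on k S (\<lambda>x. f (g x))"
  using f g
proof (induction k arbitrary: f)
  case 0
  then show ?case using continuous_on_compose2[OF _ _ gST] by auto
next
  case (Suc k)
  have D: "((\<lambda>x. f (g x)) has_derivative
      (\<lambda>v. der f (g x) (der g x v))) (at x)"
    if "x \<in> S" for x
    using Suc.prems that gST
    by (intro has_derivative_compose[OF frechet_has_derivative frechet_has_derivative]) auto
  have "Ck_on k S (\<lambda>x. der (\<lambda>x. f (g x)) x v)" for v
  proof (rule Ck_on_cong[OF S])
    show "Ck_on k S (\<lambda>x. \<Sum>b\<in>Basis. (der g x v \<bullet> b) *\<^sub>R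
            der f (g x) b)"
    proof (intro Ck_on_sum[OF S] Ck_on_bilinear[OF bounded_bilinear_scaleR S])
      fix b :: 'e
      show "Ck_on k S (\<lambda>x. der g x v \<bullet> b)"
        using Suc.prems by (intro Ck_on_bounded_linear[OF bounded_linear_inner_left S]) auto
      show "Ck_on k S (\<lambda>x. der f (g x) b)"
        using Suc.prems Ck_on_Suc_imp[OF Suc.prems(2)]
        by (intro Suc.IH[of "\<lambda>y. der f y b"]) auto
    qed
    show "(\<Sum>b\<in>Basis. (der g x v \<bullet> b) *\<^sub>R der f (g x) b)
        = der (\<lambda>x. f (g x)) x v" if "x \<in> S" for x
      unfolding frechet_derivative_eqI[OF D[OF that]]
      using Suc.prems(1) that gST
      by (intro linear_eq_sum_Basis[symmetric] linear_frechet_derivative) auto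
  qed
  then show ?case using D by (auto simp: differentiable_def)
qed

lemma Ck_on_inverse:
  fixes f :: "'e::euclidean_space \<Rightarrow> real"
  assumes S: "open S" and "Ck_on k S f" and nz: "\<And>x. x \<in> S \<Longrightarrow> f x \<noteq> 0"
  shows "Ck_on k S (\<lambda>x. inverse (f x))"
  using assms(2)
proof (induction k)
  case 0
  then show ?case using nz by (auto intro: continuous_on_inverse)
next
  case (Suc k)
  have D: "((\<lambda>x. inverse (f x)) has_derivative
      (\<lambda>v. - (inverse (f x) * der f x v * inverse (f x)))) (at x)"
    if "x \<in> S" for x
    using Suc.prems that nz
    by (intro Deriv.has_derivative_inverse frechet_has_derivative) auto
  have C: "Ck_on k S (\<lambda>x. inverse (f x))" "Ck_on k S (\<lambda>x. der f x v)" for v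
    using Suc.IH[OF Ck_on_Suc_imp[OF Suc.prems]] Suc.prems by auto
  have "Ck_on k S (\<lambda>x. der (\<lambda>x. inverse (f x)) x v)" for v
    by (rule Ck_on_cong[OF S Ck_on_bounded_linear[OF bounded_linear_minus[OF bounded_linear_ident] S
            Ck_on_bilinear[OF bounded_bilinear_mult S Ck_on_bilinear[OF bounded_bilinear_mult S
                C(1) C(2)[of v]] C(1)]]])
      (use frechet_derivative_eqI[OF D] in auto)
  then show ?case using D by (auto simp: differentiable_def)
qed

lemma Ck_on_ident: "Ck_on k S (\<lambda>x. x)"
  by (cases k) (auto simp: Ck_on_const)

lemma smooth_on_subset: "smooth_on S f \<Longrightarrow> T \<subseteq> S \<Longrightarrow> smooth_on T f"
  unfolding smooth_on_def using Ck_on_subset by blast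

lemma smooth_on_cong:
  "open S \<Longrightarrow> smooth_on S f \<Longrightarrow> (\<And>x. x \<in> S \<Longrightarrow> f x = g x) \<Longrightarrow> smooth_on S g"
  unfolding smooth_on_def using Ck_on_cong by blast

lemma smooth_on_local:
  "(\<And>x. x \<in> S \<Longrightarrow> \<exists>T. open T \<and> x \<in> T \<and> smooth_on T f) \<Longrightarrow> smooth_on S f"
  unfolding smooth_on_def using Ck_on_local by metis

lemma smooth_on_const: "smooth_on S (\<lambda>_. c)"
  by (simp add: smooth_on_def Ck_on_const)

lemma smooth_on_ident: "smooth_on S (\<lambda>x. x)"
  by (simp add: smooth_on_def Ck_on_ident)

lemma smooth_on_bounded_linear:
  "bounded_linear L \<Longrightarrow> open S \<Longrightarrow> smooth_on S f \<Longrightarrow> smooth_on S (\<lambda>x. L (f x))"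
  by (simp add: smooth_on_def Ck_on_bounded_linear)

lemma smooth_on_add:
  "open S \<Longrightarrow> smooth_on S f \<Longrightarrow> smooth_on S g \<Longrightarrow> smooth_on S (\<lambda>x. f x + g x)"
  by (simp add: smooth_on_def Ck_on_add)

lemma smooth_on_sum:
  "open S \<Longrightarrow> (\<And>i. i \<in> I \<Longrightarrow> smooth_on S (f i)) \<Longrightarrow> smooth_on S (\<lambda>x. \<Sum>i\<in>I. f i x)"
  by (simp add: smooth_on_def Ck_on_sum)

lemma smooth_on_bilinear:
  "bounded_bilinear B \<Longrightarrow> open S \<Longrightarrow> smooth_on S f \<Longrightarrow> smooth_on S g \<Longrightarrow>
   smooth_on S (\<lambda>x. B (f x) (g x))"
  by (simp add: smooth_on_def Ck_on_bilinear)

lemmas smooth_on_scaleR = smooth_on_bilinear[OF bounded_bilinear_scaleR]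
lemmas smooth_on_inner = smooth_on_bilinear[OF bounded_bilinear_inner]
lemmas smooth_on_mult = smooth_on_bilinear[OF bounded_bilinear_mult]
lemmas smooth_on_uminus = smooth_on_bounded_linear[OF bounded_linear_minus[OF bounded_linear_ident]]

lemma smooth_on_diff:
  "open S \<Longrightarrow> smooth_on S f \<Longrightarrow> smooth_on S g \<Longrightarrow> smooth_on S (\<lambda>x. f x - g x)"
  using smooth_on_add[of S f "\<lambda>x. - g x"] smooth_on_uminus[of S g] by simp

lemma smooth_on_compose:
  fixes g :: "'d::euclidean_space \<Rightarrow> 'e::euclidean_space"
  shows "open S \<Longrightarrow> smooth_on S g \<Longrightarrow> smooth_on T f \<Longrightarrow> g ` S \<subseteq> T \<Longrightarrow> smooth_on S (\<lambda>x. f (g x))"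
  using Ck_on_compose[of S _ g T f] by (simp add: smooth_on_def)

lemma smooth_on_inverse:
  fixes f :: "'e::euclidean_space \<Rightarrow> real"
  shows "open S \<Longrightarrow> smooth_on S f \<Longrightarrow> (\<And>x. x \<in> S \<Longrightarrow> f x \<noteq> 0) \<Longrightarrow> smooth_on S (\<lambda>x. inverse (f x))"
  by (simp add: smooth_on_def Ck_on_inverse)

lemma smooth_on_Pair:
  assumes "open S" "smooth_on S f" "smooth_on S g"
  shows "smooth_on S (\<lambda>x. (f x, g x))"
proof -
  have "smooth_on S (\<lambda>x. (f x, 0) + (0, g x))"
    by (intro smooth_on_add assms
        smooth_on_bounded_linear[OF bounded_linear_Pair[OF bounded_linear_ident bounded_linear_zero]]
        smooth_on_bounded_linear[OF bounded_linear_Pair[OF bounded_linear_zero bounded_linear_ident]])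
  then show ?thesis by simp
qed

lemmas smooth_on_fst = smooth_on_bounded_linear[OF bounded_linear_fst]
lemmas smooth_on_snd = smooth_on_bounded_linear[OF bounded_linear_snd]

lemma smooth_on_imp_differentiable: "smooth_on S f \<Longrightarrow> x \<in> S \<Longrightarrow> f differentiable (at x)"
  using Ck_on.simps(2) unfolding smooth_on_def by blast

lemma smooth_on_imp_continuous_on: "smooth_on S f \<Longrightarrow> continuous_on S f"
  using Ck_on.simps(1) unfolding smooth_on_def by blast

lemma smooth_on_has_derivative:
  "smooth_on S f \<Longrightarrow> x \<in> S \<Longrightarrow> (f has_derivative der f x) (at x)"
  by (simp add: frechet_has_derivative smooth_on_imp_differentiable)

lemma smooth_on_linear_derivative:
  "smooth_on S f \<Longrightarrow> x \<in> S \<Longrightarrow> linear (der f x)"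
  by (simp add: linear_frechet_derivative smooth_on_imp_differentiable)

lemma smooth_on_derivative_apply:
  "smooth_on S f \<Longrightarrow> smooth_on S (\<lambda>x. der f x v)"
  using Ck_on.simps(2) unfolding smooth_on_def by blast

lemma smooth_on_derivative:
  fixes g :: "'d::euclidean_space \<Rightarrow> 'e::euclidean_space"
  assumes S: "open S" and f: "smooth_on T f" and g: "smooth_on S g" and gST: "g ` S \<subseteq> T"
    and h: "smooth_on S h"
  shows "smooth_on S (\<lambda>x. der f (g x) (h x))"
proof (rule smooth_on_cong[OF S])
  show "smooth_on S (\<lambda>x. \<Sum>b\<in>Basis. (h x \<bullet> b) *\<^sub>R der f (g x) b)"
    by (intro smooth_on_sum smooth_on_scaleR smooth_on_inner S h smooth_on_const
        smooth_on_compose[OF S g smooth_on_derivative_apply[OF f] gST])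
  show "(\<Sum>b\<in>Basis. (h x \<bullet> b) *\<^sub>R der f (g x) b)
      = der f (g x) (h x)" if "x \<in> S" for x
    using that gST
    by (intro linear_eq_sum_Basis[symmetric] smooth_on_linear_derivative[OF f]) auto
qed

text \<open>A family of linear maps is determined by its values on a finite basis, each of which enters linearly.\<close>

lemma smooth_on_blinfunI:
  fixes F :: "'d::euclidean_space \<Rightarrow> 'e::euclidean_space \<Rightarrow>\<^sub>L 'f::real_normed_vector"
  assumes S: "open S" and F: "\<And>w. smooth_on S (\<lambda>x. blinfun_apply (F x) w)"
  shows "smooth_on S F"
proof (rule smooth_on_cong[OF S])
  show "smooth_on S (\<lambda>x. \<Sum>b\<in>Basis. blinfun_scaleR_left (F x b) o\<^sub>L blinfun_inner_left b)"
    by (intro smooth_on_sum smooth_on_bilinear[OF bounded_bilinear_blinfun_compose] S smooth_on_const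
        smooth_on_bounded_linear[OF bounded_linear_blinfun_scaleR_left] F)
  show "(\<Sum>b\<in>Basis. blinfun_scaleR_left (F x b) o\<^sub>L blinfun_inner_left b) = F x" if "x \<in> S" for x
    by (rule blinfun_eqI)
      (simp add: blinfun.sum_left linear_eq_sum_Basis[of "blinfun_apply (F x)", symmetric]
        bounded_linear.linear[OF blinfun.bounded_linear_right])
qed

lemma Blinfun_apply_linear:
  "linear L \<Longrightarrow> blinfun_apply (Blinfun (L::'e::euclidean_space \<Rightarrow> 'f::real_normed_vector)) = L"
  by (simp add: bounded_linear_Blinfun_apply linear_conv_bounded_linear)

text \<open>Both sides are the limit of \<open>\<Delta> h u v / h\<^sup>2\<close> for the second difference \<open>\<Delta>\<close>, which is symmetric in
  \<open>u\<close> and \<open>v\<close>. The limit is obtained from the mean value inequality for the function \<open>\<phi>\<close> of one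
  variable whose increment over \<open>[0, h]\<close> is the error term.\<close>

lemma symmetric_second_derivative:
  fixes f :: "'e::real_normed_vector \<Rightarrow> 'f::real_normed_vector"
  assumes S: "open S" "x \<in> S"
    and f: "\<And>y. y \<in> S \<Longrightarrow> f differentiable (at y)"
    and fu: "(\<lambda>y. der f y u) differentiable (at x)"
    and fv: "(\<lambda>y. der f y v) differentiable (at x)"
  shows "der (\<lambda>y. der f y u) x v =
    der (\<lambda>y. der f y v) x u"
proof -
  define \<Delta> where "\<Delta> h u v = f (x + h *\<^sub>R u + h *\<^sub>R v) - f (x + h *\<^sub>R u) - f (x + h *\<^sub>R v) + f x"
    for h and u v
  have key: "\<exists>\<delta>>0. \<forall>h. 0 < h \<and> h < \<delta> \<longrightarrow>
      norm (\<Delta> h u v - h\<^sup>2 *\<^sub>R der (\<lambda>y. der f y u) x v)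
        \<le> e * h\<^sup>2"
    if e: "e > 0" and fu: "(\<lambda>y. der f y u) differentiable (at x)" for e u v
  proof -
    define G where "G = (\<lambda>y. der f y u)"
    define H where "H = der G x"
    have GH: "(G has_derivative H) (at x)"
      using fu unfolding G_def H_def by (simp add: frechet_derivative_works)
    have linH: "linear H" using GH by (rule has_derivative_linear)
    define K where "K = 2 * (norm u + norm v) + 1"
    have K: "K > 0" unfolding K_def by (intro add_nonneg_pos mult_nonneg_nonneg add_nonneg_nonneg) auto
    obtain \<delta>1 where \<delta>1: "\<delta>1 > 0" and b1: "\<And>y. norm (y - x) < \<delta>1 \<Longrightarrow>
        norm (G y - G x - H (y - x)) \<le> e / K * norm (y - x)"
      using GH e K unfolding has_derivative_at_alt by (meson divide_pos_pos)
    obtain \<delta>2 where \<delta>2: "\<delta>2 > 0" and b2: "ball x \<delta>2 \<subseteq> S"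
      using S open_contains_ball by blast
    define \<delta> where "\<delta> = min \<delta>1 \<delta>2 / K"
    have \<delta>: "\<delta> > 0" using \<delta>1 \<delta>2 K by (simp add: \<delta>_def)
    have bound: "norm (\<Delta> h u v - h\<^sup>2 *\<^sub>R H v) \<le> e * h\<^sup>2" if h: "0 < h" "h < \<delta>" for h
    proof -
      have hK: "h * (norm u + norm v) < min \<delta>1 \<delta>2"
      proof -
        have "h * (norm u + norm v) \<le> h * K"
          unfolding K_def using h by (intro mult_left_mono) (auto simp: add_nonneg_nonneg)
        also have "\<dots> < min \<delta>1 \<delta>2" using h K by (simp add: \<delta>_def pos_less_divide_eq)
        finally show ?thesis .
      qed
      have small: "norm (t *\<^sub>R u + r *\<^sub>R v) \<le> h * (norm u + norm v)"
        if "0 \<le> t" "t \<le> h" "0 \<le> r" "r \<le> h" for t r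
      proof -
        have "norm (t *\<^sub>R u + r *\<^sub>R v) \<le> t * norm u + r * norm v"
          using that by (intro norm_triangle_le) simp
        also have "\<dots> \<le> h * norm u + h * norm v"
          using that by (intro add_mono mult_right_mono) auto
        finally show ?thesis by (simp add: distrib_left)
      qed
      define \<phi> where "\<phi> t = f (x + t *\<^sub>R u + h *\<^sub>R v) - f (x + t *\<^sub>R u) - (t * h) *\<^sub>R H v" for t
      define \<phi>' where "\<phi>' t = G (x + t *\<^sub>R u + h *\<^sub>R v) - G (x + t *\<^sub>R u) - h *\<^sub>R H v" for t
      have inS: "x + t *\<^sub>R u + r *\<^sub>R v \<in> S" if "0 \<le> t" "t \<le> h" "0 \<le> r" "r \<le> h" for t r
      proof -
        have "dist x (x + t *\<^sub>R u + r *\<^sub>R v) = norm (t *\<^sub>R u + r *\<^sub>R v)"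
          by (simp add: dist_norm norm_minus_commute add.assoc add.commute)
        then show ?thesis using small[OF that] hK b2 by auto
      qed
      have fd: "((\<lambda>t. f (x + t *\<^sub>R u + r *\<^sub>R v)) has_derivative (\<lambda>s. s *\<^sub>R G (x + t *\<^sub>R u + r *\<^sub>R v)))
          (at t within {0..h})" if t: "t \<in> {0..h}" and r: "0 \<le> r" "r \<le> h" for t r
      proof -
        have d: "(f has_derivative der f (x + t *\<^sub>R u + r *\<^sub>R v))
            (at (x + t *\<^sub>R u + r *\<^sub>R v))"
          using f[OF inS] t r frechet_has_derivative by auto
        have "((\<lambda>t. f (x + t *\<^sub>R u + r *\<^sub>R v)) has_derivative
            (\<lambda>s. der f (x + t *\<^sub>R u + r *\<^sub>R v) (s *\<^sub>R u))) (at t within {0..h})"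
          by (rule has_derivative_compose[where f = "\<lambda>t. x + t *\<^sub>R u + r *\<^sub>R v", OF _ d]) (auto intro!: derivative_eq_intros)
        then show ?thesis
          unfolding G_def using linear_cmul[OF has_derivative_linear[OF d]] by simp
      qed
      have \<phi>d: "(\<phi> has_derivative (\<lambda>s. s *\<^sub>R \<phi>' t)) (at t within {0..h})" if t: "t \<in> {0..h}" for t
        unfolding \<phi>_def \<phi>'_def
        using h fd[OF t, of h] fd[OF t, of 0]
        by (auto intro!: derivative_eq_intros simp: algebra_simps)
      have \<phi>'b: "norm (\<phi>' t) \<le> e * h" if t: "t \<in> {0..h}" for t
      proof -
        let ?w = "\<lambda>r. t *\<^sub>R u + r *\<^sub>R v"
        have n: "norm (G (x + ?w r) - G x - H (?w r)) \<le> e / K * (h * (norm u + norm v))"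
          if "r = 0 \<or> r = h" for r
        proof -
          have s: "norm (?w r) \<le> h * (norm u + norm v)"
            using small[of t 0] small[of t h] t h that by auto
          then have "norm (G (x + ?w r) - G x - H (?w r)) \<le> e / K * norm (?w r)"
            using b1[of "x + ?w r"] hK by simp
          also have "\<dots> \<le> e / K * (h * (norm u + norm v))"
            using s e K by (intro mult_left_mono) auto
          finally show ?thesis .
        qed
        have eq: "\<phi>' t = (G (x + ?w h) - G x - H (?w h)) - (G (x + ?w 0) - G x - H (?w 0))"
          unfolding \<phi>'_def
          by (simp add: linear_add[OF linH] linear_cmul[OF linH] linear_0[OF linH] algebra_simps)
        have "norm (\<phi>' t) \<le> e / K * (h * (norm u + norm v)) + e / K * (h * (norm u + norm v))"
          unfolding eq by (intro order_trans[OF norm_triangle_ineq4] add_mono n) auto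
        also have "\<dots> = e * h * (2 * (norm u + norm v) / K)" by (simp add: field_simps)
        also have "\<dots> \<le> e * h * 1"
          using e h K by (intro mult_left_mono) (auto simp: K_def)
        finally show ?thesis by simp
      qed
      have "norm (\<phi> h - \<phi> 0) \<le> (e * h) * norm (h - 0)"
      proof (rule differentiable_bound[of "{0..h}" \<phi> "\<lambda>t s. s *\<^sub>R \<phi>' t"])
        show "onorm (\<lambda>s. s *\<^sub>R \<phi>' t) \<le> e * h" if "t \<in> {0..h}" for t
          using \<phi>'b[OF that] by (intro onorm_bound) (use e h in \<open>auto simp: mult.commute
            intro: mult_left_mono\<close>)
      qed (use h \<phi>d in auto)
      moreover have "\<phi> h - \<phi> 0 = \<Delta> h u v - h\<^sup>2 *\<^sub>R H v"
        by (simp add: \<phi>_def \<Delta>_def power2_eq_square)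
      ultimately show ?thesis using h by (simp add: power2_eq_square mult.assoc)
    qed
    then show ?thesis using \<delta> unfolding H_def G_def by blast
  qed
  define A where "A = der (\<lambda>y. der f y u) x v"
  define B where "B = der (\<lambda>y. der f y v) x u"
  have "norm (A - B) \<le> e" if e: "e > 0" for e
  proof -
    obtain d1 where d1: "d1 > 0" "\<And>h. 0 < h \<Longrightarrow> h < d1 \<Longrightarrow> norm (\<Delta> h u v - h\<^sup>2 *\<^sub>R A) \<le> e / 2 * h\<^sup>2"
      using key[OF half_gt_zero[OF e] fu, of v] unfolding A_def by blast
    obtain d2 where d2: "d2 > 0" "\<And>h. 0 < h \<Longrightarrow> h < d2 \<Longrightarrow> norm (\<Delta> h v u - h\<^sup>2 *\<^sub>R B) \<le> e / 2 * h\<^sup>2"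
      using key[OF half_gt_zero[OF e] fv, of u] unfolding B_def by blast
    define h where "h = min d1 d2 / 2"
    have h: "0 < h" "h < d1" "h < d2" using d1(1) d2(1) by (auto simp: h_def)
    have sym: "\<Delta> h v u = \<Delta> h u v" by (simp add: \<Delta>_def algebra_simps)
    have "h\<^sup>2 *\<^sub>R (A - B) = (\<Delta> h v u - h\<^sup>2 *\<^sub>R B) - (\<Delta> h u v - h\<^sup>2 *\<^sub>R A)"
      by (simp add: sym algebra_simps)
    then have "norm (h\<^sup>2 *\<^sub>R (A - B)) \<le> e / 2 * h\<^sup>2 + e / 2 * h\<^sup>2"
      using d1(2)[OF h(1,2)] d2(2)[OF h(1,3)] norm_triangle_le_diff add_mono by metis
    then have "h\<^sup>2 * norm (A - B) \<le> h\<^sup>2 * e" by (simp add: mult.commute)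
    then show ?thesis using h(1) by simp
  qed
  then have "norm (A - B) \<le> 0" by (rule field_le_epsilon[of _ 0, simplified])
  then show ?thesis unfolding A_def B_def by simp
qed

lemma smooth_on_symmetric_second_derivative:
  assumes "open S" "x \<in> S" "smooth_on S f"
  shows "der (\<lambda>y. der f y u) x v =
    der (\<lambda>y. der f y v) x u"
  using assms
  by (intro symmetric_second_derivative[of S] smooth_on_imp_differentiable[of S]
      smooth_on_derivative_apply) auto

text \<open>The direction \<open>h y\<close> is expanded in a basis, so that only derivatives in fixed directions have
  to be differentiated.\<close>

lemma has_derivative_derivative_apply:
  fixes g :: "'d::euclidean_space \<Rightarrow> 'e::euclidean_space"
  assumes S: "open S" "x \<in> S" "g ` S \<subseteq> T" and f: "open T" "smooth_on T f"
    and g: "(g has_derivative g') (at x)" and h: "(h has_derivative h') (at x)"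
  shows "((\<lambda>y. der f (g y) (h y)) has_derivative
     (\<lambda>w. der (\<lambda>y. der f y (h x)) (g x) (g' w) +
        der f (g x) (h' w))) (at x)"
proof -
  have gT: "g y \<in> T" if "y \<in> S" for y using S that by auto
  have H: "((\<lambda>y. der f y b) has_derivative
      der (\<lambda>y. der f y b) (g x)) (at (g x))" for b
    by (rule smooth_on_has_derivative[OF smooth_on_derivative_apply[OF f(2)] gT[OF S(2)]])
  have expand: "der f y w = (\<Sum>b\<in>Basis. (w \<bullet> b) *\<^sub>R der f y b)"
    if "y \<in> T" for y w
    by (intro linear_eq_sum_Basis smooth_on_linear_derivative[OF f(2) that])
  have H_expand: "der (\<lambda>y. der f y (h x)) (g x) v =
      (\<Sum>b\<in>Basis. (h x \<bullet> b) *\<^sub>R der (\<lambda>y. der f y b) (g x) v)"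
    for v
  proof -
    have "((\<lambda>y. \<Sum>b\<in>Basis. (h x \<bullet> b) *\<^sub>R der f y b) has_derivative
      (\<lambda>v. \<Sum>b\<in>Basis. (h x \<bullet> b) *\<^sub>R
         der (\<lambda>y. der f y b) (g x) v)) (at (g x))"
      by (intro has_derivative_sum has_derivative_scaleR_right H)
    then have "((\<lambda>y. der f y (h x)) has_derivative
      (\<lambda>v. \<Sum>b\<in>Basis. (h x \<bullet> b) *\<^sub>R
         der (\<lambda>y. der f y b) (g x) v)) (at (g x))"
      by (rule has_derivative_transform_within_open[OF _ f(1) gT[OF S(2)]]) (simp add: expand)
    then show ?thesis by (simp add: frechet_derivative_eqI)
  qed
  have "((\<lambda>y. \<Sum>b\<in>Basis. (h y \<bullet> b) *\<^sub>R der f (g y) b) has_derivative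
      (\<lambda>w. \<Sum>b\<in>Basis. (h x \<bullet> b) *\<^sub>R
           der (\<lambda>y. der f y b) (g x) (g' w) +
         (h' w \<bullet> b) *\<^sub>R der f (g x) b)) (at x)"
    by (intro has_derivative_sum has_derivative_scaleR has_derivative_inner_left h
        has_derivative_compose[OF g H])
  then have "((\<lambda>y. der f (g y) (h y)) has_derivative
      (\<lambda>w. \<Sum>b\<in>Basis. (h x \<bullet> b) *\<^sub>R
           der (\<lambda>y. der f y b) (g x) (g' w) +
         (h' w \<bullet> b) *\<^sub>R der f (g x) b)) (at x)"
    by (rule has_derivative_transform_within_open[OF _ S(1,2)]) (simp add: expand gT)
  then show ?thesis
    unfolding sum.distrib H_expand[symmetric] expand[OF gT[OF S(2)], symmetric] .
qed

section \<open>Bump functions\<close>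

text \<open>The standard smooth function that vanishes with all its derivatives at \<open>0\<close>.\<close>

definition flat_exp :: "real \<Rightarrow> real" where
  "flat_exp t = (if t > 0 then exp (- inverse t) else 0)"

lemma poly_times_flat_exp_tendsto_0: "((\<lambda>t. poly q (inverse t) * flat_exp t) \<longlongrightarrow> 0) (at 0)"
proof -
  have "((\<lambda>y. \<Sum>i\<le>degree q. coeff q i * (y ^ i / exp y)) \<longlongrightarrow> (\<Sum>i\<le>degree q. coeff q i * 0)) at_top"
    by (intro tendsto_sum tendsto_mult tendsto_const tendsto_power_div_exp_0)
  then have "((\<lambda>y. poly q y * exp (- y)) \<longlongrightarrow> 0) at_top"
    by (simp add: poly_altdef sum_divide_distrib exp_minus divide_inverse sum_distrib_right mult.assoc)
  then have "((\<lambda>t. poly q (inverse t) * exp (- inverse t)) \<longlongrightarrow> 0) (at_right 0)"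
    by (rule filterlim_compose[OF _ filterlim_inverse_at_top_right])
  then have "((\<lambda>t. poly q (inverse t) * flat_exp t) \<longlongrightarrow> 0) (at_right 0)"
    by (rule Lim_transform_eventually)
      (rule eventually_mono[OF eventually_at_right_less], simp add: flat_exp_def)
  moreover have "((\<lambda>t. poly q (inverse t) * flat_exp t) \<longlongrightarrow> 0) (at_left 0)"
    by (rule Lim_transform_eventually[OF tendsto_const])
      (simp add: flat_exp_def eventually_at, auto intro: exI[of _ 1])
  ultimately show ?thesis by (simp add: filterlim_at_split)
qed

lemma poly_times_flat_exp_has_derivative:
  fixes p :: "real poly"
  defines "F \<equiv> \<lambda>q t. poly q (inverse t) * flat_exp t"
  shows "(F p has_real_derivative F ([:0, 0, 1:] * (p - pderiv p)) t) (at t)"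
proof (cases t "0::real" rule: linorder_cases)
  case less
  have "((\<lambda>_. 0) has_real_derivative 0) (at t)" by simp
  then have "(F p has_real_derivative 0) (at t)"
    by (rule has_field_derivative_transform_within_open[where S = "{..<0}"])
      (use less in \<open>auto simp: F_def flat_exp_def\<close>)
  then show ?thesis using less by (simp add: F_def flat_exp_def)
next
  case equal
  have "((\<lambda>h. (F p (0 + h) - F p 0) / h) \<longlongrightarrow> 0) (at 0)"
    using poly_times_flat_exp_tendsto_0[of "[:0, 1:] * p"]
    by (simp add: F_def flat_exp_def[of 0] divide_inverse mult_ac)
  then show ?thesis unfolding equal DERIV_def by (simp add: F_def flat_exp_def)
next
  case greater
  have "((\<lambda>t. poly p (inverse t) * exp (- inverse t)) has_real_derivative
      F ([:0, 0, 1:] * (p - pderiv p)) t) (at t)"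
    using greater
    by (auto intro!: derivative_eq_intros DERIV_chain2[OF poly_DERIV]
        simp: F_def flat_exp_def power2_eq_square algebra_simps)
  then show ?thesis
    by (rule has_field_derivative_transform_within_open[where S = "{0<..}"])
      (use greater in \<open>auto simp: F_def flat_exp_def\<close>)
qed

text \<open>The functions \<open>p(1/t) flat_exp t\<close>, for polynomials \<open>p\<close>, are closed under differentiation.\<close>

lemma smooth_on_flat_exp: "smooth_on UNIV flat_exp"
proof -
  define F where "F q t = poly q (inverse t) * flat_exp t" for q t
  have D: "(F p has_derivative (*) (F ([:0, 0, 1:] * (p - pderiv p)) t)) (at t)" for p t
    using poly_times_flat_exp_has_derivative[of p t]
    unfolding has_field_derivative_def F_def .
  have "Ck_on k UNIV (F p)" for k p
  proof (induction k arbitrary: p)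
    case 0
    show ?case
      unfolding Ck_on.simps by (rule has_derivative_continuous_on[OF D])
  next
    case (Suc k)
    have "F p differentiable (at x)" for x
      using D by (auto simp: differentiable_def)
    moreover have "Ck_on k UNIV (\<lambda>x. der (F p) x v)" for v
      unfolding frechet_derivative_eqI[OF D]
      by (intro Ck_on_bilinear[OF bounded_bilinear_mult] Suc.IH Ck_on_const open_UNIV)
    ultimately show ?case by simp
  qed
  then have "smooth_on UNIV (F 1)" by (simp add: smooth_on_def)
  then show ?thesis by (simp add: F_def[abs_def])
qed

text \<open>A constant multiple of \<open>flat_exp (c - flat_exp (\<bar>x - a\<bar>\<^sup>2 - (r/2)\<^sup>2))\<close>. The inner function vanishes on
  the ball of radius \<open>r/2\<close>, which makes the outer one constant there; outside the ball of radius \<open>r\<close>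
  the inner one is at least \<open>c = flat_exp (r\<^sup>2 - (r/2)\<^sup>2)\<close>, and the outer one vanishes.\<close>

lemma bump_function:
  fixes a :: "'e::euclidean_space"
  assumes r: "r > 0"
  obtains \<rho> :: "'e \<Rightarrow> real" and e where "smooth_on UNIV \<rho>" "0 < e"
    "\<And>x. x \<in> ball a e \<Longrightarrow> \<rho> x = 1" "\<And>x. x \<notin> ball a r \<Longrightarrow> \<rho> x = 0"
proof -
  define u where "u x = (x - a) \<bullet> (x - a)" for x :: 'e
  define c where "c = flat_exp (r\<^sup>2 - (r / 2)\<^sup>2)"
  define \<psi> where "\<psi> x = flat_exp (c - flat_exp (u x - (r / 2)\<^sup>2))" for x
  have pos: "flat_exp t > 0" if "t > 0" for t using that by (simp add: flat_exp_def)
  have mono: "flat_exp s \<le> flat_exp t" if "s \<le> t" for s t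
    using that by (auto simp: flat_exp_def le_imp_inverse_le)
  have c: "c > 0" unfolding c_def using r by (intro pos) (simp add: power2_eq_square field_simps)
  have comp: "smooth_on UNIV (\<lambda>x. flat_exp (f x))" if "smooth_on UNIV f" for f :: "'e \<Rightarrow> real"
    by (rule smooth_on_compose[OF open_UNIV that smooth_on_flat_exp]) simp
  have sm: "smooth_on UNIV \<psi>"
    unfolding \<psi>_def u_def
    by (intro comp smooth_on_diff smooth_on_const smooth_on_inner smooth_on_ident open_UNIV)
  have in0: "\<psi> x = flat_exp c" if "x \<in> ball a (r / 2)" for x
  proof -
    have "u x = (norm (x - a))\<^sup>2" by (simp add: u_def power2_norm_eq_inner)
    also have "\<dots> \<le> (r / 2)\<^sup>2"
      using that by (intro power_mono) (auto simp: dist_norm norm_minus_commute)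
    finally show ?thesis by (simp add: \<psi>_def flat_exp_def[of "u x - _"])
  qed
  have out0: "\<psi> x = 0" if "x \<notin> ball a r" for x
  proof -
    have "r\<^sup>2 \<le> (norm (x - a))\<^sup>2"
      using that r by (intro power_mono) (auto simp: dist_norm norm_minus_commute)
    also have "\<dots> = u x" by (simp add: u_def power2_norm_eq_inner)
    finally have "c \<le> flat_exp (u x - (r / 2)\<^sup>2)" unfolding c_def by (intro mono) simp
    then show ?thesis by (simp add: \<psi>_def flat_exp_def[of "c - _"])
  qed
  show ?thesis
  proof (rule that[of "\<lambda>x. inverse (flat_exp c) * \<psi> x" "r / 2"])
    show "smooth_on UNIV (\<lambda>x. inverse (flat_exp c) * \<psi> x)"
      by (intro smooth_on_mult open_UNIV smooth_on_const sm)
  qed (use r in0 out0 pos[OF c] in auto)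
qed

section \<open>Linear algebra of the fibre\<close>

lemma independent_family_iff:
  fixes e :: "'i \<Rightarrow> 'v::real_vector"
  assumes I: "finite I"
  shows "inj_on e I \<and> independent (e ` I) \<longleftrightarrow>
    (\<forall>c. (\<Sum>i\<in>I. c i *\<^sub>R e i) = 0 \<longrightarrow> (\<forall>i\<in>I. c i = 0))" (is "?L \<longleftrightarrow> ?R")
proof
  assume L: ?L
  show ?R
  proof (intro allI impI ballI)
    fix c i assume c: "(\<Sum>i\<in>I. c i *\<^sub>R e i) = 0" and i: "i \<in> I"
    define u where "u v = c (inv_into I e v)" for v
    have "(\<Sum>v\<in>e ` I. u v *\<^sub>R v) = (\<Sum>i\<in>I. u (e i) *\<^sub>R e i)"
      using L by (simp add: sum.reindex)
    also have "\<dots> = (\<Sum>i\<in>I. c i *\<^sub>R e i)"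
      using L by (intro sum.cong) (auto simp: u_def)
    finally have "u (e i) = 0"
      using independentD[of "e ` I" "e ` I" u "e i"] L I i c by auto
    then show "c i = 0" using L i by (simp add: u_def)
  qed
next
  assume R: ?R
  have inj: "inj_on e I"
  proof (rule inj_onI, rule ccontr)
    fix i j assume ij: "i \<in> I" "j \<in> I" "e i = e j" "i \<noteq> j"
    define c where "c k = (if k = i then 1 else if k = j then -1 else 0 :: real)" for k
    have "(\<Sum>k\<in>I. c k *\<^sub>R e k) = (\<Sum>k\<in>I. (if k = i then e k else 0) - (if k = j then e k else 0))"
      using ij by (intro sum.cong) (auto simp: c_def)
    also have "\<dots> = 0" using ij I by (simp add: sum_subtractf)
    finally have "c i = 0" using R ij by blast
    then show False by (simp add: c_def)
  qed
  moreover have "independent (e ` I)"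
  proof (rule independent_if_scalars_zero)
    fix u v assume u: "(\<Sum>x\<in>e ` I. u x *\<^sub>R x) = 0" and "v \<in> e ` I"
    then obtain i where i: "i \<in> I" "v = e i" by auto
    from u have "(\<Sum>i\<in>I. u (e i) *\<^sub>R e i) = 0" using inj by (simp add: sum.reindex)
    then show "u v = 0" using R[rule_format, of "\<lambda>i. u (e i)" i] i by simp
  qed (use I in simp)
  ultimately show ?L by simp
qed

lemma span_family:
  fixes e :: "'i \<Rightarrow> 'v::real_vector"
  assumes "finite I" "x \<in> span (e ` I)"
  obtains c where "x = (\<Sum>i\<in>I. c i *\<^sub>R e i)"
proof -
  have "\<exists>c. x = (\<Sum>i\<in>I. c i *\<^sub>R e i)"
    using assms
  proof (induction I arbitrary: x rule: finite_induct)
    case (insert j I)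
    then obtain k where "x - k *\<^sub>R e j \<in> span (e ` I)" by (auto simp: span_insert)
    then obtain c where c: "x - k *\<^sub>R e j = (\<Sum>i\<in>I. c i *\<^sub>R e i)" using insert.IH by blast
    have "(\<Sum>i\<in>I. (c(j := k)) i *\<^sub>R e i) = (\<Sum>i\<in>I. c i *\<^sub>R e i)"
      using insert.hyps(2) by (intro sum.cong) auto
    then have "x = (\<Sum>i\<in>insert j I. (c(j := k)) i *\<^sub>R e i)"
      using insert.hyps c by (simp add: algebra_simps)
    then show ?case by blast
  qed simp
  then show ?thesis using that by blast
qed

text \<open>The fibre of \<open>E(M)\<close> as a Euclidean space: covectors become vectors by means of the inner product.
  The metric turns into half of \<open>\<langle>x, swap y\<rangle>\<close>.\<close>

definition gvec_iso :: "'e::euclidean_space gvec \<Rightarrow> 'e \<times> 'e" where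
  "gvec_iso a = (fst a, \<Sum>b\<in>Basis. blinfun_apply (snd a) b *\<^sub>R b)"

lemma bounded_linear_gvec_iso: "bounded_linear gvec_iso"
  unfolding gvec_iso_def
  by (intro bounded_linear_intros bounded_linear_sum bounded_linear_scaleR_const
      bounded_linear_compose[OF blinfun.bounded_linear_left bounded_linear_snd]
      bounded_linear_Pair bounded_linear_fst)

lemma linear_gvec_iso: "linear gvec_iso"
  by (rule bounded_linear.linear[OF bounded_linear_gvec_iso])

lemma blinfun_apply_conv_inner:
  "blinfun_apply (\<alpha> :: 'e::euclidean_space \<Rightarrow>\<^sub>L real) v = (\<Sum>b\<in>Basis. blinfun_apply \<alpha> b *\<^sub>R b) \<bullet> v"
  using linear_eq_sum_Basis[of "blinfun_apply \<alpha>" v, OF bounded_linear.linear[OF blinfun.bounded_linear_right]]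
  by (simp add: inner_sum_left inner_commute[of v] mult.commute)

lemma inj_gvec_iso: "inj gvec_iso"
proof (rule injI)
  fix a b :: "'e::euclidean_space gvec"
  assume eq: "gvec_iso a = gvec_iso b"
  then have "blinfun_apply (snd a) v = blinfun_apply (snd b) v" for v
    unfolding blinfun_apply_conv_inner[of "snd a" v] blinfun_apply_conv_inner[of "snd b" v]
    by (simp add: gvec_iso_def)
  then have "snd a = snd b" by (rule blinfun_eqI)
  then show "a = b" using eq by (simp add: gvec_iso_def prod_eq_iff)
qed

lemma gvec_iso_surj: "\<exists>a. gvec_iso a = z"
  by (rule exI[of _ "(fst z, blinfun_inner_left (snd z))"])
    (simp add: gvec_iso_def prod_eq_iff inner_commute[of _ "snd z"] euclidean_representation)

lemma metric_E_conv_inner: "metric_E a b = (gvec_iso a \<bullet> prod.swap (gvec_iso b)) / 2"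
  unfolding metric_E_def gvec_iso_def
  using blinfun_apply_conv_inner[of "snd a" "fst b"] blinfun_apply_conv_inner[of "snd b" "fst a"]
  by (simp add: inner_prod_def inner_commute)

lemma bounded_linear_swap: "bounded_linear (prod.swap :: 'a::real_normed_vector \<times> 'b::real_normed_vector \<Rightarrow> _)"
  unfolding prod.swap_def by (intro bounded_linear_Pair bounded_linear_fst bounded_linear_snd)

lemma bounded_bilinear_metric_E: "bounded_bilinear (metric_E :: 'e::euclidean_space gvec \<Rightarrow> _)"
proof -
  have "metric_E = (\<lambda>a b :: 'e gvec. gvec_iso a \<bullet> ((1/2) *\<^sub>R prod.swap (gvec_iso b)))"
    by (intro ext) (simp add: metric_E_conv_inner)
  moreover have "bounded_bilinear \<dots>"
    by (intro bounded_bilinear.comp[OF bounded_bilinear_inner bounded_linear_gvec_iso]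
        bounded_linear_compose[OF bounded_linear_scaleR_right]
        bounded_linear_compose[OF bounded_linear_swap] bounded_linear_gvec_iso)
  ultimately show ?thesis by metis
qed

interpretation metric_E: bounded_bilinear metric_E
  by (rule bounded_bilinear_metric_E)

lemma metric_E_commute: "metric_E a b = metric_E b a"
  by (simp add: metric_E_def)

text \<open>Let \<open>K\<close> be a totally isotropic subspace for the split form \<open>\<langle>x, swap y\<rangle>\<close> on \<open>V \<times> V\<close>. As the
  form is nondegenerate, the orthogonal space of \<open>K\<close> has dimension \<open>2n - dim K\<close>; it contains \<open>K\<close>,
  whence \<open>dim K \<le> n\<close>, with equality only if \<open>K\<close> is its own orthogonal space.\<close>

context
  fixes K :: "('e::euclidean_space \<times> 'e) set"
  assumes K: "subspace K" and null: "\<And>x y. x \<in> K \<Longrightarrow> y \<in> K \<Longrightarrow> x \<bullet> prod.swap y = 0"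
begin

lemma dim_swap_perp: "dim {x. \<forall>y\<in>K. x \<bullet> prod.swap y = 0} + dim K = 2 * DIM('e)"
proof -
  have "dim (prod.swap ` K) = dim K"
    by (intro dim_image_eq bounded_linear.linear[OF bounded_linear_swap])
      (auto simp: inj_on_def)
  moreover have "{x. \<forall>y\<in>K. x \<bullet> prod.swap y = 0} = {y \<in> UNIV. \<forall>x\<in>prod.swap ` K. orthogonal x y}"
    by (auto simp: orthogonal_def inner_commute)
  moreover have "subspace (prod.swap ` K)"
    by (intro linear_subspace_image K bounded_linear.linear[OF bounded_linear_swap])
  ultimately show ?thesis
    using dim_subspace_orthogonal_to_vectors[of "prod.swap ` K" UNIV] by simp
qed

lemma subset_swap_perp: "K \<subseteq> {x. \<forall>y\<in>K. x \<bullet> prod.swap y = 0}"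
  using null by auto

lemma subspace_swap_perp: "subspace {x. \<forall>y\<in>K. x \<bullet> prod.swap y = 0}"
  by (auto simp: subspace_def inner_add_left)

lemma dim_null_le: "dim K \<le> DIM('e)"
  using dim_swap_perp dim_subset[OF subset_swap_perp] by linarith

lemma swap_perp_eq: "dim K = DIM('e) \<Longrightarrow> {x. \<forall>y\<in>K. x \<bullet> prod.swap y = 0} = K"
  using subspace_dim_equal[OF K subspace_swap_perp subset_swap_perp] dim_swap_perp by simp

text \<open>If \<open>dim K < n\<close>, the orthogonal space of \<open>K\<close> has more than \<open>n\<close> dimensions. So it meets the graphs
  of the identity and of its negative, on which the form is positive and negative definite. A positive
  vector \<open>x\<close> and a negative vector \<open>y\<close> give two null vectors \<open>x \<plusminus> t y\<close>. They are not both in \<open>K\<close>,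
  since \<open>x\<close> is not.\<close>

lemma null_extension:
  assumes small: "dim K < DIM('e)"
  shows "\<exists>x. x \<notin> K \<and> x \<bullet> prod.swap x = 0 \<and> (\<forall>y\<in>K. x \<bullet> prod.swap y = 0)"
proof -
  define W where "W = {x. \<forall>y\<in>K. x \<bullet> prod.swap y = 0}"
  have W: "subspace W" "dim W > DIM('e)"
    using subspace_swap_perp dim_swap_perp small unfolding W_def by auto
  have meets: "\<exists>v. v \<noteq> 0 \<and> (v, \<sigma> *\<^sub>R v) \<in> W" for \<sigma> :: real
  proof -
    define f where "f v = (v, \<sigma> *\<^sub>R v)" for v :: 'e
    have f: "linear f" unfolding f_def
      by (intro bounded_linear.linear bounded_linear_Pair bounded_linear_ident
          bounded_linear_scaleR_right)
    have "dim (range f) = DIM('e)"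
      using dim_image_eq[OF f, of UNIV] by (simp add: f_def inj_on_def)
    moreover have "subspace (range f)" by (rule linear_subspace_image[OF f]) simp
    ultimately have "dim {x + y |x y. x \<in> W \<and> y \<in> range f} + dim (W \<inter> range f) = dim W + DIM('e)"
      using dim_sums_Int[OF W(1)] by simp
    moreover have "dim {x + y |x y. x \<in> W \<and> y \<in> range f} \<le> 2 * DIM('e)"
      using dim_subset_UNIV[of "{x + y |x y. x \<in> W \<and> y \<in> range f}"] by simp
    ultimately have "dim (W \<inter> range f) > 0" using W(2) by linarith
    then have "\<not> W \<inter> range f \<subseteq> {0}" by (metis dim_eq_0 less_irrefl)
    then obtain v where "f v \<in> W" "f v \<noteq> 0" by blast
    moreover from this have "v \<noteq> 0" using linear_0[OF f] by auto
    ultimately show ?thesis by (auto simp: f_def)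
  qed
  obtain v where v: "v \<noteq> 0" "(v, 1 *\<^sub>R v) \<in> W" using meets by blast
  obtain w where w: "w \<noteq> 0" "(w, (- 1) *\<^sub>R w) \<in> W" using meets by blast
  define x y where "x = (v, v)" and "y = (w, - w)"
  have xy: "x \<in> W" "y \<in> W" using v w by (auto simp: x_def y_def)
  have pos: "x \<bullet> prod.swap x > 0" and neg: "y \<bullet> prod.swap y < 0"
    and xy0: "x \<bullet> prod.swap y = 0" "y \<bullet> prod.swap x = 0"
    using v w by (auto simp: x_def y_def inner_commute)
  define t where "t = norm v / norm w"
  have t: "t > 0" using v w by (simp add: t_def)
  have combo: "(x + \<sigma> *\<^sub>R y) \<bullet> prod.swap (x + \<sigma> *\<^sub>R y) = 0" if "\<sigma>\<^sup>2 = t\<^sup>2" for \<sigma>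
  proof -
    have "(x + \<sigma> *\<^sub>R y) \<bullet> prod.swap (x + \<sigma> *\<^sub>R y) = 2 * (norm v)\<^sup>2 - 2 * \<sigma>\<^sup>2 * (norm w)\<^sup>2"
      by (simp add: x_def y_def power2_norm_eq_inner power2_eq_square[of \<sigma>] algebra_simps
          inner_commute[of v w])
    then show ?thesis using w(1) unfolding that t_def by (simp add: power_divide)
  qed
  have inW: "x + \<sigma> *\<^sub>R y \<in> W" for \<sigma>
    using xy W(1) by (simp add: subspace_add subspace_scale)
  have "x + t *\<^sub>R y \<notin> K \<or> x + (- t) *\<^sub>R y \<notin> K"
  proof (rule ccontr)
    assume "\<not> ?thesis"
    then have k: "x + t *\<^sub>R y \<in> K" "x + (- t) *\<^sub>R y \<in> K" by auto
    have "(1/2) *\<^sub>R ((x + t *\<^sub>R y) + (x + (- t) *\<^sub>R y)) \<in> K"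
      by (intro subspace_scale[OF K] subspace_add[OF K] k)
    moreover have "(1/2) *\<^sub>R ((x + t *\<^sub>R y) + (x + (- t) *\<^sub>R y)) = x"
      by (simp add: scaleR_add_right[symmetric] flip: scaleR_2)
    ultimately show False using null[of x x] pos by simp
  qed
  then obtain \<sigma> where "\<sigma>\<^sup>2 = t\<^sup>2" "x + \<sigma> *\<^sub>R y \<notin> K" by (metis power2_minus)
  then show ?thesis using combo inW unfolding W_def by blast
qed

end

lemma isotropic_image:
  "isotropic L \<longleftrightarrow> subspace (gvec_iso ` L) \<and>
    (\<forall>x\<in>gvec_iso ` L. \<forall>y\<in>gvec_iso ` L. x \<bullet> prod.swap y = 0)"
proof -
  have "subspace L" if "subspace (gvec_iso ` L)"
  proof -
    have "subspace (gvec_iso -` (gvec_iso ` L))"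
      by (rule linear_subspace_vimage[OF linear_gvec_iso that])
    then show ?thesis by (simp add: inj_vimage_image_eq[OF inj_gvec_iso])
  qed
  then show ?thesis
    unfolding isotropic_def metric_E_conv_inner
    using linear_subspace_image[OF linear_gvec_iso] by auto
qed

text \<open>Dimensions are taken in \<open>V \<times> V\<close>, where orthogonal complements are available.\<close>

definition gdim :: "'e::euclidean_space gvec set \<Rightarrow> nat" where
  "gdim L = dim (gvec_iso ` L)"

lemma isotropic_gdim_le: "isotropic L \<Longrightarrow> gdim L \<le> DIM('e)" for L :: "'e::euclidean_space gvec set"
  unfolding gdim_def isotropic_image by (intro dim_null_le) auto

lemma isotropic_insert:
  assumes L: "isotropic L" and a: "metric_E a a = 0" "\<And>b. b \<in> L \<Longrightarrow> metric_E a b = 0"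
  shows "isotropic (span (insert a L))"
proof -
  have "span L = L" using L by (simp add: isotropic_def span_eq_iff)
  have sp: "\<exists>b k. b \<in> L \<and> x = b + k *\<^sub>R a" if x: "x \<in> span (insert a L)" for x
  proof -
    obtain k where "x - k *\<^sub>R a \<in> L" using x unfolding span_insert \<open>span L = L\<close> by blast
    then show ?thesis by (intro exI[of _ "x - k *\<^sub>R a"] exI[of _ k]) simp
  qed
  have ba: "metric_E b a = 0" if "b \<in> L" for b
    using a(2)[OF that] metric_E_commute[of b a] by simp
  have "metric_E x y = 0" if xy: "x \<in> span (insert a L)" "y \<in> span (insert a L)" for x y
  proof -
    obtain b k b' k' where "b \<in> L" "x = b + k *\<^sub>R a" "b' \<in> L" "y = b' + k' *\<^sub>R a"
      using sp[OF xy(1)] sp[OF xy(2)] by blast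
    then show ?thesis
      using L a ba by (simp add: isotropic_def metric_E.add_left metric_E.add_right
          metric_E.scaleR_left metric_E.scaleR_right)
  qed
  then show ?thesis by (simp add: isotropic_def)
qed

lemma maximal_isotropic_iff:
  "maximal_isotropic L \<longleftrightarrow> isotropic L \<and> gdim L = DIM('e)" for L :: "'e::euclidean_space gvec set"
proof safe
  assume max: "maximal_isotropic L"
  then show iso: "isotropic L" by (simp add: maximal_isotropic_def)
  show "gdim L = DIM('e)"
  proof (rule ccontr)
    assume "gdim L \<noteq> DIM('e)"
    then have "dim (gvec_iso ` L) < DIM('e)"
      using isotropic_gdim_le[OF iso] by (simp add: gdim_def)
    then have "\<exists>x. x \<notin> gvec_iso ` L \<and> x \<bullet> prod.swap x = 0 \<and> (\<forall>y\<in>gvec_iso ` L. x \<bullet> prod.swap y = 0)"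
      using iso unfolding isotropic_image by (intro null_extension) auto
    then obtain x where x: "x \<notin> gvec_iso ` L" "x \<bullet> prod.swap x = 0"
      "\<And>y. y \<in> gvec_iso ` L \<Longrightarrow> x \<bullet> prod.swap y = 0"
      by blast
    obtain a where a: "gvec_iso a = x" using gvec_iso_surj by blast
    let ?L' = "span (insert a L)"
    have "isotropic ?L'"
      using x a by (intro isotropic_insert[OF iso]) (auto simp: metric_E_conv_inner)
    moreover have "L \<subseteq> ?L'" by (auto intro: span_base)
    ultimately have "?L' = L" using max by (simp add: maximal_isotropic_def)
    moreover have "a \<in> ?L'" by (simp add: span_base)
    ultimately show False using x(1) a by auto
  qed
next
  assume iso: "isotropic L" and d: "gdim L = DIM('e)"
  have "L' = L" if L': "isotropic L'" "L \<subseteq> L'" for L'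
  proof -
    have "gvec_iso ` L = gvec_iso ` L'"
      using iso L' isotropic_gdim_le[OF L'(1)] d
      by (intro subspace_dim_equal) (auto simp: isotropic_image gdim_def)
    then show ?thesis by (simp add: inj_image_eq_iff[OF inj_gvec_iso])
  qed
  then show "maximal_isotropic L" using iso by (simp add: maximal_isotropic_def)
qed

lemma maximal_isotropic_perp:
  assumes "maximal_isotropic L" "\<And>b. b \<in> L \<Longrightarrow> metric_E a b = 0"
  shows "a \<in> L"
proof -
  have "{x. \<forall>y\<in>gvec_iso ` L. x \<bullet> prod.swap y = 0} = gvec_iso ` L"
    using assms(1) unfolding maximal_isotropic_iff isotropic_image gdim_def
    by (intro swap_perp_eq) auto
  then have "gvec_iso a \<in> gvec_iso ` L"
    using assms(2) by (auto simp: metric_E_conv_inner)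
  then show ?thesis by (simp add: inj_image_mem_iff[OF inj_gvec_iso])
qed

lemma gdim_frame:
  assumes "inj_on e I" "independent (e ` I)"
  shows "gdim (span (e ` I)) = card I"
proof -
  have inj: "inj_on gvec_iso A" for A
    using inj_gvec_iso by (rule inj_on_subset) simp
  have "gvec_iso ` span (e ` I) = span (gvec_iso ` e ` I)"
    by (simp add: linear_span_image[OF linear_gvec_iso])
  moreover have "independent (gvec_iso ` e ` I)"
    by (rule linear_independent_injective_image[OF linear_gvec_iso assms(2) inj])
  ultimately have "gdim (span (e ` I)) = card (gvec_iso ` e ` I)"
    by (simp add: gdim_def dim_eq_card_independent)
  then show ?thesis using assms(1) by (simp add: card_image[OF inj] card_image)
qed

section \<open>Coefficients with respect to a smooth frame\<close>

lemma sum_times_delta: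
  "finite I \<Longrightarrow> i \<in> I \<Longrightarrow> (\<Sum>j\<in>I. c j * (if i = j then 1 else 0)) = (c i :: real)"
  by (simp add: if_distrib[of "\<lambda>t. _ * t"] cong: if_cong)

text \<open>The dual frame inside the span of the frame, built as in the Gram-Schmidt process: \<open>w\<close> is the
  component of the new vector orthogonal to the span of the previous ones, and the old dual vectors are
  corrected by multiples of \<open>w\<close>. Smoothness is visible, since one divides only by \<open>w \<bullet> w\<close>.\<close>

lemma smooth_dual_frame:
  fixes e :: "nat \<Rightarrow> 'd::euclidean_space \<Rightarrow> 'v::euclidean_space"
  assumes S: "open S" and "\<And>i. i < r \<Longrightarrow> smooth_on S (e i)"
    and "\<And>x c i. x \<in> S \<Longrightarrow> (\<Sum>i<r. c i *\<^sub>R e i x) = 0 \<Longrightarrow> i < r \<Longrightarrow> c i = 0"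
  shows "\<exists>\<theta>. (\<forall>i<r. smooth_on S (\<theta> i)) \<and>
     (\<forall>x\<in>S. \<forall>i<r. \<forall>j<r. \<theta> i x \<bullet> e j x = (if i = j then 1 else 0)) \<and>
     (\<forall>x\<in>S. \<forall>i<r. \<theta> i x \<in> span ((\<lambda>j. e j x) ` {..<r}))"
  using assms(2,3)
proof (induction r)
  case 0
  then show ?case by auto
next
  case (Suc r)
  have ind: "c i = 0" if "x \<in> S" "(\<Sum>i<r. c i *\<^sub>R e i x) = 0" "i < r" for x c i
    using Suc.prems(2)[of x "\<lambda>i. if i < r then c i else 0" i] that by auto
  have "\<exists>\<theta>. (\<forall>i<r. smooth_on S (\<theta> i)) \<and>
     (\<forall>x\<in>S. \<forall>i<r. \<forall>j<r. \<theta> i x \<bullet> e j x = (if i = j then 1 else 0)) \<and>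
     (\<forall>x\<in>S. \<forall>i<r. \<theta> i x \<in> span ((\<lambda>j. e j x) ` {..<r}))"
    by (rule Suc.IH) (use Suc.prems(1) ind in auto)
  then obtain \<theta> where IH: "\<forall>i<r. smooth_on S (\<theta> i)"
    "\<forall>x\<in>S. \<forall>i<r. \<forall>j<r. \<theta> i x \<bullet> e j x = (if i = j then 1 else 0)"
    "\<forall>x\<in>S. \<forall>i<r. \<theta> i x \<in> span ((\<lambda>j. e j x) ` {..<r})"
    by blast
  have \<theta>: "smooth_on S (\<theta> i)" if "i < r" for i
    using IH(1) that by blast
  have dual: "\<theta> i x \<bullet> e j x = (if i = j then 1 else 0)" if "x \<in> S" "i < r" "j < r" for x i j
    using IH(2) that by blast
  have sp: "\<theta> i x \<in> span ((\<lambda>j. e j x) ` {..<r})" if "x \<in> S" "i < r" for x i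
    using IH(3) that by blast
  define w where "w x = e r x - (\<Sum>i<r. (e r x \<bullet> \<theta> i x) *\<^sub>R e i x)" for x
  have w_smooth: "smooth_on S w"
    unfolding w_def using Suc.prems(1) \<theta>
    by (intro smooth_on_diff smooth_on_sum smooth_on_scaleR smooth_on_inner S) auto
  have w_perp_\<theta>: "w x \<bullet> \<theta> k x = 0" if "x \<in> S" "k < r" for x k
  proof -
    have "(\<Sum>i<r. (e r x \<bullet> \<theta> i x) *\<^sub>R e i x) \<bullet> \<theta> k x = (\<Sum>i<r. (e r x \<bullet> \<theta> i x) * (if k = i then 1 else 0))"
      unfolding inner_sum_left by (intro sum.cong) (use that dual in \<open>auto simp: inner_commute\<close>)
    then show ?thesis using that by (simp add: w_def inner_diff_left sum_times_delta)
  qed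
  have w_perp: "w x \<bullet> e j x = 0" if x: "x \<in> S" and j: "j < r" for x j
  proof -
    \<comment> \<open>\<open>P\<close> lies in the span of the frame and is orthogonal to it, so that \<open>e j x\<close> is a combination
      of the dual vectors.\<close>
    define P where "P = e j x - (\<Sum>i<r. (e j x \<bullet> e i x) *\<^sub>R \<theta> i x)"
    have P_e: "P \<bullet> e k x = 0" if "k < r" for k
    proof -
      have "(\<Sum>i<r. (e j x \<bullet> e i x) *\<^sub>R \<theta> i x) \<bullet> e k x = (\<Sum>i<r. (e j x \<bullet> e i x) * (if k = i then 1 else 0))"
        unfolding inner_sum_left by (intro sum.cong) (use that x in \<open>auto simp: dual\<close>)
      then show ?thesis using that by (simp add: P_def inner_diff_left sum_times_delta)
    qed
    have perp: "orthogonal P y" if "y \<in> span ((\<lambda>i. e i x) ` {..<r})" for y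
      by (rule orthogonal_to_span[OF that]) (auto simp: orthogonal_def P_e)
    have "P \<in> span ((\<lambda>i. e i x) ` {..<r})"
      unfolding P_def using sp[OF x] j by (intro span_diff span_sum span_scale) (auto intro: span_base)
    then have "P = 0" using perp[of P] by (simp add: orthogonal_self)
    then have P_eq: "(\<Sum>i<r. (e j x \<bullet> e i x) *\<^sub>R \<theta> i x) = e j x" by (simp add: P_def)
    have "w x \<bullet> e j x = w x \<bullet> (\<Sum>i<r. (e j x \<bullet> e i x) *\<^sub>R \<theta> i x)" by (simp only: P_eq)
    also have "\<dots> = 0" using w_perp_\<theta>[OF x] by (simp add: inner_sum_right)
    finally show ?thesis .
  qed
  have w_nz: "w x \<noteq> 0" if x: "x \<in> S" for x
  proof
    assume "w x = 0"
    define c where "c i = (if i = r then 1 else - (e r x \<bullet> \<theta> i x))" for i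
    have "(\<Sum>i<Suc r. c i *\<^sub>R e i x) = w x"
      by (simp add: c_def w_def sum_negf)
    then have "c r = 0" using Suc.prems(2)[OF x, of c r] \<open>w x = 0\<close> by simp
    then show False by (simp add: c_def)
  qed
  have w_e: "w x \<bullet> e r x = w x \<bullet> w x" if x: "x \<in> S" for x
  proof -
    have e_eq: "w x + (\<Sum>i<r. (e r x \<bullet> \<theta> i x) *\<^sub>R e i x) = e r x" by (simp add: w_def)
    have "w x \<bullet> e r x = w x \<bullet> (w x + (\<Sum>i<r. (e r x \<bullet> \<theta> i x) *\<^sub>R e i x))" by (simp only: e_eq)
    also have "\<dots> = w x \<bullet> w x" using w_perp[OF x] by (simp add: inner_sum_right inner_add_right)
    finally show ?thesis .
  qed
  define \<theta>r where "\<theta>r x = inverse (w x \<bullet> w x) *\<^sub>R w x" for x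
  have \<theta>r: "smooth_on S \<theta>r"
    unfolding \<theta>r_def using w_nz
    by (intro smooth_on_scaleR smooth_on_inverse smooth_on_inner w_smooth S) auto
  have \<theta>r_e: "\<theta>r x \<bullet> e j x = (if j = r then 1 else 0)" if "x \<in> S" "j < Suc r" for x j
    using that w_perp w_e w_nz by (auto simp: \<theta>r_def less_Suc_eq)
  define \<theta>' where "\<theta>' i x = (if i = r then \<theta>r x else \<theta> i x - (\<theta> i x \<bullet> e r x) *\<^sub>R \<theta>r x)" for i x
  have sub: "y \<in> span ((\<lambda>j. e j x) ` {..<Suc r})" if "y \<in> span ((\<lambda>j. e j x) ` {..<r})" for x y
    by (rule set_mp[OF span_mono that]) auto
  have "smooth_on S (\<theta>' i)" if "i < Suc r" for i
  proof (cases "i = r")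
    case True
    then show ?thesis using \<theta>r by (simp add: \<theta>'_def[abs_def])
  next
    case False
    have "smooth_on S (\<lambda>x. \<theta> i x - (\<theta> i x \<bullet> e r x) *\<^sub>R \<theta>r x)"
      using \<theta>[of i] Suc.prems(1)[of r] that False
      by (intro smooth_on_diff smooth_on_scaleR smooth_on_inner S \<theta>r) auto
    then show ?thesis using False by (simp add: \<theta>'_def[abs_def])
  qed
  moreover have "\<theta>' i x \<bullet> e j x = (if i = j then 1 else 0)"
    if "x \<in> S" "i < Suc r" "j < Suc r" for x i j
    using that dual[of x i j] \<theta>r_e[of x j]
    by (auto simp: \<theta>'_def inner_diff_left less_Suc_eq)
  moreover have "\<theta>' i x \<in> span ((\<lambda>j. e j x) ` {..<Suc r})" if x: "x \<in> S" and i: "i < Suc r" for x i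
  proof -
    have "w x \<in> span ((\<lambda>j. e j x) ` {..<Suc r})"
      unfolding w_def by (intro span_diff span_sum span_scale span_base) auto
    then have "\<theta>r x \<in> span ((\<lambda>j. e j x) ` {..<Suc r})"
      unfolding \<theta>r_def by (rule span_scale)
    then show ?thesis
      using sub[OF sp[OF x]] i by (auto simp: \<theta>'_def less_Suc_eq intro!: span_diff span_scale)
  qed
  ultimately show ?case by blast
qed

text \<open>The coefficients are the inner products with the dual frame.\<close>

lemma smooth_frame_coefficients:
  fixes e :: "nat \<Rightarrow> 'd::euclidean_space \<Rightarrow> 'e::euclidean_space gvec"
  assumes S: "open S" and e: "\<And>i. i < r \<Longrightarrow> smooth_on S (e i)" and s: "smooth_on S s"
    and ind: "\<And>x c i. x \<in> S \<Longrightarrow> (\<Sum>i<r. c i *\<^sub>R e i x) = 0 \<Longrightarrow> i < r \<Longrightarrow> c i = 0"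
    and sp: "\<And>x. x \<in> S \<Longrightarrow> s x \<in> span ((\<lambda>i. e i x) ` {..<r})"
  shows "\<exists>f. (\<forall>i<r. smooth_on S (f i)) \<and> (\<forall>x\<in>S. s x = (\<Sum>i<r. f i x *\<^sub>R e i x))"
proof -
  have sum_iso: "(\<Sum>i<r. c i *\<^sub>R gvec_iso (e i x)) = gvec_iso (\<Sum>i<r. c i *\<^sub>R e i x)" for c x
    by (simp add: linear_sum[OF linear_gvec_iso] linear_cmul[OF linear_gvec_iso])
  have "c i = 0" if x: "x \<in> S" "(\<Sum>i<r. c i *\<^sub>R gvec_iso (e i x)) = 0" "i < r" for x c i
  proof -
    have "gvec_iso (\<Sum>i<r. c i *\<^sub>R e i x) = gvec_iso 0"
      using x(2) by (simp add: sum_iso linear_0[OF linear_gvec_iso])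
    then show ?thesis using ind[OF x(1) injD[OF inj_gvec_iso] x(3)] by blast
  qed
  then have "\<exists>\<theta>. (\<forall>i<r. smooth_on S (\<theta> i)) \<and>
     (\<forall>x\<in>S. \<forall>i<r. \<forall>j<r. \<theta> i x \<bullet> gvec_iso (e j x) = (if i = j then 1 else 0)) \<and>
     (\<forall>x\<in>S. \<forall>i<r. \<theta> i x \<in> span ((\<lambda>j. gvec_iso (e j x)) ` {..<r}))"
    by (intro smooth_dual_frame S smooth_on_bounded_linear[OF bounded_linear_gvec_iso S e]) auto
  then obtain \<theta> where \<theta>': "\<forall>i<r. smooth_on S (\<theta> i)"
    "\<forall>x\<in>S. \<forall>i<r. \<forall>j<r. \<theta> i x \<bullet> gvec_iso (e j x) = (if i = j then 1 else 0)"
    by blast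
  have \<theta>: "smooth_on S (\<theta> i)" if "i < r" for i
    using \<theta>'(1) that by blast
  have dual: "\<theta> i x \<bullet> gvec_iso (e j x) = (if i = j then 1 else 0)" if "x \<in> S" "i < r" "j < r" for x i j
    using \<theta>'(2) that by blast
  define f where "f i x = \<theta> i x \<bullet> gvec_iso (s x)" for i x
  have "smooth_on S (f i)" if "i < r" for i
    unfolding f_def
    by (intro smooth_on_inner S \<theta> that smooth_on_bounded_linear[OF bounded_linear_gvec_iso S s])
  moreover have "s x = (\<Sum>i<r. f i x *\<^sub>R e i x)" if x: "x \<in> S" for x
  proof -
    obtain c where c: "s x = (\<Sum>i<r. c i *\<^sub>R e i x)"
      using span_family[OF finite_lessThan sp[OF x]] by blast
    have "f i x = c i" if i: "i < r" for i
    proof -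
      have "f i x = (\<Sum>j<r. c j * (\<theta> i x \<bullet> gvec_iso (e j x)))"
        by (simp add: f_def c sum_iso[symmetric] inner_sum_right)
      also have "\<dots> = (\<Sum>j<r. c j * (if i = j then 1 else 0))"
        by (intro sum.cong) (use dual x i in auto)
      finally show ?thesis using i by (simp add: sum_times_delta)
    qed
    then show ?thesis by (simp add: c)
  qed
  ultimately show ?thesis by blast
qed

section \<open>The Courant bracket in coordinates\<close>

text \<open>The Courant bracket of two sections that are given by their components in one chart.\<close>

definition coord_bracket :: "('e::euclidean_space \<Rightarrow> 'e gvec) \<Rightarrow> ('e \<Rightarrow> 'e gvec) \<Rightarrow> 'e \<Rightarrow> 'e gvec" where
  "coord_bracket s t x =
    (der (\<lambda>y. fst (t y)) x (fst (s x)) - der (\<lambda>y. fst (s y)) x (fst (t x)),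
     (der (\<lambda>y. snd (t y)) x (fst (s x))
        + (snd (t x) o\<^sub>L Blinfun (der (\<lambda>y. fst (s y)) x)))
     - (der (\<lambda>y. snd (s y)) x (fst (t x))
        + (snd (s x) o\<^sub>L Blinfun (der (\<lambda>y. fst (t y)) x)))
     + Blinfun (der (\<lambda>y. omega_E (s y) (t y)) x))"

lemma has_derivative_fst_snd:
  assumes "(s has_derivative s') (at x)"
  shows "((\<lambda>y. fst (s y)) has_derivative (\<lambda>v. fst (s' v))) (at x)"
    and "((\<lambda>y. snd (s y)) has_derivative (\<lambda>v. snd (s' v))) (at x)"
  using assms by (auto intro: has_derivative_fst has_derivative_snd)

lemma has_derivative_omega_E:
  assumes s: "(s has_derivative s') (at x)" and t: "(t has_derivative t') (at x)"
  shows "((\<lambda>y. omega_E (s y) (t y)) has_derivative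
      (\<lambda>v. omega_E (s' v) (t x) + omega_E (s x) (t' v))) (at x)"
proof -
  have "((\<lambda>y. 1 / 2 * (blinfun_apply (snd (s y)) (fst (t y)) - blinfun_apply (snd (t y)) (fst (s y))))
    has_derivative
      (\<lambda>v. 1 / 2 * ((blinfun_apply (snd (s x)) (fst (t' v)) + blinfun_apply (snd (s' v)) (fst (t x)))
         - (blinfun_apply (snd (t x)) (fst (s' v)) + blinfun_apply (snd (t' v)) (fst (s x)))))) (at x)"
    by (intro has_derivative_mult_right has_derivative_diff
        bounded_bilinear.FDERIV[OF bounded_bilinear_blinfun_apply]
        has_derivative_fst_snd s t)
  then have "((\<lambda>y. omega_E (s y) (t y)) has_derivative
      (\<lambda>v. 1 / 2 * ((blinfun_apply (snd (s x)) (fst (t' v)) + blinfun_apply (snd (s' v)) (fst (t x)))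
         - (blinfun_apply (snd (t x)) (fst (s' v)) + blinfun_apply (snd (t' v)) (fst (s x)))))) (at x)"
    by (simp add: omega_E_def)
  then show ?thesis
    by (rule has_derivative_eq_rhs) (simp add: omega_E_def fun_eq_iff field_simps)
qed

lemma coord_bracket_eq:
  assumes s: "(s has_derivative s') (at x)" and t: "(t has_derivative t') (at x)"
  shows "fst (coord_bracket s t x) = fst (t' (fst (s x))) - fst (s' (fst (t x)))"
    and "blinfun_apply (snd (coord_bracket s t x)) w =
      (blinfun_apply (snd (t' (fst (s x)))) w + blinfun_apply (snd (t x)) (fst (s' w)))
      - (blinfun_apply (snd (s' (fst (t x)))) w + blinfun_apply (snd (s x)) (fst (t' w)))
      + (omega_E (s' w) (t x) + omega_E (s x) (t' w))"
proof -
  note D = has_derivative_fst_snd[OF s] has_derivative_fst_snd[OF t] has_derivative_omega_E[OF s t]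
  note lin = D[THEN has_derivative_linear]
  note eqs = D[THEN frechet_derivative_eqI]
  show "fst (coord_bracket s t x) = fst (t' (fst (s x))) - fst (s' (fst (t x)))"
    by (simp add: coord_bracket_def eqs)
  show "blinfun_apply (snd (coord_bracket s t x)) w =
      (blinfun_apply (snd (t' (fst (s x)))) w + blinfun_apply (snd (t x)) (fst (s' w)))
      - (blinfun_apply (snd (s' (fst (t x)))) w + blinfun_apply (snd (s x)) (fst (t' w)))
      + (omega_E (s' w) (t x) + omega_E (s x) (t' w))"
    by (simp add: coord_bracket_def eqs blinfun.add_left blinfun.diff_left
        lin[THEN Blinfun_apply_linear])
qed

lemma coord_bracket_cong:
  assumes "open S" "x \<in> S" "\<And>y. y \<in> S \<Longrightarrow> s y = s' y" "\<And>y. y \<in> S \<Longrightarrow> t y = t' y"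
  shows "coord_bracket s t x = coord_bracket s' t' x"
proof -
  note c = frechet_derivative_cong_open[OF assms(1,2)]
  have "der (\<lambda>y. fst (s y)) x = der (\<lambda>y. fst (s' y)) x"
    "der (\<lambda>y. snd (s y)) x = der (\<lambda>y. snd (s' y)) x"
    "der (\<lambda>y. fst (t y)) x = der (\<lambda>y. fst (t' y)) x"
    "der (\<lambda>y. snd (t y)) x = der (\<lambda>y. snd (t' y)) x"
    "der (\<lambda>y. omega_E (s y) (t y)) x = der (\<lambda>y. omega_E (s' y) (t' y)) x"
    by (rule c, simp add: assms(3,4))+
  then show ?thesis by (simp add: coord_bracket_def assms)
qed

lemma smooth_on_coord_bracket:
  fixes s t :: "'e::euclidean_space \<Rightarrow> 'e gvec"
  assumes S: "open S" and s: "smooth_on S s" and t: "smooth_on S t"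
  shows "smooth_on S (coord_bracket s t)"
proof -
  note D = smooth_on_has_derivative[OF s] smooth_on_has_derivative[OF t]
  have der: "smooth_on S (\<lambda>x. der f x (h x))"
    if "smooth_on S f" "smooth_on S h" for f :: "'e \<Rightarrow> 'e gvec" and h :: "'e \<Rightarrow> 'e"
    using smooth_on_derivative[OF S that(1) smooth_on_ident _ that(2)] by simp
  note sm = smooth_on_fst[OF S] smooth_on_snd[OF S] S s t der smooth_on_const
    smooth_on_bilinear[OF bounded_bilinear_blinfun_apply]
  have om: "smooth_on S (\<lambda>x. omega_E (f x) (g x))" if "smooth_on S f" "smooth_on S g"
    for f g :: "'e \<Rightarrow> 'e gvec"
  proof -
    have "smooth_on S (\<lambda>x. (1/2) *\<^sub>R (blinfun_apply (snd (f x)) (fst (g x)) - blinfun_apply (snd (g x)) (fst (f x))))"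
      by (intro smooth_on_scaleR smooth_on_diff sm that)
    then show ?thesis by (simp add: omega_E_def[abs_def])
  qed
  have "smooth_on S (\<lambda>x. fst (coord_bracket s t x))"
    by (rule smooth_on_cong[OF S, of "\<lambda>x. fst (der t x (fst (s x)))
          - fst (der s x (fst (t x)))"])
      (intro smooth_on_diff sm, simp add: coord_bracket_eq(1)[OF D])
  moreover have "smooth_on S (\<lambda>x. snd (coord_bracket s t x))"
  proof (rule smooth_on_blinfunI[OF S])
    fix w
    show "smooth_on S (\<lambda>x. blinfun_apply (snd (coord_bracket s t x)) w)"
      by (rule smooth_on_cong[OF S _ coord_bracket_eq(2)[OF D, symmetric]])
        (intro smooth_on_diff smooth_on_add sm om, assumption?)
  qed
  ultimately have "smooth_on S (\<lambda>x. (fst (coord_bracket s t x), snd (coord_bracket s t x)))"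
    by (rule smooth_on_Pair[OF S])
  then show ?thesis by simp
qed

definition second_derivative ::
  "('e::euclidean_space \<Rightarrow> 'f::real_normed_vector) \<Rightarrow> 'e \<Rightarrow> 'e \<Rightarrow> 'e \<Rightarrow> 'f" where
  "second_derivative f x u v = der (\<lambda>y. der f y u) x v"

text \<open>\<open>s\<close> and \<open>s'\<close> represent the same section in coordinates \<open>y\<close> and \<open>\<phi> y\<close>: vectors are pushed forward
  and covectors are pulled back.\<close>

definition transforms ::
  "'e::euclidean_space set \<Rightarrow> ('e \<Rightarrow> 'e) \<Rightarrow> ('e \<Rightarrow> 'e gvec) \<Rightarrow> ('e \<Rightarrow> 'e gvec) \<Rightarrow> bool" where
  "transforms S \<phi> s s' \<longleftrightarrow> (\<forall>y\<in>S. fst (s' (\<phi> y)) = der \<phi> y (fst (s y)) \<and>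
     (\<forall>w. blinfun_apply (snd (s y)) w =
        blinfun_apply (snd (s' (\<phi> y))) (der \<phi> y w)))"

context
  fixes \<phi> :: "'e::euclidean_space \<Rightarrow> 'e" and S T :: "'e set" and x :: 'e
  assumes S: "open S" "x \<in> S" and \<phi>: "smooth_on S \<phi>" and T: "\<phi> ` S \<subseteq> T"
begin

lemma second_derivative_sym: "second_derivative \<phi> x u v = second_derivative \<phi> x v u"
  unfolding second_derivative_def by (rule smooth_on_symmetric_second_derivative[OF S \<phi>])

lemma derivative_apply_has_derivative:
  assumes "(h has_derivative h') (at x)"
  shows "((\<lambda>y. der \<phi> y (h y)) has_derivative
      (\<lambda>w. second_derivative \<phi> x (h x) w + der \<phi> x (h' w))) (at x)"
  unfolding second_derivative_def
  using has_derivative_derivative_apply[OF S _ S(1) \<phi> has_derivative_ident assms] by simp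

text \<open>The transformation law, differentiated once. The second derivatives of \<open>\<phi>\<close> show that the
  derivative of a section has no meaning independent of the coordinates.\<close>

lemma transforms_derivative:
  fixes u u' :: "'e \<Rightarrow> 'e gvec"
  assumes u: "smooth_on S u" "smooth_on T u'" "transforms S \<phi> u u'"
  shows "fst (der u' (\<phi> x) (der \<phi> x v)) =
      second_derivative \<phi> x (fst (u x)) v + der \<phi> x (fst (der u x v))"
    and "blinfun_apply (snd (der u x v)) w =
      blinfun_apply (snd (der u' (\<phi> x) (der \<phi> x v)))
        (der \<phi> x w)
      + blinfun_apply (snd (u' (\<phi> x))) (second_derivative \<phi> x w v)"
proof -
  define A where "A = der \<phi> x"
  have \<phi>x: "\<phi> x \<in> T" using S T by auto
  have linA: "linear A" unfolding A_def by (rule smooth_on_linear_derivative[OF \<phi> S(2)])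
  have D\<phi>: "(\<phi> has_derivative A) (at x)"
    unfolding A_def by (rule smooth_on_has_derivative[OF \<phi> S(2)])
  note DA = derivative_apply_has_derivative
  note Du = smooth_on_has_derivative[OF u(1) S(2)]
  note Du' = has_derivative_compose[OF D\<phi> smooth_on_has_derivative[OF u(2) \<phi>x]]
  have "((\<lambda>y. fst (u' (\<phi> y))) has_derivative
      (\<lambda>v. second_derivative \<phi> x (fst (u x)) v + der \<phi> x (fst (der u x v)))) (at x)"
    by (rule has_derivative_transform_within_open[OF DA[OF has_derivative_fst[OF Du]] S])
      (use u(3) in \<open>simp add: transforms_def\<close>)
  from has_derivative_unique[OF this has_derivative_fst[OF Du']]
  show "fst (der u' (\<phi> x) (der \<phi> x v)) =
      second_derivative \<phi> x (fst (u x)) v + der \<phi> x (fst (der u x v))"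
    by (simp add: fun_eq_iff A_def)
  have "((\<lambda>y. blinfun_apply (snd (u' (\<phi> y))) (der \<phi> y w)) has_derivative
      (\<lambda>v. blinfun_apply (snd (u' (\<phi> x))) (second_derivative \<phi> x w v) +
        blinfun_apply (snd (der u' (\<phi> x) (A v))) (A w))) (at x)"
    using bounded_bilinear.FDERIV[OF bounded_bilinear_blinfun_apply has_derivative_snd[OF Du']
        DA[OF has_derivative_const[of w]]]
    by (simp add: linear_0[OF linA] A_def[symmetric])
  then have "((\<lambda>y. blinfun_apply (snd (u y)) w) has_derivative
      (\<lambda>v. blinfun_apply (snd (u' (\<phi> x))) (second_derivative \<phi> x w v) +
        blinfun_apply (snd (der u' (\<phi> x) (A v))) (A w))) (at x)"
    by (rule has_derivative_transform_within_open[OF _ S]) (use u(3) in \<open>simp add: transforms_def\<close>)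
  then have "(\<lambda>v. blinfun_apply (snd (u' (\<phi> x))) (second_derivative \<phi> x w v) +
        blinfun_apply (snd (der u' (\<phi> x) (A v))) (A w)) =
      (\<lambda>v. blinfun_apply (snd (der u x v)) w)"
    by (rule has_derivative_unique[OF _ bounded_linear.has_derivative[OF
          blinfun.bounded_linear_left has_derivative_snd[OF Du]]])
  then show "blinfun_apply (snd (der u x v)) w =
      blinfun_apply (snd (der u' (\<phi> x) (der \<phi> x v)))
        (der \<phi> x w)
      + blinfun_apply (snd (u' (\<phi> x))) (second_derivative \<phi> x w v)"
    by (simp add: fun_eq_iff A_def add.commute)
qed

text \<open>The terms with second derivatives of \<open>\<phi>\<close> cancel because of its symmetry.\<close>

lemma coord_bracket_natural:
  assumes s: "smooth_on S s" "smooth_on T s'" "transforms S \<phi> s s'"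
    and t: "smooth_on S t" "smooth_on T t'" "transforms S \<phi> t t'"
  shows "fst (coord_bracket s' t' (\<phi> x)) = der \<phi> x (fst (coord_bracket s t x))"
    and "blinfun_apply (snd (coord_bracket s t x)) w =
      blinfun_apply (snd (coord_bracket s' t' (\<phi> x))) (der \<phi> x w)"
proof -
  define A where "A = der \<phi> x"
  have linA: "linear A" unfolding A_def by (rule smooth_on_linear_derivative[OF \<phi> S(2)])
  have \<phi>x: "\<phi> x \<in> T" using S T by auto
  note relS = transforms_derivative[OF s, folded A_def]
    and relT = transforms_derivative[OF t, folded A_def]
    and sym = second_derivative_sym
  note br = coord_bracket_eq[OF smooth_on_has_derivative[OF s(1) S(2)] smooth_on_has_derivative[OF t(1) S(2)]]
  note br' = coord_bracket_eq[OF smooth_on_has_derivative[OF s(2) \<phi>x] smooth_on_has_derivative[OF t(2) \<phi>x]]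
  have s0: "fst (s' (\<phi> x)) = A (fst (s x))" "blinfun_apply (snd (s x)) w = blinfun_apply (snd (s' (\<phi> x))) (A w)"
    and t0: "fst (t' (\<phi> x)) = A (fst (t x))" "blinfun_apply (snd (t x)) w = blinfun_apply (snd (t' (\<phi> x))) (A w)" for w
    using s(3) t(3) S(2) by (auto simp: A_def transforms_def)
  show "fst (coord_bracket s' t' (\<phi> x)) = der \<phi> x (fst (coord_bracket s t x))"
    unfolding br br' A_def[symmetric] s0 t0 linear_diff[OF linA]
    using relT(1)[of "fst (s x)"] relS(1)[of "fst (t x)"] sym[of "fst (t x)" "fst (s x)"] by simp
  show "blinfun_apply (snd (coord_bracket s t x)) w =
      blinfun_apply (snd (coord_bracket s' t' (\<phi> x))) (der \<phi> x w)"
    unfolding br br' A_def[symmetric] omega_E_def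
    by (simp add: s0 t0 relS relT blinfun.add_right blinfun.diff_right sym[of w "fst (s x)"]
        sym[of w "fst (t x)"] algebra_simps add_divide_distrib diff_divide_distrib)
qed

end

text \<open>\<open>g(\<partial>\<^bsub>\<rho>s\<^esub> t, u)\<close>, for the flat connection of the chart.\<close>

definition metric_derivative ::
  "('e::euclidean_space \<Rightarrow> 'e gvec) \<Rightarrow> ('e \<Rightarrow> 'e gvec) \<Rightarrow> ('e \<Rightarrow> 'e gvec) \<Rightarrow> 'e \<Rightarrow> real" where
  "metric_derivative s t u x = metric_E (der t x (fst (s x))) (u x)"

text \<open>The Courant tensor, whose vanishing on an almost Dirac structure is equivalent to involutivity.\<close>

definition courant_tensor ::
  "('e::euclidean_space \<Rightarrow> 'e gvec) \<Rightarrow> ('e \<Rightarrow> 'e gvec) \<Rightarrow> ('e \<Rightarrow> 'e gvec) \<Rightarrow> 'e \<Rightarrow> real" where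
  "courant_tensor s t u x = metric_derivative s t u x + metric_derivative t u s x + metric_derivative u s t x"

lemma courant_tensor_cyclic: "courant_tensor s t u x = courant_tensor t u s x"
  by (simp add: courant_tensor_def)

lemma courant_tensor_cong:
  assumes S: "open S" "x \<in> S" and "\<And>y. y \<in> S \<Longrightarrow> s y = s' y" "\<And>y. y \<in> S \<Longrightarrow> t y = t' y"
    "\<And>y. y \<in> S \<Longrightarrow> u y = u' y"
  shows "courant_tensor s t u x = courant_tensor s' t' u' x"
  unfolding courant_tensor_def metric_derivative_def
  using assms(2-) frechet_derivative_cong_open[OF S, of s s'] frechet_derivative_cong_open[OF S, of t t']
    frechet_derivative_cong_open[OF S, of u u'] by simp

lemma isotropic_derivative:
  assumes S: "open S" "x \<in> S" and iso: "\<And>y. y \<in> S \<Longrightarrow> metric_E (s y) (t y) = 0"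
    and s: "s differentiable (at x)" and t: "t differentiable (at x)"
  shows "metric_E (der s x w) (t x) = - metric_E (s x) (der t x w)"
proof -
  have "((\<lambda>y. metric_E (s y) (t y)) has_derivative
      (\<lambda>w. metric_E (s x) (der t x w) + metric_E (der s x w) (t x))) (at x)"
    by (rule metric_E.FDERIV[OF frechet_has_derivative[OF s] frechet_has_derivative[OF t]])
  moreover have "((\<lambda>y. metric_E (s y) (t y)) has_derivative (\<lambda>_. 0)) (at x)"
    by (rule has_derivative_transform_within_open[OF has_derivative_const S]) (simp add: iso)
  ultimately have "(\<lambda>w. metric_E (s x) (der t x w)
      + metric_E (der s x w) (t x)) = (\<lambda>_. 0)"
    by (rule has_derivative_unique)
  then show ?thesis by (simp add: fun_eq_iff add_eq_0_iff)
qed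

text \<open>In coordinates, for sections with \<open>g(s,t) = 0\<close>, one has
  \<open>g([s,t],u) = g(\<partial>\<^bsub>\<rho>s\<^esub> t, u) - g(\<partial>\<^bsub>\<rho>t\<^esub> s, u) + g(\<partial>\<^bsub>\<rho>u\<^esub> s, t)\<close>, and
  \<open>g(s,u) = 0\<close> turns the second term into \<open>g(\<partial>\<^bsub>\<rho>t\<^esub> u, s)\<close>.\<close>

lemma metric_coord_bracket:
  assumes S: "open S" "x \<in> S"
    and d: "s differentiable (at x)" "t differentiable (at x)" "u differentiable (at x)"
    and st: "\<And>y. y \<in> S \<Longrightarrow> metric_E (s y) (t y) = 0"
    and su: "\<And>y. y \<in> S \<Longrightarrow> metric_E (u y) (s y) = 0"
  shows "metric_E (coord_bracket s t x) (u x) = courant_tensor s t u x"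
proof -
  note D = d[THEN frechet_has_derivative]
  have 1: "metric_E (der u x (fst (t x))) (s x)
      = - metric_E (der s x (fst (t x))) (u x)"
    using isotropic_derivative[OF S su d(3,1)] by (simp add: metric_E_commute)
  have 2: "metric_E (der s x (fst (u x))) (t x)
      = - metric_E (s x) (der t x (fst (u x)))"
    by (rule isotropic_derivative[OF S st d(1,2)])
  have "metric_E (coord_bracket s t x) (u x) =
      metric_E (der t x (fst (s x))) (u x)
      - metric_E (der s x (fst (t x))) (u x)
      + (metric_E (der s x (fst (u x))) (t x)
         - metric_E (s x) (der t x (fst (u x)))) / 2"
    unfolding metric_E_def coord_bracket_eq[OF D(1,2)] omega_E_def
    by (simp add: field_simps blinfun.diff_right)
  then show ?thesis
    unfolding courant_tensor_def metric_derivative_def 1 using 2 by simp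
qed

text \<open>Only one of the three terms differentiates \<open>s\<close>, and isotropy moves the derivative to \<open>t\<close>. By
  cyclic symmetry the same holds for the other arguments.\<close>

lemma courant_tensor_cong1:
  assumes S: "open S" "x \<in> S"
    and d: "s differentiable (at x)" "s' differentiable (at x)" "t differentiable (at x)"
    and st: "\<And>y. y \<in> S \<Longrightarrow> metric_E (s y) (t y) = 0"
      "\<And>y. y \<in> S \<Longrightarrow> metric_E (s' y) (t y) = 0"
    and eq: "s x = s' x"
  shows "courant_tensor s t u x = courant_tensor s' t u x"
  unfolding courant_tensor_def metric_derivative_def
  by (simp add: eq isotropic_derivative[OF S st(1) d(1,3)] isotropic_derivative[OF S st(2) d(2,3)])

section \<open>Lifts in coordinates\<close>

text \<open>The tangent vector \<open>q\<close> of \<open>E(M)\<close> at \<open>p\<close>, as an element of \<open>E(TM)\<close>. On covectors the two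
  arguments change places: the coefficient of \<open>dv\<close> is the one from the base point \<open>p\<close>.\<close>

definition lift_pair :: "'e::euclidean_space gvec \<Rightarrow> 'e gvec \<Rightarrow> ('e \<times> 'e) gvec" where
  "lift_pair p q = ((fst p, fst q), (snd q o\<^sub>L fst_blinfun) + (snd p o\<^sub>L snd_blinfun))"

text \<open>The sum \<open>s\<^sup>C + t\<^sup>V\<close> in the coordinates \<open>(x, v)\<close>.\<close>

definition coord_lift ::
  "('e::euclidean_space \<Rightarrow> 'e gvec) \<Rightarrow> ('e \<Rightarrow> 'e gvec) \<Rightarrow> 'e \<times> 'e \<Rightarrow> ('e \<times> 'e) gvec" where
  "coord_lift s t = (\<lambda>(x, v). lift_pair (s x) (der s x v + t x))"

lemma metric_lift_pair: "metric_E (lift_pair p q) (lift_pair p' q') = metric_E p q' + metric_E q p'"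
  by (simp add: metric_E_def lift_pair_def blinfun.add_left field_simps)

lemma bounded_linear_lift_pair: "bounded_linear (\<lambda>z. lift_pair (fst z) (snd z))"
  unfolding lift_pair_def
  by (intro bounded_linear_Pair bounded_linear_add
      bounded_linear_compose[OF bounded_bilinear.bounded_linear_left[OF bounded_bilinear_blinfun_compose]]
      bounded_linear_compose[OF bounded_linear_fst] bounded_linear_compose[OF bounded_linear_snd]
      bounded_linear_fst bounded_linear_snd)

lemma lift_pair_add: "lift_pair (p + p') (q + q') = lift_pair p q + lift_pair p' q'"
  using linear_add[OF bounded_linear.linear[OF bounded_linear_lift_pair], of "(p, q)" "(p', q')"] by simp

lemma lift_pair_scaleR: "lift_pair (c *\<^sub>R p) (c *\<^sub>R q) = c *\<^sub>R lift_pair p q"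
  using linear_cmul[OF bounded_linear.linear[OF bounded_linear_lift_pair], of c "(p, q)"] by simp

lemma lift_pair_0: "lift_pair 0 0 = 0"
  using lift_pair_scaleR[of 0 0 0] by simp

lemma lift_pair_sum: "lift_pair (\<Sum>i\<in>I. p i) (\<Sum>i\<in>I. q i) = (\<Sum>i\<in>I. lift_pair (p i) (q i))"
  by (induction I rule: infinite_finite_induct) (auto simp: lift_pair_0 lift_pair_add)

lemma lift_pair_eq_0: "lift_pair p q = 0 \<longleftrightarrow> p = 0 \<and> q = 0"
proof
  assume z: "lift_pair p q = 0"
  have "blinfun_apply (snd (lift_pair p q)) (w, 0) = 0" "blinfun_apply (snd (lift_pair p q)) (0, w) = 0" for w
    by (simp_all add: z)
  then have "snd p = 0" "snd q = 0"
    by (auto intro!: blinfun_eqI simp: lift_pair_def blinfun.add_left)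
  moreover have "fst p = 0" "fst q = 0" using arg_cong[OF z, of fst] by (auto simp: lift_pair_def zero_prod_def)
  ultimately show "p = 0 \<and> q = 0" by (simp add: prod_eq_iff)
qed (simp add: lift_pair_0)

context
  fixes S :: "'e::euclidean_space set"
  assumes S: "open S"
begin

lemma smooth_on_coord_lift:
  assumes s: "smooth_on S s" and t: "smooth_on S t"
  shows "smooth_on (S \<times> UNIV) (coord_lift s t)"
proof -
  have SU: "open (S \<times> (UNIV :: 'e set))" using S by (simp add: open_Times)
  have sub: "(\<lambda>z. fst z) ` (S \<times> (UNIV :: 'e set)) \<subseteq> S" by auto
  note fst = smooth_on_fst[OF SU smooth_on_ident]
  have "smooth_on (S \<times> UNIV) (\<lambda>z. lift_pair (s (fst z)) (der s (fst z) (snd z) + t (fst z)))"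
    using smooth_on_bounded_linear[OF bounded_linear_lift_pair SU smooth_on_Pair[OF SU
          smooth_on_compose[OF SU fst s sub] smooth_on_add[OF SU
          smooth_on_derivative[OF SU s fst sub smooth_on_snd[OF SU smooth_on_ident]]
          smooth_on_compose[OF SU fst t sub]]]] by simp
  then show ?thesis by (simp add: coord_lift_def case_prod_unfold)
qed

lemma coord_lift_has_derivative:
  assumes s: "smooth_on S s" and t: "smooth_on S t" and x: "x \<in> S"
  shows "(coord_lift s t has_derivative (\<lambda>(X, Y). lift_pair (der s x X)
     (der (\<lambda>y. der s y v) x X
        + der s x Y + der t x X))) (at (x, v))"
proof -
  have SU: "open (S \<times> (UNIV :: 'e set))" "(x, v) \<in> S \<times> UNIV" using S x by (auto simp: open_Times)
  have sub: "(\<lambda>z. fst z) ` (S \<times> (UNIV :: 'e set)) \<subseteq> S" by auto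
  have dfst: "(fst has_derivative fst) (at (x, v))" and dsnd: "(snd has_derivative snd) (at (x, v))"
    by (auto intro: has_derivative_fst[OF has_derivative_ident] has_derivative_snd[OF has_derivative_ident])
  have comp: "((\<lambda>z. u (fst z)) has_derivative (\<lambda>h. der u x (fst h))) (at (x, v))"
    if "smooth_on S u" for u :: "'e \<Rightarrow> 'e gvec"
    using has_derivative_compose[OF dfst, of u] smooth_on_has_derivative[OF that x] by simp
  have "((\<lambda>z. lift_pair (s (fst z)) (der s (fst z) (snd z) + t (fst z)))
     has_derivative (\<lambda>h. lift_pair (der s x (fst h))
     (der (\<lambda>y. der s y v) x (fst h)
        + der s x (snd h) + der t x (fst h)))) (at (x, v))"
    using bounded_linear.has_derivative[OF bounded_linear_lift_pair
        has_derivative_Pair[OF comp[OF s] has_derivative_add[OF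
        has_derivative_derivative_apply[OF SU sub S s dfst dsnd] comp[OF t]]]]
    by simp
  then show ?thesis by (simp add: coord_lift_def case_prod_unfold)
qed

lemma metric_derivative_has_derivative:
  assumes s: "smooth_on S s1" "smooth_on S s2" "smooth_on S s3" and x: "x \<in> S"
  shows "(metric_derivative s1 s2 s3 has_derivative (\<lambda>v.
     metric_E (der s2 x (fst (s1 x))) (der s3 x v)
     + metric_E (der (\<lambda>y. der s2 y (fst (s1 x))) x v
         + der s2 x (fst (der s1 x v))) (s3 x))) (at x)"
  using metric_E.FDERIV[OF has_derivative_derivative_apply[OF S x _ S s(2) has_derivative_ident
        has_derivative_fst[OF smooth_on_has_derivative[OF s(1) x]]] smooth_on_has_derivative[OF s(3) x]]
  by (simp add: metric_derivative_def[abs_def])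

text \<open>The first term on the right comes from the complete lifts alone; here the second derivative of
  \<open>s2\<close> arises in the directions \<open>v, \<rho>s1\<close> and is needed in the opposite order. A vertical part in one slot
  contributes the undifferentiated expression, and two vertical parts contribute nothing.\<close>

lemma metric_derivative_lift:
  assumes s: "smooth_on S s1" "smooth_on S s2" "smooth_on S s3"
    and t: "smooth_on S t1" "smooth_on S t2" "smooth_on S t3" and x: "x \<in> S"
  shows "metric_derivative (coord_lift s1 t1) (coord_lift s2 t2) (coord_lift s3 t3) (x, v) =
    der (metric_derivative s1 s2 s3) x v
    + metric_derivative s1 s2 t3 x + metric_derivative t1 s2 s3 x + metric_derivative s1 t2 s3 x"
proof -
  have lin: "linear (der s2 x)" by (rule smooth_on_linear_derivative[OF s(2) x])
  have at_point: "coord_lift s3 t3 (x, v) = lift_pair (s3 x) (der s3 x v + t3 x)"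
    "fst (coord_lift s1 t1 (x, v)) = (fst (s1 x), fst (der s1 x v) + fst (t1 x))"
    by (simp_all add: coord_lift_def lift_pair_def)
  show ?thesis
    unfolding metric_derivative_def[of "coord_lift _ _"] frechet_derivative_eqI[OF coord_lift_has_derivative[OF s(2) t(2) x]]
      frechet_derivative_eqI[OF metric_derivative_has_derivative[OF s x]]
    using smooth_on_symmetric_second_derivative[OF S x s(2), of v "fst (s1 x)"]
    by (simp add: at_point metric_lift_pair metric_derivative_def
        metric_E.add_left metric_E.add_right linear_add[OF lin])
qed

text \<open>The cyclic sum of the previous formula.\<close>

lemma courant_tensor_lift:
  assumes s: "smooth_on S s1" "smooth_on S s2" "smooth_on S s3"
    and t: "smooth_on S t1" "smooth_on S t2" "smooth_on S t3" and x: "x \<in> S"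
    and sss: "\<And>y. y \<in> S \<Longrightarrow> courant_tensor s1 s2 s3 y = 0"
    and sst: "courant_tensor s1 s2 t3 x = 0" "courant_tensor t1 s2 s3 x = 0" "courant_tensor s1 t2 s3 x = 0"
  shows "courant_tensor (coord_lift s1 t1) (coord_lift s2 t2) (coord_lift s3 t3) (x, v) = 0"
proof -
  note D = metric_derivative_has_derivative
  note d = D[THEN differentiableI, THEN frechet_has_derivative]
  have "(courant_tensor s1 s2 s3 has_derivative (\<lambda>v.
      der (metric_derivative s1 s2 s3) x v
      + der (metric_derivative s2 s3 s1) x v
      + der (metric_derivative s3 s1 s2) x v)) (at x)"
    unfolding courant_tensor_def[abs_def]
    by (rule has_derivative_add[OF has_derivative_add[OF d[OF s x] d[OF s(2,3,1) x]] d[OF s(3,1,2) x]])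
  moreover have "(courant_tensor s1 s2 s3 has_derivative (\<lambda>_. 0)) (at x)"
    by (rule has_derivative_transform_within_open[OF has_derivative_const S x]) (simp add: sss)
  ultimately have "(\<lambda>v. der (metric_derivative s1 s2 s3) x v
      + der (metric_derivative s2 s3 s1) x v
      + der (metric_derivative s3 s1 s2) x v) = (\<lambda>_. 0)"
    by (rule has_derivative_unique)
  from fun_cong[OF this, of v] show ?thesis
    using sst unfolding courant_tensor_def
    by (simp add: metric_derivative_lift[OF s t x] metric_derivative_lift[OF s(2,3,1) t(2,3,1) x]
        metric_derivative_lift[OF s(3,1,2) t(3,1,2) x])
qed

end

text \<open>The coordinate change of the tangent bundle is \<open>(x, v) \<mapsto> (\<phi> x, D\<phi>(x) v)\<close>.\<close>

lemma tangent_map_has_derivative: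
  fixes \<phi> :: "'e::euclidean_space \<Rightarrow> 'e"
  assumes S: "open S" "x \<in> S" and \<phi>: "smooth_on S \<phi>"
  shows "((\<lambda>z. (\<phi> (fst z), der \<phi> (fst z) (snd z))) has_derivative
    (\<lambda>W. (der \<phi> x (fst W),
       second_derivative \<phi> x v (fst W) + der \<phi> x (snd W)))) (at (x, v))"
proof -
  have SU: "open (S \<times> (UNIV :: 'e set))" "(x, v) \<in> S \<times> UNIV" using S by (auto simp: open_Times)
  have sub: "(\<lambda>z. fst z) ` (S \<times> (UNIV :: 'e set)) \<subseteq> S" by auto
  have dfst: "(fst has_derivative fst) (at (x, v))" and dsnd: "(snd has_derivative snd) (at (x, v))"
    by (auto intro: has_derivative_fst[OF has_derivative_ident] has_derivative_snd[OF has_derivative_ident])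
  have "((\<lambda>z. \<phi> (fst z)) has_derivative (\<lambda>h. der \<phi> x (fst h))) (at (x, v))"
    using has_derivative_compose[OF dfst, of \<phi>] smooth_on_has_derivative[OF \<phi> S(2)] by simp
  from has_derivative_Pair[OF this has_derivative_derivative_apply[OF SU sub S(1) \<phi> dfst dsnd]]
  show ?thesis by (simp add: second_derivative_def)
qed

text \<open>Under \<open>(x, v) \<mapsto> (\<phi> x, D\<phi>(x) v)\<close> the derivatives of the components pick up exactly the second
  derivative that occurs in the derivative of this map.\<close>

lemma coord_lift_natural:
  fixes \<phi> :: "'e::euclidean_space \<Rightarrow> 'e" and v :: 'e
  assumes S: "open S" "x \<in> S" and \<phi>: "smooth_on S \<phi>" and T: "\<phi> ` S \<subseteq> T"
    and s: "smooth_on S s" "smooth_on T s'" "transforms S \<phi> s s'"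
    and t: "transforms S \<phi> t t'"
  defines "W \<equiv> (\<lambda>W. (der \<phi> x (fst W),
       second_derivative \<phi> x v (fst W) + der \<phi> x (snd W)))"
  shows "fst (coord_lift s' t' (\<phi> x, der \<phi> x v)) = W (fst (coord_lift s t (x, v)))"
    and "blinfun_apply (snd (coord_lift s t (x, v))) w =
      blinfun_apply (snd (coord_lift s' t' (\<phi> x, der \<phi> x v))) (W w)"
proof -
  note rel = transforms_derivative[OF S \<phi> T s]
  note sym = second_derivative_sym[OF S \<phi> T]
  have lin: "linear (der \<phi> x)" by (rule smooth_on_linear_derivative[OF \<phi> S(2)])
  have s0: "fst (s' (\<phi> x)) = der \<phi> x (fst (s x))"
      "blinfun_apply (snd (s x)) w = blinfun_apply (snd (s' (\<phi> x))) (der \<phi> x w)"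
    and t0: "fst (t' (\<phi> x)) = der \<phi> x (fst (t x))"
      "blinfun_apply (snd (t x)) w = blinfun_apply (snd (t' (\<phi> x))) (der \<phi> x w)" for w
    using s(3) t S(2) by (auto simp: transforms_def)
  show "fst (coord_lift s' t' (\<phi> x, der \<phi> x v)) = W (fst (coord_lift s t (x, v)))"
    by (simp add: coord_lift_def lift_pair_def W_def s0 t0 rel(1)[of v] linear_add[OF lin] sym[of v "fst (s x)"])
  show "blinfun_apply (snd (coord_lift s t (x, v))) w =
      blinfun_apply (snd (coord_lift s' t' (\<phi> x, der \<phi> x v))) (W w)"
    by (simp add: coord_lift_def lift_pair_def W_def s0 t0 rel(2)[of v] blinfun.add_left blinfun.add_right
        sym[of v "fst w"])
qed

section \<open>Charts and coordinate representations\<close>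

abbreviation open_in :: "('a, 'e::euclidean_space) charted_space \<Rightarrow> 'a set \<Rightarrow> bool" where
  "open_in M \<equiv> openin (manifold_top M)"

definition gcomp ::
  "('a, 'e::euclidean_space) charted_space \<Rightarrow> ('a, 'e) chart \<Rightarrow> 'a \<Rightarrow> 'e gvec \<Rightarrow> 'e gvec" where
  "gcomp M c p a = (vec_comp M c p (fst a), covec_comp M c p (snd a))"

definition sec_rep ::
  "('a, 'e::euclidean_space) charted_space \<Rightarrow> ('a, 'e) chart \<Rightarrow> ('a \<Rightarrow> 'e gvec) \<Rightarrow> 'e \<Rightarrow> 'e gvec" where
  "sec_rep M c s x = gcomp M c (chart_inv c x) (s (chart_inv c x))"

lemma sec_rep_simps:
  "vf_rep M c (fst \<circ> s) = (\<lambda>x. fst (sec_rep M c s x))"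
  "form_rep M c (snd \<circ> s) = (\<lambda>x. snd (sec_rep M c s x))"
  by (simp_all add: fun_eq_iff sec_rep_def gcomp_def vf_rep_def form_rep_def)

lemma linear_gcomp: "linear (gcomp M c p)"
  by (rule linearI)
    (auto simp: gcomp_def vec_comp_def covec_comp_def blinfun.add_right blinfun.scaleR_right
      bounded_bilinear.add_left[OF bounded_bilinear_blinfun_compose]
      bounded_bilinear.scaleR_left[OF bounded_bilinear_blinfun_compose])

lemma sec_rep_add: "sec_rep M c (\<lambda>q. s q + t q) x = sec_rep M c s x + sec_rep M c t x"
  by (simp add: sec_rep_def linear_add[OF linear_gcomp])

lemma sec_rep_scaleR: "sec_rep M c (\<lambda>q. f q *\<^sub>R s q) x = f (chart_inv c x) *\<^sub>R sec_rep M c s x"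
  by (simp add: sec_rep_def linear_cmul[OF linear_gcomp])

text \<open>The conditions on the charts alone. They pass on to the tangent bundle.\<close>

locale charted_manifold =
  fixes M :: "('a, 'e::euclidean_space) charted_space"
  assumes smooth_atlas: "smooth_atlas (atlas M)"
    and chart_at: "p \<in> carrier M \<Longrightarrow> chart_at M p \<in> atlas M \<and> p \<in> fst (chart_at M p)"
begin

definition trans_der :: "('a, 'e) chart \<Rightarrow> ('a, 'e) chart \<Rightarrow> 'e \<Rightarrow> 'e \<Rightarrow> 'e" where
  "trans_der c c' x = der (snd c' \<circ> chart_inv c) x"

lemma in_carrier: "c \<in> atlas M \<Longrightarrow> p \<in> fst c \<Longrightarrow> p \<in> carrier M"
  by (auto simp: carrier_def)

lemma inj_chart: "c \<in> atlas M \<Longrightarrow> inj_on (snd c) (fst c)"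
  using smooth_atlas by (simp add: smooth_atlas_def)

lemma chart_inv_left: "c \<in> atlas M \<Longrightarrow> p \<in> fst c \<Longrightarrow> chart_inv c (snd c p) = p"
  by (simp add: chart_inv_def inj_chart)

lemma chart_inv_right: "x \<in> snd c ` fst c \<Longrightarrow> snd c (chart_inv c x) = x"
  by (simp add: chart_inv_def f_inv_into_f)

lemma chart_inv_into: "x \<in> snd c ` fst c \<Longrightarrow> chart_inv c x \<in> fst c"
  by (simp add: chart_inv_def inv_into_into)

lemma in_chart_image_iff:
  "c \<in> atlas M \<Longrightarrow> x \<in> snd c ` (U \<inter> fst c) \<longleftrightarrow> x \<in> snd c ` fst c \<and> chart_inv c x \<in> U"
  by (auto simp: chart_inv_left chart_inv_into intro!: image_eqI[of x "snd c" "chart_inv c x"] simp: chart_inv_right)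

lemma open_overlap: "c \<in> atlas M \<Longrightarrow> c' \<in> atlas M \<Longrightarrow> open (snd c ` (fst c \<inter> fst c'))"
  using smooth_atlas by (simp add: smooth_atlas_def)

lemma open_chart_image: "c \<in> atlas M \<Longrightarrow> open (snd c ` fst c)"
  using smooth_atlas by (simp add: smooth_atlas_def)

lemma smooth_trans:
  "c \<in> atlas M \<Longrightarrow> c' \<in> atlas M \<Longrightarrow> smooth_on (snd c ` (fst c \<inter> fst c')) (snd c' \<circ> chart_inv c)"
  using smooth_atlas by (simp add: smooth_atlas_def)

lemma topspace_manifold_top: "topspace (manifold_top M) = carrier M"
proof -
  have "topspace (manifold_top M) = \<Union> {fst c \<inter> snd c -` W |c W. c \<in> atlas M \<and> open W}"
    by (simp add: manifold_top_def)
  also have "\<dots> = carrier M"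
  proof
    show "carrier M \<subseteq> \<Union> {fst c \<inter> snd c -` W |c W. c \<in> atlas M \<and> open W}"
    proof
      fix p assume "p \<in> carrier M"
      then obtain c where c: "c \<in> atlas M" "p \<in> fst c" by (auto simp: carrier_def)
      then have "p \<in> fst c \<inter> snd c -` UNIV" by simp
      then show "p \<in> \<Union> {fst c \<inter> snd c -` W |c W. c \<in> atlas M \<and> open W}"
        using c open_UNIV by blast
    qed
  qed (auto simp: carrier_def)
  finally show ?thesis .
qed

lemma openin_subset_carrier: "open_in M U \<Longrightarrow> U \<subseteq> carrier M"
  using openin_subset topspace_manifold_top by metis

lemma openin_chart_preimage: "c \<in> atlas M \<Longrightarrow> open W \<Longrightarrow> open_in M (fst c \<inter> snd c -` W)"
  unfolding manifold_top_def by (rule topology_generated_by_Basis) blast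

lemma openin_chart: "c \<in> atlas M \<Longrightarrow> open_in M (fst c)"
  using openin_chart_preimage[of c UNIV] by simp

lemma openin_carrier: "open_in M (carrier M)"
  using openin_topspace topspace_manifold_top by metis

lemma open_chart_image_of_open:
  assumes c: "c \<in> atlas M" and U: "open_in M U"
  shows "open (snd c ` (U \<inter> fst c))"
proof -
  have "generate_topology_on {fst c \<inter> snd c -` W |c W. c \<in> atlas M \<and> open W} U"
    using U unfolding manifold_top_def openin_topology_generated_by_iff .
  then show ?thesis
  proof induction
    case Empty
    then show ?case by simp
  next
    case (Int A B)
    have "snd c ` (A \<inter> B \<inter> fst c) = snd c ` (A \<inter> fst c) \<inter> snd c ` (B \<inter> fst c)"
      using inj_chart[OF c] by (auto dest: inj_onD)
    then show ?case using Int by auto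
  next
    case (UN K)
    have "snd c ` (\<Union>K \<inter> fst c) = (\<Union>A\<in>K. snd c ` (A \<inter> fst c))" by auto
    then show ?case using UN by auto
  next
    case (Basis A)
    then obtain c' W where A: "A = fst c' \<inter> snd c' -` W" "c' \<in> atlas M" "open W" by auto
    have "open ((snd c' \<circ> chart_inv c) -` W \<inter> snd c ` (fst c \<inter> fst c'))"
      using continuous_open_preimage[OF smooth_on_imp_continuous_on[OF smooth_trans[OF c A(2)]]
          open_overlap[OF c A(2)] A(3)] by (simp add: Int_commute)
    moreover have "snd c ` (A \<inter> fst c) = (snd c' \<circ> chart_inv c) -` W \<inter> snd c ` (fst c \<inter> fst c')"
      using A chart_inv_left[OF c] by auto
    ultimately show ?case by simp
  qed
qed

lemma trans_der:
  assumes "c \<in> atlas M" "c' \<in> atlas M" "x \<in> snd c ` (fst c \<inter> fst c')"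
  shows "((snd c' \<circ> chart_inv c) has_derivative trans_der c c' x) (at x)"
  unfolding trans_der_def by (rule smooth_on_has_derivative[OF smooth_trans[OF assms(1,2)] assms(3)])

lemma linear_trans_der:
  "c \<in> atlas M \<Longrightarrow> c' \<in> atlas M \<Longrightarrow> x \<in> snd c ` (fst c \<inter> fst c') \<Longrightarrow> linear (trans_der c c' x)"
  using trans_der has_derivative_linear by blast

lemma trans_der_self:
  assumes c: "c \<in> atlas M" and x: "x \<in> snd c ` fst c"
  shows "trans_der c c x v = v"
proof -
  have "((\<lambda>x. x) has_derivative (\<lambda>v. v)) (at x)" by (rule has_derivative_ident)
  then have "((snd c \<circ> chart_inv c) has_derivative (\<lambda>v. v)) (at x)"
    by (rule has_derivative_transform_within_open[OF _ open_chart_image[OF c] x])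
      (simp add: chart_inv_right)
  then show ?thesis by (simp add: trans_der_def frechet_derivative_eqI)
qed

lemma trans_der_comp:
  assumes c: "c \<in> atlas M" "c' \<in> atlas M" "c'' \<in> atlas M"
    and p: "p \<in> fst c" "p \<in> fst c'" "p \<in> fst c''"
  shows "trans_der c c'' (snd c p) v = trans_der c' c'' (snd c' p) (trans_der c c' (snd c p) v)"
proof -
  let ?S = "snd c ` (fst c' \<inter> fst c'' \<inter> fst c)"
  have S: "open ?S" "snd c p \<in> ?S"
    using p by (auto intro!: open_chart_image_of_open openin_Int openin_chart c)
  have at_p: "(snd c' \<circ> chart_inv c) (snd c p) = snd c' p"
    using p c by (simp add: chart_inv_left)
  have "((\<lambda>x. (snd c'' \<circ> chart_inv c') ((snd c' \<circ> chart_inv c) x)) has_derivative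
     (\<lambda>v. trans_der c' c'' (snd c' p) (trans_der c c' (snd c p) v))) (at (snd c p))"
    by (rule has_derivative_compose[OF trans_der[OF c(1,2)]], use p in force,
        unfold at_p, rule trans_der[OF c(2,3)], use p in force)
  then have "((snd c'' \<circ> chart_inv c) has_derivative
     (\<lambda>v. trans_der c' c'' (snd c' p) (trans_der c c' (snd c p) v))) (at (snd c p))"
    by (rule has_derivative_transform_within_open[OF _ S]) (auto simp: chart_inv_left c)
  then show ?thesis by (simp add: trans_der_def frechet_derivative_eqI)
qed

lemma jacobian_apply:
  assumes "c \<in> atlas M" "c' \<in> atlas M" "p \<in> fst c" "p \<in> fst c'"
  shows "blinfun_apply (jacobian c c' p) = trans_der c c' (snd c p)"
  unfolding jacobian_def trans_der_def
  by (rule Blinfun_apply_linear, fold trans_der_def, rule linear_trans_der) (use assms in auto)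

lemma gcomp_apply:
  assumes c: "c \<in> atlas M" and p: "p \<in> fst c"
  defines "c\<^sub>0 \<equiv> chart_at M p"
  shows "fst (gcomp M c p a) = trans_der c\<^sub>0 c (snd c\<^sub>0 p) (fst a)"
    and "blinfun_apply (snd (gcomp M c p a)) w = blinfun_apply (snd a) (trans_der c c\<^sub>0 (snd c p) w)"
  using chart_at[OF in_carrier[OF c p]] c p
  by (simp_all add: gcomp_def vec_comp_def covec_comp_def jacobian_apply c\<^sub>0_def)

lemma gcomp_chart_at:
  assumes p: "p \<in> carrier M"
  shows "gcomp M (chart_at M p) p a = a"
proof (rule prod_eqI)
  note c = chart_at[OF p]
  have x: "snd (chart_at M p) p \<in> snd (chart_at M p) ` fst (chart_at M p)" using c by simp
  show "fst (gcomp M (chart_at M p) p a) = fst a"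
    using c x by (simp add: gcomp_apply trans_der_self)
  show "snd (gcomp M (chart_at M p) p a) = snd a"
    using c x by (intro blinfun_eqI) (simp add: gcomp_apply trans_der_self)
qed

lemma gcomp_change:
  assumes c: "c \<in> atlas M" "c' \<in> atlas M" and p: "p \<in> fst c" "p \<in> fst c'"
  shows "fst (gcomp M c' p a) = trans_der c c' (snd c p) (fst (gcomp M c p a))"
    and "blinfun_apply (snd (gcomp M c p a)) w =
      blinfun_apply (snd (gcomp M c' p a)) (trans_der c c' (snd c p) w)"
  using chart_at[OF in_carrier[OF c(1) p(1)]] c p
  by (simp_all add: gcomp_apply trans_der_comp[symmetric])

lemma trans_der_inverse:
  assumes c: "c \<in> atlas M" "c' \<in> atlas M" and p: "p \<in> fst c" "p \<in> fst c'"
  shows "trans_der c' c (snd c' p) (trans_der c c' (snd c p) v) = v"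
  using c p by (simp add: trans_der_comp[symmetric] trans_der_self)

text \<open>Covectors pull back, so that the transformation law determines the components with respect to
  \<open>c\<close> only because the coordinate change is invertible.\<close>

lemma gcomp_eqI:
  assumes c: "c \<in> atlas M" and p: "p \<in> fst c"
  defines "A \<equiv> trans_der (chart_at M p) c (snd (chart_at M p) p)"
  assumes b: "fst b = A (fst a)" "\<And>w. blinfun_apply (snd a) w = blinfun_apply (snd b) (A w)"
  shows "gcomp M c p a = b"
proof (rule prod_eqI)
  note c0 = chart_at[OF in_carrier[OF c p]]
  show "fst (gcomp M c p a) = fst b"
    by (simp add: gcomp_apply[OF c p] b A_def)
  show "snd (gcomp M c p a) = snd b"
    using c0 c p by (intro blinfun_eqI) (simp add: gcomp_apply b(2) A_def trans_der_inverse)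
qed

lemma pairing_gcomp:
  assumes c: "c \<in> atlas M" and p: "p \<in> fst c"
  shows "blinfun_apply (snd (gcomp M c p a)) (fst (gcomp M c p b)) = blinfun_apply (snd a) (fst b)"
  using chart_at[OF in_carrier[OF c p]] c p by (simp add: gcomp_apply trans_der_inverse)

lemma metric_gcomp:
  "c \<in> atlas M \<Longrightarrow> p \<in> fst c \<Longrightarrow> metric_E (gcomp M c p a) (gcomp M c p b) = metric_E a b"
  by (simp add: metric_E_def pairing_gcomp)

lemma omega_gcomp:
  "c \<in> atlas M \<Longrightarrow> p \<in> fst c \<Longrightarrow> omega_E (gcomp M c p a) (gcomp M c p b) = omega_E a b"
  by (simp add: omega_E_def pairing_gcomp)

lemma gcomp_eq_0_iff:
  assumes c: "c \<in> atlas M" and p: "p \<in> fst c"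
  shows "gcomp M c p a = 0 \<longleftrightarrow> a = 0"
proof
  let ?c = "chart_at M p"
  have c0: "?c \<in> atlas M" "p \<in> fst ?c" using chart_at[OF in_carrier[OF c p]] by auto
  assume z: "gcomp M c p a = 0"
  have "gcomp M ?c p a = 0"
  proof (rule prod_eqI)
    have "trans_der c ?c (snd c p) 0 = 0"
      by (rule linear_0[OF linear_trans_der]) (use c c0 p in auto)
    then show "fst (gcomp M ?c p a) = fst 0"
      using gcomp_change(1)[OF c c0(1) p c0(2), of a] z by simp
    show "snd (gcomp M ?c p a) = snd 0"
      by (rule blinfun_eqI) (simp add: gcomp_change(2)[OF c0(1) c c0(2) p] z)
  qed
  then show "a = 0" using gcomp_chart_at[OF in_carrier[OF c p]] by simp
qed (simp add: linear_0[OF linear_gcomp])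

lemma inj_gcomp:
  assumes "c \<in> atlas M" "p \<in> fst c"
  shows "inj (gcomp M c p)"
  by (simp add: linear_injective_0[OF linear_gcomp] gcomp_eq_0_iff[OF assms])

lemma sec_rep_at: "c \<in> atlas M \<Longrightarrow> p \<in> fst c \<Longrightarrow> sec_rep M c s (snd c p) = gcomp M c p (s p)"
  by (simp add: sec_rep_def chart_inv_left)

lemma sec_rep_chart_at:
  "p \<in> carrier M \<Longrightarrow> sec_rep M (chart_at M p) s (snd (chart_at M p) p) = s p"
  using chart_at by (simp add: sec_rep_at gcomp_chart_at)

lemma sec_rep_change:
  assumes c: "c \<in> atlas M" "c' \<in> atlas M" and y: "y \<in> snd c ` (fst c \<inter> fst c')"
  shows "fst (sec_rep M c' s ((snd c' \<circ> chart_inv c) y)) = trans_der c c' y (fst (sec_rep M c s y))"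
    and "blinfun_apply (snd (sec_rep M c s y)) w =
      blinfun_apply (snd (sec_rep M c' s ((snd c' \<circ> chart_inv c) y))) (trans_der c c' y w)"
proof -
  obtain p where p: "p \<in> fst c" "p \<in> fst c'" "y = snd c p" using y by auto
  have *: "(snd c' \<circ> chart_inv c) (snd c p) = snd c' p" using p c by (simp add: chart_inv_left)
  show "fst (sec_rep M c' s ((snd c' \<circ> chart_inv c) y)) = trans_der c c' y (fst (sec_rep M c s y))"
    unfolding p(3) * sec_rep_at[OF c(1) p(1)] sec_rep_at[OF c(2) p(2)] by (rule gcomp_change[OF c p(1,2)])
  show "blinfun_apply (snd (sec_rep M c s y)) w =
      blinfun_apply (snd (sec_rep M c' s ((snd c' \<circ> chart_inv c) y))) (trans_der c c' y w)"
    unfolding p(3) * sec_rep_at[OF c(1) p(1)] sec_rep_at[OF c(2) p(2)] by (rule gcomp_change[OF c p(1,2)])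
qed

lemma transforms_sec_rep:
  assumes "c \<in> atlas M" "c' \<in> atlas M" "S \<subseteq> snd c ` (fst c \<inter> fst c')"
  shows "transforms S (snd c' \<circ> chart_inv c) (sec_rep M c s) (sec_rep M c' s)"
  using sec_rep_change[OF assms(1,2) subsetD[OF assms(3)]]
  unfolding transforms_def trans_der_def by blast

lemma smooth_section_iff:
  assumes U: "open_in M U"
  shows "smooth_section M U s \<longleftrightarrow> (\<forall>c\<in>atlas M. smooth_on (snd c ` (U \<inter> fst c)) (sec_rep M c s))"
proof -
  have "smooth_on (snd c ` (U \<inter> fst c)) (\<lambda>x. fst (sec_rep M c s x)) \<and>
      smooth_on (snd c ` (U \<inter> fst c)) (\<lambda>x. snd (sec_rep M c s x)) \<longleftrightarrow>
      smooth_on (snd c ` (U \<inter> fst c)) (sec_rep M c s)" if c: "c \<in> atlas M" for c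
    using smooth_on_Pair[OF open_chart_image_of_open[OF c U], of "\<lambda>x. fst (sec_rep M c s x)" "\<lambda>x. snd (sec_rep M c s x)"]
      smooth_on_fst[OF open_chart_image_of_open[OF c U]] smooth_on_snd[OF open_chart_image_of_open[OF c U]]
    by auto
  then show ?thesis
    unfolding smooth_section_def smooth_vf_def smooth_form_def sec_rep_simps by blast
qed

lemma smooth_section_cong:
  assumes U: "open_in M U" and s: "smooth_section M U s" and eq: "\<And>p. p \<in> U \<Longrightarrow> s p = t p"
  shows "smooth_section M U t"
  unfolding smooth_section_iff[OF U]
proof
  fix c assume c: "c \<in> atlas M"
  show "smooth_on (snd c ` (U \<inter> fst c)) (sec_rep M c t)"
    by (rule smooth_on_cong[OF open_chart_image_of_open[OF c U], of "sec_rep M c s"])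
      (use s c in \<open>simp add: smooth_section_iff[OF U]\<close>, use c eq in \<open>auto simp: sec_rep_def chart_inv_left\<close>)
qed

lemma smooth_section_subset:
  "smooth_section M U s \<Longrightarrow> V \<subseteq> U \<Longrightarrow> smooth_section M V s"
  unfolding smooth_section_def smooth_vf_def smooth_form_def
  by (meson smooth_on_subset image_mono Int_mono subset_refl)

lemma smooth_section_add:
  assumes "open_in M U" "smooth_section M U s" "smooth_section M U t"
  shows "smooth_section M U (\<lambda>q. s q + t q)"
  using assms by (simp add: smooth_section_iff sec_rep_add[abs_def] smooth_on_add open_chart_image_of_open)

lemma smooth_section_scaleR:
  assumes "open_in M U" "smooth_fun M U f" "smooth_section M U s"
  shows "smooth_section M U (\<lambda>q. f q *\<^sub>R s q)"
  using assms by (simp add: smooth_section_iff sec_rep_scaleR[abs_def] smooth_fun_def o_def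
      smooth_on_scaleR open_chart_image_of_open)

lemma smooth_section_zero: "open_in M U \<Longrightarrow> smooth_section M U (\<lambda>_. 0)"
  by (simp add: smooth_section_iff sec_rep_def[abs_def] linear_0[OF linear_gcomp] smooth_on_const)

lemma smooth_fun_const: "smooth_fun M U (\<lambda>_. c)"
  by (simp add: smooth_fun_def o_def smooth_on_const)

lemma smooth_fun_subset: "smooth_fun M U f \<Longrightarrow> V \<subseteq> U \<Longrightarrow> smooth_fun M V f"
  unfolding smooth_fun_def by (meson smooth_on_subset image_mono Int_mono subset_refl)

lemma smooth_section_local:
  assumes U: "open_in M U"
    and "\<And>p. p \<in> U \<Longrightarrow> \<exists>V. open_in M V \<and> p \<in> V \<and> smooth_section M V s"
  shows "smooth_section M U s"
  unfolding smooth_section_iff[OF U]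
proof
  fix c assume c: "c \<in> atlas M"
  show "smooth_on (snd c ` (U \<inter> fst c)) (sec_rep M c s)"
  proof (rule smooth_on_local)
    fix x assume "x \<in> snd c ` (U \<inter> fst c)"
    then obtain p where p: "p \<in> U" "p \<in> fst c" "x = snd c p" by auto
    obtain V where V: "open_in M V" "p \<in> V" "smooth_section M V s"
      using assms(2)[OF p(1)] by blast
    then show "\<exists>T. open T \<and> x \<in> T \<and> smooth_on T (sec_rep M c s)"
      using p c by (intro exI[of _ "snd c ` (V \<inter> fst c)"])
        (auto simp: smooth_section_iff open_chart_image_of_open)
  qed
qed

text \<open>Smoothness in a single chart suffices, as the transition maps are smooth.\<close>

lemma smooth_fun_in_chart:
  assumes c: "c \<in> atlas M" and U: "open_in M U" "U \<subseteq> fst c"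
    and f: "smooth_on (snd c ` U) g" and eq: "\<And>p. p \<in> U \<Longrightarrow> f p = g (snd c p)"
  shows "smooth_fun M U f"
  unfolding smooth_fun_def
proof
  fix c' assume c': "c' \<in> atlas M"
  have op: "open (snd c' ` (U \<inter> fst c'))" by (rule open_chart_image_of_open[OF c' U(1)])
  have sm: "smooth_on (snd c' ` (U \<inter> fst c')) (snd c \<circ> chart_inv c')"
    by (rule smooth_on_subset[OF smooth_trans[OF c' c]]) (use U(2) in auto)
  show "smooth_on (snd c' ` (U \<inter> fst c')) (f \<circ> chart_inv c')"
    by (rule smooth_on_cong[OF op smooth_on_compose[OF op sm f]])
      (auto simp: chart_inv_left c' eq)
qed

section \<open>The Courant bracket in an arbitrary chart\<close>

lemma courant_bracket_chart_at:
  assumes p: "p \<in> carrier M"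
  defines "c \<equiv> chart_at M p"
  shows "courant_bracket M s t p = coord_bracket (sec_rep M c s) (sec_rep M c t) (snd c p)"
proof -
  have c: "c \<in> atlas M" "p \<in> fst c" using chart_at[OF p] by (auto simp: c_def)
  have "der ((\<lambda>q. omega_E (s q) (t q)) \<circ> chart_inv c) (snd c p) =
    der (\<lambda>y. omega_E (sec_rep M c s y) (sec_rep M c t y)) (snd c p)"
    by (rule frechet_derivative_cong_open[OF open_chart_image[OF c(1)]])
      (use c in \<open>auto simp: sec_rep_def omega_gcomp chart_inv_left\<close>)
  then show ?thesis
    by (simp add: courant_bracket_def coord_bracket_def lie_bracket_def lie_deriv_form_def
        ext_deriv_def sec_rep_simps Let_def c_def[symmetric])
qed

lemma sec_rep_courant_bracket:
  assumes U: "open_in M U" and s: "smooth_section M U s" and t: "smooth_section M U t"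
    and c: "c \<in> atlas M" and p: "p \<in> U" "p \<in> fst c"
  shows "sec_rep M c (courant_bracket M s t) (snd c p) =
    coord_bracket (sec_rep M c s) (sec_rep M c t) (snd c p)"
proof -
  let ?c = "chart_at M p"
  let ?S = "snd ?c ` (fst c \<inter> U \<inter> fst ?c)" and ?\<phi> = "snd c \<circ> chart_inv ?c"
  have c0: "?c \<in> atlas M" "p \<in> fst ?c" using chart_at[OF in_carrier[OF c p(2)]] by auto
  have S: "open ?S" "snd ?c p \<in> ?S"
    using p c c0 U by (auto intro!: open_chart_image_of_open openin_Int openin_chart)
  have sm: "smooth_on ?S ?\<phi>"
    by (rule smooth_on_subset[OF smooth_trans[OF c0(1) c]]) auto
  have T: "?\<phi> ` ?S \<subseteq> snd c ` (U \<inter> fst c)"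
    using chart_inv_left[OF c0(1)] by auto
  have rs: "smooth_on ?S (sec_rep M ?c u)" "smooth_on (snd c ` (U \<inter> fst c)) (sec_rep M c u)"
    if "smooth_section M U u" for u
    using that c c0 U by (auto simp: smooth_section_iff intro: smooth_on_subset)
  have tr: "transforms ?S ?\<phi> (sec_rep M ?c u) (sec_rep M c u)" for u
    by (rule transforms_sec_rep[OF c0(1) c]) auto
  have \<phi>p: "?\<phi> (snd ?c p) = snd c p" using c0 by (simp add: chart_inv_left)
  note natural = coord_bracket_natural[OF S sm T rs[OF s] tr rs[OF t] tr, folded trans_der_def, unfolded \<phi>p]
  show ?thesis
    unfolding sec_rep_at[OF c p(2)] courant_bracket_chart_at[OF in_carrier[OF c p(2)]]
    by (rule gcomp_eqI[OF c p(2) natural])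
qed

lemma smooth_section_courant_bracket:
  assumes U: "open_in M U" and s: "smooth_section M U s" and t: "smooth_section M U t"
  shows "smooth_section M U (courant_bracket M s t)"
  unfolding smooth_section_iff[OF U]
proof
  fix c assume c: "c \<in> atlas M"
  have op: "open (snd c ` (U \<inter> fst c))" by (rule open_chart_image_of_open[OF c U])
  show "smooth_on (snd c ` (U \<inter> fst c)) (sec_rep M c (courant_bracket M s t))"
    by (rule smooth_on_cong[OF op smooth_on_coord_bracket[OF op, of "sec_rep M c s" "sec_rep M c t"]])
      (use c s t sec_rep_courant_bracket[OF U s t c] in \<open>auto simp: smooth_section_iff[OF U]\<close>)
qed

lemma courant_bracket_cong:
  assumes U: "open_in M U" "p \<in> U"
    and "\<And>q. q \<in> U \<Longrightarrow> s q = s' q" "\<And>q. q \<in> U \<Longrightarrow> t q = t' q"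
  shows "courant_bracket M s t p = courant_bracket M s' t' p"
proof -
  have p: "p \<in> carrier M" using openin_subset_carrier[OF U(1)] U(2) by auto
  note c = chart_at[OF p]
  show ?thesis
    unfolding courant_bracket_chart_at[OF p]
    by (rule coord_bracket_cong[OF open_chart_image_of_open[OF _ U(1)]])
      (use c U in_chart_image_iff assms(3,4) in \<open>auto simp: sec_rep_def chart_inv_left\<close>)
qed

end

section \<open>Germs\<close>

lemma germ_eqI:
  assumes U: "open_in M U" "p \<in> U" and eq: "\<And>q. q \<in> U \<Longrightarrow> s q = t q"
  shows "germ M p s = germ M p t"
proof -
  have "germ M p s \<subseteq> germ M p t" if eq: "\<And>q. q \<in> U \<Longrightarrow> s q = t q" for s t :: "_ \<Rightarrow> 'v"
  proof
    fix u assume "u \<in> germ M p s"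
    then obtain V where "open_in M V" "p \<in> V" "\<forall>q\<in>V. u q = s q"
      by (auto simp: germ_def)
    then show "u \<in> germ M p t"
      unfolding germ_def using U eq by (intro CollectI exI[of _ "U \<inter> V"]) auto
  qed
  from this[of s t] this[of t s] show ?thesis using eq by auto
qed

context charted_manifold
begin

context
  fixes p :: 'a
  assumes p: "p \<in> carrier M"
begin

lemma germ_self: "s \<in> germ M p s"
  unfolding germ_def using p openin_carrier by blast

lemma germ_eqD:
  assumes "germ M p s = germ M p t"
  obtains U where "open_in M U" "p \<in> U" "\<And>q. q \<in> U \<Longrightarrow> s q = t q"
  using germ_self[of s] unfolding assms by (auto simp: germ_def)

lemma germ_add_germ: "germ_add (germ M p s) (germ M p t) = germ M p (\<lambda>q. s q + t q :: 'v::real_vector)"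
proof safe
  fix u assume "u \<in> germ_add (germ M p s) (germ M p t)"
  then obtain s' t' U V where u: "u = (\<lambda>q. s' q + t' q)"
    and U: "open_in M U" "p \<in> U" "\<forall>q\<in>U. s' q = s q"
    and V: "open_in M V" "p \<in> V" "\<forall>q\<in>V. t' q = t q"
    unfolding germ_add_def germ_def by blast
  then show "u \<in> germ M p (\<lambda>q. s q + t q)"
    unfolding germ_def by (intro CollectI exI[of _ "U \<inter> V"]) auto
next
  fix u assume u: "u \<in> germ M p (\<lambda>q. s q + t q)"
  have "(\<lambda>q. u q - t q) \<in> germ M p s"
    using u unfolding germ_def by (auto simp: algebra_simps)
  then show "u \<in> germ_add (germ M p s) (germ M p t)"
    unfolding germ_add_def using germ_self[of t]
    by (intro CollectI exI[of _ "\<lambda>q. u q - t q"] exI[of _ t]) simp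
qed

lemma germ_scale_germ: "germ_scale (germ M p f) (germ M p s) = germ M p (\<lambda>q. f q *\<^sub>R s q :: 'v::real_vector)"
proof safe
  fix u assume "u \<in> germ_scale (germ M p f) (germ M p s)"
  then obtain f' s' U V where u: "u = (\<lambda>q. f' q *\<^sub>R s' q)"
    and U: "open_in M U" "p \<in> U" "\<forall>q\<in>U. f' q = f q"
    and V: "open_in M V" "p \<in> V" "\<forall>q\<in>V. s' q = s q"
    unfolding germ_scale_def germ_def by blast
  then show "u \<in> germ M p (\<lambda>q. f q *\<^sub>R s q)"
    unfolding germ_def by (intro CollectI exI[of _ "U \<inter> V"]) auto
next
  fix u assume "u \<in> germ M p (\<lambda>q. f q *\<^sub>R s q)"
  then obtain U where U: "open_in M U" "p \<in> U" "\<forall>q\<in>U. u q = f q *\<^sub>R s q"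
    by (auto simp: germ_def)
  \<comment> \<open>Away from \<open>p\<close> the factors are chosen such that every representative of the product is a product.\<close>
  define f' where "f' q = (if q \<in> U then f q else 1)" for q
  define s' where "s' q = (if q \<in> U then s q else u q)" for q
  have "f' \<in> germ M p f" "s' \<in> germ M p s"
    unfolding germ_def f'_def s'_def using U by auto
  moreover have "u = (\<lambda>q. f' q *\<^sub>R s' q)"
    using U by (auto simp: f'_def s'_def)
  ultimately show "u \<in> germ_scale (germ M p f) (germ M p s)"
    unfolding germ_scale_def by blast
qed

lemma germ_lincomb_germ:
  "(\<And>i. i < k \<Longrightarrow> \<phi> i = germ M p (f i)) \<Longrightarrow>
    germ_lincomb M p \<phi> (\<lambda>i. germ M p (e i)) k = germ M p (\<lambda>q. \<Sum>i<k. f i q *\<^sub>R e i q)"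
  by (induction k) (auto simp: germ_add_germ germ_scale_germ)

end

lemma smooth_section_sum:
  assumes U: "open_in M U" and "\<And>i. i \<in> I \<Longrightarrow> smooth_section M U (s i)"
  shows "smooth_section M U (\<lambda>q. \<Sum>i\<in>I. s i q)"
  using assms(2)
  by (induction I rule: infinite_finite_induct)
    (auto simp: smooth_section_zero[OF U] intro: smooth_section_add[OF U])

section \<open>Local frames of almost Dirac structures\<close>

definition frame_on :: "('a \<Rightarrow> 'e gvec set) \<Rightarrow> 'a set \<Rightarrow> (nat \<Rightarrow> 'a \<Rightarrow> 'e gvec) \<Rightarrow> bool" where
  "frame_on D U e \<longleftrightarrow> open_in M U \<and> (\<forall>i<DIM('e). smooth_section M U (e i)) \<and>
     (\<forall>q\<in>U. span ((\<lambda>i. e i q) ` {..<DIM('e)}) = D q \<and>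
        (\<forall>c. (\<Sum>i<DIM('e). c i *\<^sub>R e i q) = 0 \<longrightarrow> (\<forall>i<DIM('e). c i = 0)))"

text \<open>The rank of a maximal isotropic subbundle is the dimension of the manifold.\<close>

lemma almost_dirac_frame:
  assumes D: "almost_dirac M D" and p: "p \<in> carrier M"
  obtains U e where "p \<in> U" "frame_on D U e"
proof -
  obtain U and r :: nat and e where U: "open_in M U" "p \<in> U"
    and e: "\<forall>i<r. smooth_section M U (e i)"
    and fr: "\<forall>q\<in>U. inj_on (\<lambda>i. e i q) {..<r} \<and> independent ((\<lambda>i. e i q) ` {..<r}) \<and>
           span ((\<lambda>i. e i q) ` {..<r}) = D q"
    using D p unfolding almost_dirac_def vector_subbundle_def by blast
  have "maximal_isotropic (D p)" using D p by (simp add: almost_dirac_def)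
  then have "r = DIM('e)"
    using fr U(2) gdim_frame[of "\<lambda>i. e i p" "{..<r}"] by (simp add: maximal_isotropic_iff)
  moreover have "\<forall>c. (\<Sum>i<r. c i *\<^sub>R e i q) = 0 \<longrightarrow> (\<forall>i\<in>{..<r}. c i = 0)" if "q \<in> U" for q
    using fr that independent_family_iff[of "{..<r}" "\<lambda>i. e i q"] by simp
  ultimately have "frame_on D U e"
    unfolding frame_on_def using U e fr by auto
  then show ?thesis using that U(2) by blast
qed

text \<open>An isotropic space with a basis of \<open>n\<close> elements is maximal.\<close>

lemma frame_on_almost_diracI:
  assumes "\<And>p. p \<in> carrier M \<Longrightarrow> \<exists>U e. p \<in> U \<and> frame_on D U e"
    and iso: "\<And>p. p \<in> carrier M \<Longrightarrow> isotropic (D p)"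
  shows "almost_dirac M D"
proof -
  have indep: "inj_on (\<lambda>i. e i q) {..<DIM('e)} \<and> independent ((\<lambda>i. e i q) ` {..<DIM('e)})"
    if "frame_on D U e" "q \<in> U" for U e q
    using that independent_family_iff[of "{..<DIM('e)}" "\<lambda>i. e i q"] by (simp add: frame_on_def)
  have "vector_subbundle M D"
    unfolding vector_subbundle_def
  proof
    fix p assume "p \<in> carrier M"
    then obtain U e where U: "p \<in> U" "frame_on D U e" using assms(1) by blast
    then show "\<exists>U (r::nat) e. open_in M U \<and> p \<in> U \<and>
        (\<forall>i<r. smooth_section M U (e i)) \<and>
        (\<forall>q\<in>U. inj_on (\<lambda>i. e i q) {..<r} \<and> independent ((\<lambda>i. e i q) ` {..<r}) \<and>
           span ((\<lambda>i. e i q) ` {..<r}) = D q)"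
      using indep[OF U(2)] by (intro exI[of _ U] exI[of _ "DIM('e)"] exI[of _ e]) (auto simp: frame_on_def)
  qed
  moreover have "maximal_isotropic (D p)" if p: "p \<in> carrier M" for p
  proof -
    obtain U e where U: "p \<in> U" "frame_on D U e" using assms(1)[OF p] by blast
    have "span ((\<lambda>i. e i p) ` {..<DIM('e)}) = D p" using U by (simp add: frame_on_def)
    then have "gdim (D p) = DIM('e)"
      using gdim_frame[of "\<lambda>i. e i p" "{..<DIM('e)}"] indep[OF U(2,1)] by auto
    then show ?thesis using iso[OF p] by (simp add: maximal_isotropic_iff)
  qed
  ultimately show ?thesis by (simp add: almost_dirac_def)
qed

lemma frame_on_span: "frame_on D U e \<Longrightarrow> q \<in> U \<Longrightarrow> span ((\<lambda>i. e i q) ` {..<DIM('e)}) = D q"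
  by (simp add: frame_on_def)

lemma frame_on_independent:
  "frame_on D U e \<Longrightarrow> q \<in> U \<Longrightarrow> (\<Sum>i<DIM('e). a i *\<^sub>R e i q) = 0 \<Longrightarrow> i < DIM('e) \<Longrightarrow> a i = 0"
  by (simp add: frame_on_def)

lemma frame_on_section:
  assumes fr: "frame_on D U e" and i: "i < DIM('e)"
  shows "section_of M D U (e i)"
proof -
  have "e i q \<in> span ((\<lambda>i. e i q) ` {..<DIM('e)})" for q
    using i by (intro span_base) auto
  then show ?thesis using fr i unfolding section_of_def frame_on_def by auto
qed

lemma section_of_frame_sum:
  assumes "frame_on D U e" and W: "open_in M W" "W \<subseteq> U"
    and f: "\<And>i. i < DIM('e) \<Longrightarrow> smooth_fun M W (f i)"
  shows "section_of M D W (\<lambda>q. \<Sum>i<DIM('e). f i q *\<^sub>R e i q)"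
  unfolding section_of_def
proof (intro conjI ballI)
  show "smooth_section M W (\<lambda>q. \<Sum>i<DIM('e). f i q *\<^sub>R e i q)"
    using assms by (intro smooth_section_sum smooth_section_scaleR W f)
      (auto simp: frame_on_def intro: smooth_section_subset)
  fix q assume "q \<in> W"
  then have D: "D q = span ((\<lambda>i. e i q) ` {..<DIM('e)})" using assms by (auto simp: frame_on_def)
  show "(\<Sum>i<DIM('e). f i q *\<^sub>R e i q) \<in> D q"
    unfolding D by (intro span_sum span_scale span_base) auto
qed

lemma frame_coefficients:
  assumes fr: "frame_on D U e" and V: "open_in M V" and s: "section_of M D V s"
    and p: "p \<in> U" "p \<in> V"
  obtains W f where "open_in M W" "p \<in> W" "W \<subseteq> U \<inter> V"
    "\<And>i. i < DIM('e) \<Longrightarrow> smooth_fun M W (f i)"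
    "\<And>q. q \<in> W \<Longrightarrow> s q = (\<Sum>i<DIM('e). f i q *\<^sub>R e i q)"
proof -
  let ?n = "DIM('e)" and ?c = "chart_at M p"
  have U: "open_in M U" using fr by (simp add: frame_on_def)
  have c: "?c \<in> atlas M" "p \<in> fst ?c" using chart_at openin_subset_carrier[OF U] p by auto
  define W where "W = U \<inter> V \<inter> fst ?c"
  have W: "open_in M W" "p \<in> W" "W \<subseteq> U \<inter> V" "W \<subseteq> fst ?c"
    using U V c p by (auto simp: W_def openin_chart)
  let ?S = "snd ?c ` W"
  have S: "?S = snd ?c ` (W \<inter> fst ?c)" using W(4) by (simp add: Int_absorb2)
  have opS: "open ?S" unfolding S by (rule open_chart_image_of_open[OF c(1) W(1)])
  have comb: "(\<Sum>i<?n. a i *\<^sub>R sec_rep M ?c (e i) (snd ?c q)) = gcomp M ?c q (\<Sum>i<?n. a i *\<^sub>R e i q)"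
    if "q \<in> W" for a q
    using that W(4) c by (auto simp: sec_rep_at linear_sum[OF linear_gcomp] linear_cmul[OF linear_gcomp])
  have "\<exists>g. (\<forall>i<?n. smooth_on ?S (g i)) \<and>
      (\<forall>x\<in>?S. sec_rep M ?c s x = (\<Sum>i<?n. g i x *\<^sub>R sec_rep M ?c (e i) x))"
  proof (rule smooth_frame_coefficients[OF opS])
    show "smooth_on ?S (sec_rep M ?c (e i))" if "i < ?n" for i
    proof -
      have "smooth_section M W (e i)"
        using fr that W(3) by (auto simp: frame_on_def intro: smooth_section_subset)
      then show ?thesis using c S by (simp add: smooth_section_iff[OF W(1)])
    qed
    have "smooth_section M W s"
      using s W(3) by (auto simp: section_of_def intro: smooth_section_subset)
    then show "smooth_on ?S (sec_rep M ?c s)" using c S by (simp add: smooth_section_iff[OF W(1)])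
    show "a i = 0" if x: "x \<in> ?S" and z: "(\<Sum>i<?n. a i *\<^sub>R sec_rep M ?c (e i) x) = 0" and i: "i < ?n" for x a i
    proof -
      obtain q where q: "q \<in> W" "x = snd ?c q" using x by auto
      have "(\<Sum>i<?n. a i *\<^sub>R e i q) = 0"
        using z comb[OF q(1)] gcomp_eq_0_iff[OF c(1) subsetD[OF W(4) q(1)]] by (simp add: q(2))
      then show ?thesis using fr q(1) W(3) i by (auto simp: frame_on_def)
    qed
    show "sec_rep M ?c s x \<in> span ((\<lambda>i. sec_rep M ?c (e i) x) ` {..<?n})" if x: "x \<in> ?S" for x
    proof -
      obtain q where q: "q \<in> W" "x = snd ?c q" using x by auto
      have "s q \<in> span ((\<lambda>i. e i q) ` {..<?n})"
        using s q(1) W(3) frame_on_span[OF fr, of q] by (auto simp: section_of_def)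
      then obtain a where "s q = (\<Sum>i<?n. a i *\<^sub>R e i q)"
        using span_family[OF finite_lessThan] by blast
      then have "sec_rep M ?c s x = (\<Sum>i<?n. a i *\<^sub>R sec_rep M ?c (e i) x)"
        using q comb[OF q(1)] W(4) c(1) by (auto simp: sec_rep_at)
      then show ?thesis by (simp only:) (intro span_sum span_scale span_base imageI)
    qed
  qed
  then obtain g where g: "\<And>i. i < ?n \<Longrightarrow> smooth_on ?S (g i)"
    "\<And>x. x \<in> ?S \<Longrightarrow> sec_rep M ?c s x = (\<Sum>i<?n. g i x *\<^sub>R sec_rep M ?c (e i) x)"
    by blast
  show ?thesis
  proof (rule that[OF W(1,2,3), of "\<lambda>i q. g i (snd ?c q)"])
    show "smooth_fun M W (\<lambda>q. g i (snd ?c q))" if "i < ?n" for i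
      by (rule smooth_fun_in_chart[OF c(1) W(1,4) g(1)[OF that] refl])
    show "s q = (\<Sum>i<?n. g i (snd ?c q) *\<^sub>R e i q)" if q: "q \<in> W" for q
    proof -
      have qc: "q \<in> fst ?c" using q W(4) by auto
      have "gcomp M ?c q (s q) = gcomp M ?c q (\<Sum>i<?n. g i (snd ?c q) *\<^sub>R e i q)"
        using g(2)[of "snd ?c q"] q comb[OF q] sec_rep_at[OF c(1) qc] by auto
      then show ?thesis using injD[OF inj_gcomp[OF c(1) qc]] by blast
    qed
  qed
qed

text \<open>Injectivity is the pointwise independence of a frame, and surjectivity is the smoothness of the
  coefficients.\<close>

lemma locally_free_section_germs:
  assumes D: "almost_dirac M D"
  shows "locally_free M DIM('e) (section_germs M D)"
  unfolding locally_free_def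
proof
  let ?n = "DIM('e)"
  fix p assume "p \<in> carrier M"
  then obtain U e where U: "p \<in> U" "frame_on D U e" using almost_dirac_frame[OF D] by blast
  have opU: "open_in M U" using U(2) by (simp add: frame_on_def)
  note sec = frame_on_section[OF U(2)]
  have bij: "bij_betw (\<lambda>\<phi>. germ_lincomb M q \<phi> (\<lambda>i. germ M q (e i)) ?n)
             ({..<?n} \<rightarrow>\<^sub>E function_germs M q) (section_germs M D q)" if q: "q \<in> U" for q
  proof -
    have qM: "q \<in> carrier M" using openin_subset_carrier[OF opU] q by auto
    have rep: "\<exists>f W. open_in M W \<and> q \<in> W \<and> W \<subseteq> U \<and> (\<forall>i<?n. smooth_fun M W (f i) \<and> \<phi> i = germ M q (f i))"
      if \<phi>: "\<phi> \<in> {..<?n} \<rightarrow>\<^sub>E function_germs M q" for \<phi>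
    proof -
      have "\<forall>i<?n. \<exists>f V. \<phi> i = germ M q f \<and> open_in M V \<and> q \<in> V \<and> smooth_fun M V f"
        using \<phi> unfolding function_germs_def by (auto dest!: PiE_mem)
      then obtain f V where fV: "\<And>i. i < ?n \<Longrightarrow> \<phi> i = germ M q (f i) \<and> open_in M (V i)
          \<and> q \<in> V i \<and> smooth_fun M (V i) (f i)" by metis
      let ?W = "\<Inter>((\<lambda>i. V i) ` {..<?n}) \<inter> U"
      have "open_in M (\<Inter>((\<lambda>i. V i) ` {..<?n}))"
        using fV by (intro openin_Inter) (auto simp: lessThan_empty_iff)
      then have "open_in M ?W" using opU by (rule openin_Int)
      then show ?thesis using fV q by (intro exI[of _ f] exI[of _ ?W]) (auto intro: smooth_fun_subset)
    qed
    show ?thesis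
      unfolding bij_betw_def
    proof (intro conjI inj_onI subset_antisym subsetI)
      fix \<phi> \<psi>
      assume \<phi>: "\<phi> \<in> {..<?n} \<rightarrow>\<^sub>E function_germs M q" and \<psi>: "\<psi> \<in> {..<?n} \<rightarrow>\<^sub>E function_germs M q"
        and eq: "germ_lincomb M q \<phi> (\<lambda>i. germ M q (e i)) ?n = germ_lincomb M q \<psi> (\<lambda>i. germ M q (e i)) ?n"
      obtain f where f: "\<And>i. i < ?n \<Longrightarrow> \<phi> i = germ M q (f i)" using rep[OF \<phi>] by blast
      obtain g where g: "\<And>i. i < ?n \<Longrightarrow> \<psi> i = germ M q (g i)" using rep[OF \<psi>] by blast
      have "germ_lincomb M q \<phi> (\<lambda>i. germ M q (e i)) ?n = germ M q (\<lambda>q. \<Sum>i<?n. f i q *\<^sub>R e i q)"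
        by (rule germ_lincomb_germ[OF qM f])
      moreover have "germ_lincomb M q \<psi> (\<lambda>i. germ M q (e i)) ?n = germ M q (\<lambda>q. \<Sum>i<?n. g i q *\<^sub>R e i q)"
        by (rule germ_lincomb_germ[OF qM g])
      ultimately have "germ M q (\<lambda>q. \<Sum>i<?n. f i q *\<^sub>R e i q) = germ M q (\<lambda>q. \<Sum>i<?n. g i q *\<^sub>R e i q)"
        using eq by simp
      then obtain V where V: "open_in M V" "q \<in> V"
        "\<And>q. q \<in> V \<Longrightarrow> (\<Sum>i<?n. f i q *\<^sub>R e i q) = (\<Sum>i<?n. g i q *\<^sub>R e i q)"
        by (rule germ_eqD[OF qM]) blast
      have fg: "f i q' = g i q'" if "q' \<in> U \<inter> V" "i < ?n" for i q'
      proof -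
        have "(\<Sum>i<?n. (f i q' - g i q') *\<^sub>R e i q') = 0"
          using V(3)[of q'] that by (simp add: scaleR_diff_left sum_subtractf)
        then have "f i q' - g i q' = 0"
          using frame_on_independent[OF U(2), of q' "\<lambda>i. f i q' - g i q'" i] that by simp
        then show ?thesis by simp
      qed
      have "\<phi> i = \<psi> i" if "i < ?n" for i
        unfolding f[OF that] g[OF that]
        by (rule germ_eqI[of M "U \<inter> V"]) (use opU V q fg that in auto)
      then show "\<phi> = \<psi>" by (intro PiE_ext[OF \<phi> \<psi>]) auto
    next
      fix h assume "h \<in> (\<lambda>\<phi>. germ_lincomb M q \<phi> (\<lambda>i. germ M q (e i)) ?n) ` ({..<?n} \<rightarrow>\<^sub>E function_germs M q)"
      then obtain \<phi> where \<phi>: "\<phi> \<in> {..<?n} \<rightarrow>\<^sub>E function_germs M q"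
        and h: "h = germ_lincomb M q \<phi> (\<lambda>i. germ M q (e i)) ?n" by blast
      obtain f W where W: "open_in M W" "q \<in> W" "W \<subseteq> U"
        and f: "\<And>i. i < ?n \<Longrightarrow> smooth_fun M W (f i)" "\<And>i. i < ?n \<Longrightarrow> \<phi> i = germ M q (f i)"
        using rep[OF \<phi>] by blast
      have "h = germ M q (\<lambda>q. \<Sum>i<?n. f i q *\<^sub>R e i q)"
        unfolding h by (rule germ_lincomb_germ[OF qM f(2)])
      then show "h \<in> section_germs M D q"
        unfolding section_germs_def
        by (intro CollectI exI conjI) (rule refl W section_of_frame_sum[OF U(2) W(1,3) f(1)] | assumption)+
    next
      fix h assume "h \<in> section_germs M D q"
      then obtain s V where h: "h = germ M q s" and V: "open_in M V" "q \<in> V"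
        and s: "section_of M D V s" unfolding section_germs_def by blast
      obtain W f where W: "open_in M W" "q \<in> W"
        and f: "\<And>i. i < ?n \<Longrightarrow> smooth_fun M W (f i)"
        and s_eq: "\<And>q. q \<in> W \<Longrightarrow> s q = (\<Sum>i<?n. f i q *\<^sub>R e i q)"
        by (rule frame_coefficients[OF U(2) V(1) s q V(2)]) blast
      define \<phi> where "\<phi> = (\<lambda>i\<in>{..<?n}. germ M q (f i))"
      have "\<phi> \<in> {..<?n} \<rightarrow>\<^sub>E function_germs M q"
        unfolding \<phi>_def function_germs_def using W f by auto
      moreover have "germ_lincomb M q \<phi> (\<lambda>i. germ M q (e i)) ?n = h"
        unfolding h
        by (subst germ_lincomb_germ[OF qM, of _ _ f], simp add: \<phi>_def, rule germ_eqI[OF W])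
          (simp add: s_eq)
      ultimately show "h \<in> (\<lambda>\<phi>. germ_lincomb M q \<phi> (\<lambda>i. germ M q (e i)) ?n) ` ({..<?n} \<rightarrow>\<^sub>E function_germs M q)"
        by blast
    qed
  qed
  show "\<exists>U e. open_in M U \<and> p \<in> U \<and>
        (\<forall>q\<in>U. (\<forall>i<?n. germ M q (e i) \<in> section_germs M D q) \<and>
           bij_betw (\<lambda>\<phi>. germ_lincomb M q \<phi> (\<lambda>i. germ M q (e i)) ?n)
             ({..<?n} \<rightarrow>\<^sub>E function_germs M q) (section_germs M D q))"
    using opU U(1) bij sec unfolding section_germs_def by (intro exI[of _ U] exI[of _ e]) blast
qed

end

section \<open>The tangent bundle as a manifold\<close>

context charted_manifold
begin

lemma fst_tangent_chart: "fst (tangent_chart M c) = fst c \<times> UNIV"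
  by (simp add: tangent_chart_def)

lemma snd_tangent_chart: "snd (tangent_chart M c) (p, v) = (snd c p, vec_comp M c p v)"
  by (simp add: tangent_chart_def)

lemma vec_comp_conv_gcomp: "vec_comp M c p v = fst (gcomp M c p (v, 0))"
  by (simp add: gcomp_def)

lemma vec_comp_change:
  assumes "c \<in> atlas M" "c' \<in> atlas M" "p \<in> fst c" "p \<in> fst c'"
  shows "vec_comp M c' p v = trans_der c c' (snd c p) (vec_comp M c p v)"
  unfolding vec_comp_conv_gcomp by (rule gcomp_change(1)[OF assms])

lemma vec_comp_chart_at: "p \<in> carrier M \<Longrightarrow> vec_comp M (chart_at M p) p v = v"
  by (simp add: vec_comp_conv_gcomp gcomp_chart_at)

lemma inj_vec_comp:
  assumes c: "c \<in> atlas M" "p \<in> fst c"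
  shows "vec_comp M c p v = vec_comp M c p w \<longleftrightarrow> v = w"
proof
  note c0 = chart_at[OF in_carrier[OF c]]
  assume "vec_comp M c p v = vec_comp M c p w"
  then have "vec_comp M (chart_at M p) p v = vec_comp M (chart_at M p) p w"
    using c c0 vec_comp_change[of c "chart_at M p" p] by simp
  then show "v = w" by (simp add: vec_comp_chart_at in_carrier[OF c])
qed simp

lemma surj_vec_comp:
  assumes c: "c \<in> atlas M" "p \<in> fst c"
  shows "\<exists>v. vec_comp M c p v = w"
proof
  note c0 = chart_at[OF in_carrier[OF c]]
  let ?v = "trans_der c (chart_at M p) (snd c p) w"
  have "vec_comp M c p ?v = trans_der (chart_at M p) c (snd (chart_at M p) p) ?v"
    using c c0 by (simp add: vec_comp_conv_gcomp gcomp_apply)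
  then show "vec_comp M c p ?v = w" using c c0 by (simp add: trans_der_inverse)
qed

lemma tangent_chart_image:
  assumes c: "c \<in> atlas M" and A: "A \<subseteq> fst c"
  shows "snd (tangent_chart M c) ` (A \<times> UNIV) = snd c ` A \<times> UNIV"
proof
  show "snd c ` A \<times> UNIV \<subseteq> snd (tangent_chart M c) ` (A \<times> UNIV)"
  proof
    fix z assume "z \<in> snd c ` A \<times> (UNIV :: 'e set)"
    then obtain p w where p: "p \<in> A" "z = (snd c p, w)" by auto
    obtain v where v: "vec_comp M c p v = w" using surj_vec_comp[OF c, of p w] p A by auto
    then show "z \<in> snd (tangent_chart M c) ` (A \<times> UNIV)"
      using p by (intro image_eqI[of _ _ "(p, v)"]) (auto simp: snd_tangent_chart)
  qed
qed (auto simp: snd_tangent_chart)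

lemma inj_tangent_chart:
  assumes c: "c \<in> atlas M"
  shows "inj_on (snd (tangent_chart M c)) (fst (tangent_chart M c))"
proof (rule inj_onI)
  fix z z' assume z: "z \<in> fst (tangent_chart M c)" "z' \<in> fst (tangent_chart M c)"
    and eq: "snd (tangent_chart M c) z = snd (tangent_chart M c) z'"
  obtain p v q w where pq: "z = (p, v)" "z' = (q, w)" "p \<in> fst c" "q \<in> fst c"
    using z by (auto simp: fst_tangent_chart)
  have "p = q" using eq pq inj_onD[OF inj_chart[OF c], of p q] by (simp add: snd_tangent_chart)
  then show "z = z'" using eq pq inj_vec_comp[OF c] by (auto simp: snd_tangent_chart)
qed

lemma tangent_chart_inv:
  assumes "c \<in> atlas M" "p \<in> fst c"
  shows "chart_inv (tangent_chart M c) (snd c p, vec_comp M c p v) = (p, v)"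
  using inv_into_f_f[OF inj_tangent_chart[OF assms(1)], of "(p, v)"] assms
  by (simp add: chart_inv_def fst_tangent_chart snd_tangent_chart)

text \<open>The coordinate change on \<open>TM\<close> involves only the two charts of \<open>M\<close>: the preferred charts that
  represent the tangent vectors cancel.\<close>

lemma tangent_transition:
  assumes c: "c \<in> atlas M" "c' \<in> atlas M" and x: "x \<in> snd c ` (fst c \<inter> fst c')"
  shows "(snd (tangent_chart M c') \<circ> chart_inv (tangent_chart M c)) (x, w) =
    ((snd c' \<circ> chart_inv c) x, trans_der c c' x w)"
proof -
  obtain p where p: "p \<in> fst c" "p \<in> fst c'" "x = snd c p" using x by auto
  obtain v where v: "vec_comp M c p v = w" using surj_vec_comp[OF c(1) p(1)] by blast
  then show ?thesis
    using c p tangent_chart_inv[OF c(1) p(1), of v] vec_comp_change[OF c p(1,2), of v]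
    by (simp add: snd_tangent_chart chart_inv_left)
qed

lemma atlas_tangent_bundle: "atlas (tangent_bundle M) = tangent_chart M ` atlas M"
  by (simp add: tangent_bundle_def)

lemma chart_at_tangent_bundle: "chart_at (tangent_bundle M) (p, v) = tangent_chart M (chart_at M p)"
  by (simp add: tangent_bundle_def)

lemma carrier_tangent_bundle: "carrier (tangent_bundle M) = carrier M \<times> UNIV"
  by (auto simp: carrier_def atlas_tangent_bundle fst_tangent_chart)

lemma overlap_tangent_chart:
  "fst (tangent_chart M c) \<inter> fst (tangent_chart M c') = (fst c \<inter> fst c') \<times> UNIV"
  by (auto simp: fst_tangent_chart)

lemma charted_manifold_tangent_bundle: "charted_manifold (tangent_bundle M)"
proof
  show "smooth_atlas (atlas (tangent_bundle M))"
    unfolding smooth_atlas_def atlas_tangent_bundle ball_simps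
  proof (intro conjI ballI)
    fix c assume c: "c \<in> atlas M"
    show "inj_on (snd (tangent_chart M c)) (fst (tangent_chart M c))" by (rule inj_tangent_chart[OF c])
    show "open (snd (tangent_chart M c) ` fst (tangent_chart M c))"
      using tangent_chart_image[OF c subset_refl] open_chart_image[OF c]
      by (simp add: fst_tangent_chart open_Times)
    fix c' assume c': "c' \<in> atlas M"
    let ?S = "snd c ` (fst c \<inter> fst c')"
    have img: "snd (tangent_chart M c) ` (fst (tangent_chart M c) \<inter> fst (tangent_chart M c')) = ?S \<times> UNIV"
      unfolding overlap_tangent_chart by (rule tangent_chart_image[OF c]) simp
    have op: "open (?S \<times> (UNIV :: 'e set))" by (intro open_Times open_overlap c c') simp
    then show "open (snd (tangent_chart M c) ` (fst (tangent_chart M c) \<inter> fst (tangent_chart M c')))"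
      by (simp add: img)
    have sub: "(\<lambda>z. fst z) ` (?S \<times> (UNIV :: 'e set)) \<subseteq> ?S" by auto
    note fs = smooth_on_fst[OF op smooth_on_ident] and sn = smooth_on_snd[OF op smooth_on_ident]
    show "smooth_on (snd (tangent_chart M c) ` (fst (tangent_chart M c) \<inter> fst (tangent_chart M c')))
      (snd (tangent_chart M c') \<circ> chart_inv (tangent_chart M c))"
      unfolding img
    proof (rule smooth_on_cong[OF op])
      show "smooth_on (?S \<times> UNIV) (\<lambda>z. ((snd c' \<circ> chart_inv c) (fst z), trans_der c c' (fst z) (snd z)))"
        unfolding trans_der_def
        by (rule smooth_on_Pair[OF op smooth_on_compose[OF op fs smooth_trans[OF c c'] sub]
              smooth_on_derivative[OF op smooth_trans[OF c c'] fs sub sn]])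
      show "((snd c' \<circ> chart_inv c) (fst z), trans_der c c' (fst z) (snd z)) =
          (snd (tangent_chart M c') \<circ> chart_inv (tangent_chart M c)) z" if "z \<in> ?S \<times> UNIV" for z
        using tangent_transition[OF c c', of "fst z" "snd z"] that by (simp add: mem_Times_iff)
    qed
  qed
  fix z assume "z \<in> carrier (tangent_bundle M)"
  then show "chart_at (tangent_bundle M) z \<in> atlas (tangent_bundle M) \<and> z \<in> fst (chart_at (tangent_bundle M) z)"
    using chart_at[of "fst z"]
    by (cases z) (auto simp: carrier_tangent_bundle chart_at_tangent_bundle atlas_tangent_bundle fst_tangent_chart)
qed

lemma openin_tangent_bundle:
  assumes U: "open_in M U"
  shows "open_in (tangent_bundle M) (U \<times> UNIV)"
proof (subst openin_subopen, intro ballI)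
  interpret TM: charted_manifold "tangent_bundle M" by (rule charted_manifold_tangent_bundle)
  fix z assume z: "z \<in> U \<times> (UNIV :: 'e set)"
  then have "fst z \<in> carrier M" using openin_subset_carrier[OF U] by auto
  then obtain c where c: "c \<in> atlas M" "fst z \<in> fst c" by (auto simp: carrier_def)
  have tc: "tangent_chart M c \<in> atlas (tangent_bundle M)" using c by (simp add: atlas_tangent_bundle)
  let ?V = "fst (tangent_chart M c) \<inter> snd (tangent_chart M c) -` (snd c ` (U \<inter> fst c) \<times> UNIV)"
  have "open_in (tangent_bundle M) ?V"
    by (rule TM.openin_chart_preimage[OF tc]) (intro open_Times open_chart_image_of_open c U open_UNIV)
  moreover have "?V = (U \<inter> fst c) \<times> UNIV"
    using inj_onD[OF inj_chart[OF c(1)]] by (fastforce simp: fst_tangent_chart snd_tangent_chart)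
  ultimately show "\<exists>T. open_in (tangent_bundle M) T \<and> z \<in> T \<and> T \<subseteq> U \<times> UNIV"
    using z c by (intro exI[of _ "(U \<inter> fst c) \<times> UNIV"]) auto
qed

section \<open>Lifts\<close>

text \<open>\<open>s\<^sup>C + t\<^sup>V\<close>. Treating both lifts at once makes the fibres of \<open>D\<^sup>t\<^sup>g\<close> exactly the sets of such values.\<close>

definition lift_section :: "('a \<Rightarrow> 'e gvec) \<Rightarrow> ('a \<Rightarrow> 'e gvec) \<Rightarrow> 'a \<times> 'e \<Rightarrow> ('e \<times> 'e) gvec" where
  "lift_section s t z = complete_lift M s z + vertical_lift M t z"

lemma smooth_sec_rep_differentiable:
  assumes "open_in M U" "smooth_section M U s" "c \<in> atlas M" "p \<in> U" "p \<in> fst c"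
  shows "sec_rep M c s differentiable (at (snd c p))"
  using assms by (intro smooth_on_imp_differentiable[of "snd c ` (U \<inter> fst c)"]) (auto simp: smooth_section_iff)

lemma lift_section_eq:
  assumes U: "open_in M U" and s: "smooth_section M U s" and p: "p \<in> U"
  defines "c \<equiv> chart_at M p"
  shows "lift_section s t (p, v) = coord_lift (sec_rep M c s) (sec_rep M c t) (snd c p, v)"
proof -
  have pM: "p \<in> carrier M" using openin_subset_carrier[OF U] p by auto
  have c: "c \<in> atlas M" "p \<in> fst c" using chart_at[OF pM] by (auto simp: c_def)
  note D = has_derivative_fst_snd[OF frechet_has_derivative[OF smooth_sec_rep_differentiable[OF U s c(1) p c(2)]]]
  note E = D[THEN frechet_derivative_eqI]
  have at_p: "sec_rep M c s (snd c p) = s p" "sec_rep M c t (snd c p) = t p"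
    using sec_rep_chart_at[OF pM] by (simp_all add: c_def)
  show ?thesis
    unfolding lift_section_def complete_lift_def vertical_lift_def vf_clift_def form_clift_def
      vf_vlift_def form_vlift_def coord_lift_def lift_pair_def
    by (simp add: c_def[symmetric] Let_def sec_rep_simps E at_p
        bounded_bilinear.add_left[OF bounded_bilinear_blinfun_compose])
qed

text \<open>The lifts are defined point by point in the preferred charts. That they have the same
  expression in every chart is what makes them smooth.\<close>

lemma sec_rep_lift_section:
  assumes U: "open_in M U" and s: "smooth_section M U s" and t: "smooth_section M U t"
    and c: "c \<in> atlas M" and x: "x \<in> snd c ` (U \<inter> fst c)"
  shows "sec_rep (tangent_bundle M) (tangent_chart M c) (lift_section s t) (x, w) =
    coord_lift (sec_rep M c s) (sec_rep M c t) (x, w)"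
proof -
  interpret TM: charted_manifold "tangent_bundle M" by (rule charted_manifold_tangent_bundle)
  obtain p where p: "p \<in> U" "p \<in> fst c" "x = snd c p" using x by auto
  obtain v where w: "w = vec_comp M c p v" using surj_vec_comp[OF c p(2), of w] by auto
  have pM: "p \<in> carrier M" by (rule in_carrier[OF c p(2)])
  let ?c = "chart_at M p" and ?tc = "tangent_chart M"
  let ?S = "snd ?c ` (fst c \<inter> U \<inter> fst ?c)" and ?\<phi> = "snd c \<circ> chart_inv ?c"
  have c0: "?c \<in> atlas M" "p \<in> fst ?c" using chart_at[OF pM] by auto
  have tc: "?tc c \<in> atlas (tangent_bundle M)" "(p, v) \<in> fst (?tc c)"
    using c p by (auto simp: atlas_tangent_bundle fst_tangent_chart)
  have z: "snd (?tc c) (p, v) = (x, w)" by (simp add: snd_tangent_chart p w)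
  have z0: "snd (?tc ?c) (p, v) = (snd ?c p, v)" by (simp add: snd_tangent_chart vec_comp_chart_at[OF pM])
  have at_z: "sec_rep (tangent_bundle M) (?tc c) (lift_section s t) (x, w) =
      gcomp (tangent_bundle M) (?tc c) (p, v) (coord_lift (sec_rep M ?c s) (sec_rep M ?c t) (snd ?c p, v))"
    using TM.sec_rep_at[OF tc, of "lift_section s t"] lift_section_eq[OF U s p(1), of t v] z by simp
  have S: "open ?S" "snd ?c p \<in> ?S"
    using p c c0 U by (auto intro!: open_chart_image_of_open openin_Int openin_chart)
  have sm: "smooth_on ?S ?\<phi>"
    by (rule smooth_on_subset[OF smooth_trans[OF c0(1) c]]) auto
  have T: "?\<phi> ` ?S \<subseteq> snd c ` (U \<inter> fst c)"
    using chart_inv_left[OF c0(1)] by auto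
  have rs: "smooth_on ?S (sec_rep M ?c s)" "smooth_on (snd c ` (U \<inter> fst c)) (sec_rep M c s)"
    using s c c0 U by (auto simp: smooth_section_iff intro: smooth_on_subset)
  have tr: "transforms ?S ?\<phi> (sec_rep M ?c u) (sec_rep M c u)" for u
    by (rule transforms_sec_rep[OF c0(1) c]) auto
  have \<phi>p: "?\<phi> (snd ?c p) = x" using c0 by (simp add: chart_inv_left p)
  have \<phi>v: "der ?\<phi> (snd ?c p) v = w"
    using vec_comp_change[OF c0(1) c c0(2) p(2), of v] by (simp add: trans_der_def w vec_comp_chart_at[OF pM])
  have SU: "open (?S \<times> (UNIV :: 'e set))" "(snd ?c p, v) \<in> ?S \<times> UNIV"
    using S by (auto simp: open_Times)
  have "(snd (?tc c) \<circ> chart_inv (?tc ?c) has_derivative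
      (\<lambda>W. (der ?\<phi> (snd ?c p) (fst W),
       second_derivative ?\<phi> (snd ?c p) v (fst W) + der ?\<phi> (snd ?c p) (snd W)))) (at (snd ?c p, v))"
  proof (rule has_derivative_transform_within_open[OF tangent_map_has_derivative[OF S sm] SU])
    fix z assume "z \<in> ?S \<times> (UNIV :: 'e set)"
    then have "fst z \<in> snd ?c ` (fst ?c \<inter> fst c)" by auto
    from tangent_transition[OF c0(1) c this, of "snd z"]
    show "(?\<phi> (fst z), der ?\<phi> (fst z) (snd z)) = (snd (?tc c) \<circ> chart_inv (?tc ?c)) z"
      by (simp add: trans_der_def)
  qed
  then have D: "TM.trans_der (chart_at (tangent_bundle M) (p, v)) (?tc c)
        (snd (chart_at (tangent_bundle M) (p, v)) (p, v)) =
      (\<lambda>W. (der ?\<phi> (snd ?c p) (fst W),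
       second_derivative ?\<phi> (snd ?c p) v (fst W) + der ?\<phi> (snd ?c p) (snd W)))"
    unfolding TM.trans_der_def chart_at_tangent_bundle z0 by (rule frechet_derivative_eqI)
  note natural = coord_lift_natural[OF S sm T rs tr tr, of t, where v = v, unfolded \<phi>p \<phi>v]
  show ?thesis
    unfolding at_z by (rule TM.gcomp_eqI[OF tc, unfolded D, OF natural])
qed

lemma smooth_section_lift:
  assumes U: "open_in M U" and s: "smooth_section M U s" and t: "smooth_section M U t"
  shows "smooth_section (tangent_bundle M) (U \<times> UNIV) (lift_section s t)"
proof -
  interpret TM: charted_manifold "tangent_bundle M" by (rule charted_manifold_tangent_bundle)
  show ?thesis
    unfolding TM.smooth_section_iff[OF openin_tangent_bundle[OF U]] atlas_tangent_bundle ball_simps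
  proof
    fix c assume c: "c \<in> atlas M"
    let ?S = "snd c ` (U \<inter> fst c)"
    have S: "open ?S" by (rule open_chart_image_of_open[OF c U])
    have "(U \<times> UNIV) \<inter> fst (tangent_chart M c) = (U \<inter> fst c) \<times> UNIV"
      by (auto simp: fst_tangent_chart)
    then have img: "snd (tangent_chart M c) ` ((U \<times> UNIV) \<inter> fst (tangent_chart M c)) = ?S \<times> UNIV"
      using tangent_chart_image[OF c, of "U \<inter> fst c"] by simp
    have rs: "smooth_on ?S (sec_rep M c s)" "smooth_on ?S (sec_rep M c t)"
      using s t c by (auto simp: smooth_section_iff[OF U])
    show "smooth_on (snd (tangent_chart M c) ` ((U \<times> UNIV) \<inter> fst (tangent_chart M c)))
        (sec_rep (tangent_bundle M) (tangent_chart M c) (lift_section s t))"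
      unfolding img
      by (rule smooth_on_cong[OF _ smooth_on_coord_lift[OF S rs]])
        (use S sec_rep_lift_section[OF U s t c] in \<open>auto simp: open_Times\<close>)
  qed
qed

end

section \<open>Locality of involutivity\<close>

context charted_manifold
begin

lemma section_of_subset: "section_of M D U s \<Longrightarrow> V \<subseteq> U \<Longrightarrow> section_of M D V s"
  unfolding section_of_def by (auto intro: smooth_section_subset)

lemma compact_chart_inv_image_closed:
  assumes H: "Hausdorff_space (manifold_top M)" and c: "c \<in> atlas M"
    and K: "compact K" "K \<subseteq> snd c ` fst c"
  shows "closedin (manifold_top M) (chart_inv c ` K)"
proof -
  have "continuous_map (top_of_set (snd c ` fst c)) (manifold_top M) (chart_inv c)"
    unfolding continuous_map_def topspace_euclidean_subtopology
  proof (intro conjI allI impI)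
    show "chart_inv c \<in> snd c ` fst c \<rightarrow> topspace (manifold_top M)"
      using in_carrier[OF c chart_inv_into] by (auto simp: topspace_manifold_top)
    fix U assume U: "open_in M U"
    have "{x \<in> snd c ` fst c. chart_inv c x \<in> U} = snd c ` (U \<inter> fst c)"
      using in_chart_image_iff[OF c] by blast
    then show "openin (top_of_set (snd c ` fst c)) {x \<in> snd c ` fst c. chart_inv c x \<in> U}"
      using open_chart_image_of_open[OF c U] by (auto intro: open_subset)
  qed
  moreover have "compactin (top_of_set (snd c ` fst c)) K"
    using K by (simp add: compactin_subtopology)
  ultimately have "compactin (manifold_top M) (chart_inv c ` K)"
    using image_compactin by blast
  then show ?thesis by (rule compactin_imp_closedin[OF H])
qed

text \<open>The section is multiplied by a bump function whose support is compact in a chart domain. In a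
  Hausdorff space the support is closed, so that the extension by zero is smooth.\<close>

lemma extend_section:
  assumes H: "Hausdorff_space (manifold_top M)"
    and D: "\<And>q. q \<in> carrier M \<Longrightarrow> subspace (D q)"
    and U: "open_in M U" and s: "section_of M D U s" and p: "p \<in> U"
  obtains s' V where "section_of M D (carrier M) s'" "open_in M V" "p \<in> V" "V \<subseteq> U"
    "\<And>q. q \<in> V \<Longrightarrow> s' q = s q"
proof -
  have pM: "p \<in> carrier M" using openin_subset_carrier[OF U] p by auto
  obtain c where c: "c \<in> atlas M" "p \<in> fst c" using chart_at[OF pM] by blast
  let ?S = "snd c ` (U \<inter> fst c)"
  have "open ?S" "snd c p \<in> ?S" using open_chart_image_of_open[OF c(1) U] p c by auto
  then obtain r where r: "r > 0" "cball (snd c p) r \<subseteq> ?S" using open_contains_cball by blast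
  obtain \<rho> \<epsilon> where \<rho>: "smooth_on UNIV \<rho>" "0 < \<epsilon>" "\<And>x. x \<in> ball (snd c p) \<epsilon> \<Longrightarrow> \<rho> x = 1"
    "\<And>x. x \<notin> ball (snd c p) r \<Longrightarrow> \<rho> x = (0::real)"
    using bump_function[OF r(1), of "snd c p"] by blast
  define s' where "s' q = (if q \<in> U \<inter> fst c then \<rho> (snd c q) *\<^sub>R s q else 0)" for q
  define K where "K = chart_inv c ` cball (snd c p) r"
  define V where "V = U \<inter> (fst c \<inter> snd c -` ball (snd c p) \<epsilon>)"
  have Uc: "open_in M (U \<inter> fst c)" using U c by (simp add: openin_chart openin_Int)
  have "closedin (manifold_top M) K"
    unfolding K_def by (rule compact_chart_inv_image_closed[OF H c(1)]) (use r(2) in auto)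
  then have Kc: "open_in M (carrier M - K)"
    using topspace_manifold_top by (metis closedin_def)
  have KU: "K \<subseteq> U \<inter> fst c"
    using r(2) in_chart_image_iff[OF c(1)] chart_inv_into unfolding K_def by blast
  have s'0: "s' q = 0" if "q \<notin> K" for q
  proof (cases "q \<in> U \<inter> fst c")
    case True
    have "snd c q \<notin> cball (snd c p) r"
      using that True chart_inv_left[OF c(1)] unfolding K_def by (metis IntD2 image_eqI)
    then show ?thesis using \<rho>(4)[of "snd c q"] by (auto simp: s'_def)
  qed (auto simp: s'_def)
  have "smooth_section M (carrier M) s'"
  proof (rule smooth_section_local[OF openin_carrier])
    fix q assume q: "q \<in> carrier M"
    show "\<exists>V. open_in M V \<and> q \<in> V \<and> smooth_section M V s'"
    proof (cases "q \<in> K")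
      case True
      have "smooth_fun M (U \<inter> fst c) (\<lambda>q. \<rho> (snd c q))"
        by (rule smooth_fun_in_chart[OF c(1) Uc _ smooth_on_subset[OF \<rho>(1)]]) auto
      then have "smooth_section M (U \<inter> fst c) (\<lambda>q. \<rho> (snd c q) *\<^sub>R s q)"
        using s by (intro smooth_section_scaleR Uc) (auto simp: section_of_def intro: smooth_section_subset)
      then have "smooth_section M (U \<inter> fst c) s'"
        by (rule smooth_section_cong[OF Uc]) (simp add: s'_def)
      then show ?thesis using True KU Uc by blast
    next
      case False
      have "smooth_section M (carrier M - K) s'"
        by (rule smooth_section_cong[OF Kc smooth_section_zero[OF Kc]]) (simp add: s'0)
      then show ?thesis using False q Kc by blast
    qed
  qed
  moreover have "s' q \<in> D q" if q: "q \<in> carrier M" for q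
    using D[OF q] s by (auto simp: s'_def section_of_def subspace_0 subspace_scale)
  ultimately have "section_of M D (carrier M) s'" by (simp add: section_of_def)
  moreover have "open_in M V"
    unfolding V_def using U c by (intro openin_Int openin_chart_preimage) auto
  moreover have "p \<in> V" using p c \<rho>(2) by (simp add: V_def)
  moreover have "s' q = s q" if "q \<in> V" for q using that \<rho>(3) by (simp add: s'_def V_def)
  ultimately show ?thesis using that[of s' V] by (auto simp: V_def)
qed

lemma maximal_isotropic_fibre: "dirac_structure M D \<Longrightarrow> q \<in> carrier M \<Longrightarrow> maximal_isotropic (D q)"
  by (simp add: dirac_structure_def almost_dirac_def)

lemma isotropic_fibre: "dirac_structure M D \<Longrightarrow> q \<in> carrier M \<Longrightarrow> isotropic (D q)"
  using maximal_isotropic_fibre by (simp add: maximal_isotropic_def)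

text \<open>The bracket at \<open>p\<close> depends on the sections near \<open>p\<close> only, and there they agree with global ones.\<close>

lemma dirac_local_involutive:
  assumes H: "Hausdorff_space (manifold_top M)" and D: "dirac_structure M D"
    and U: "open_in M U" and s: "section_of M D U s" and t: "section_of M D U t" and p: "p \<in> U"
  shows "courant_bracket M s t p \<in> D p"
proof -
  have sub: "subspace (D q)" if "q \<in> carrier M" for q
    using isotropic_fibre[OF D that] by (simp add: isotropic_def)
  obtain s' V where s': "section_of M D (carrier M) s'" "open_in M V" "p \<in> V"
    "\<And>q. q \<in> V \<Longrightarrow> s' q = s q" using extend_section[OF H sub U s p] by metis
  obtain t' W where t': "section_of M D (carrier M) t'" "open_in M W" "p \<in> W"
    "\<And>q. q \<in> W \<Longrightarrow> t' q = t q" using extend_section[OF H sub U t p] by metis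
  have "courant_bracket M s t p = courant_bracket M s' t' p"
    by (rule courant_bracket_cong[of "V \<inter> W"]) (use s' t' in auto)
  moreover have "section_of M D (carrier M) (courant_bracket M s' t')"
    using D s'(1) t'(1) by (auto simp: dirac_structure_def)
  moreover have "p \<in> carrier M" using openin_subset_carrier[OF U] p by auto
  ultimately show ?thesis by (simp add: section_of_def)
qed

lemma metric_sections:
  assumes iso: "isotropic (D q)" and "section_of M D U s" "section_of M D U t" "q \<in> U"
  shows "metric_E (s q) (t q) = 0"
  using assms by (auto simp: section_of_def isotropic_def)

lemma metric_sec_rep_sections:
  assumes iso: "\<And>q. q \<in> carrier M \<Longrightarrow> isotropic (D q)" and s: "section_of M D U s" and t: "section_of M D U t"
    and c: "c \<in> atlas M" and y: "y \<in> snd c ` (U \<inter> fst c)"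
  shows "metric_E (sec_rep M c s y) (sec_rep M c t y) = 0"
proof -
  obtain q where q: "q \<in> U" "q \<in> fst c" "y = snd c q" using y by auto
  then show ?thesis
    using metric_sections[OF iso[OF in_carrier[OF c q(2)]] s t q(1)] c
    by (simp add: sec_rep_at metric_gcomp)
qed

lemma dirac_courant_tensor_zero:
  assumes H: "Hausdorff_space (manifold_top M)" and D: "dirac_structure M D"
    and U: "open_in M U"
    and s: "section_of M D U s" and t: "section_of M D U t" and u: "section_of M D U u"
    and c: "c \<in> atlas M" and y: "y \<in> snd c ` (U \<inter> fst c)"
  shows "courant_tensor (sec_rep M c s) (sec_rep M c t) (sec_rep M c u) y = 0"
proof -
  let ?S = "snd c ` (U \<inter> fst c)"
  have S: "open ?S" by (rule open_chart_image_of_open[OF c U])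
  obtain q where q: "q \<in> U" "q \<in> fst c" "y = snd c q" using y by auto
  have qM: "q \<in> carrier M" by (rule in_carrier[OF c q(2)])
  have d: "sec_rep M c s' differentiable (at y)" if "section_of M D U s'" for s'
    unfolding q(3) using that by (intro smooth_sec_rep_differentiable[OF U _ c q(1,2)]) (simp add: section_of_def)
  note iso = metric_sec_rep_sections[OF isotropic_fibre[OF D]]
  have "metric_E (courant_bracket M s t q) (u q) = 0"
    using isotropic_fibre[OF D qM] dirac_local_involutive[OF H D U s t q(1)] u q(1)
    by (auto simp: isotropic_def section_of_def)
  then have "metric_E (coord_bracket (sec_rep M c s) (sec_rep M c t) y) (sec_rep M c u y) = 0"
    using sec_rep_courant_bracket[OF U _ _ c q(1,2), of s t] s t q c
    by (simp add: section_of_def sec_rep_at metric_gcomp flip: sec_rep_courant_bracket[OF U _ _ c q(1,2)])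
  then show ?thesis
    using metric_coord_bracket[OF S y d[OF s] d[OF t] d[OF u] iso[OF _ s t c] iso[OF _ u s c]] by simp
qed

section \<open>The tangent lift of a Dirac structure\<close>

definition lift_der :: "('a \<Rightarrow> 'e gvec) \<Rightarrow> 'a \<Rightarrow> 'e \<Rightarrow> 'e gvec" where
  "lift_der s p v = der (sec_rep M (chart_at M p) s) (snd (chart_at M p) p) v"

lemma lift_section_pair:
  assumes U: "open_in M U" and s: "smooth_section M U s" and p: "p \<in> U"
  shows "lift_section s t (p, v) = lift_pair (s p) (lift_der s p v + t p)"
proof -
  have "p \<in> carrier M" using openin_subset_carrier[OF U] p by auto
  then show ?thesis
    using lift_section_eq[OF U s p, of t v] by (simp add: coord_lift_def lift_der_def sec_rep_chart_at)
qed

lemma lift_der_add: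
  assumes U: "open_in M U" and s: "smooth_section M U s" "smooth_section M U t" and p: "p \<in> U"
  shows "lift_der (\<lambda>q. s q + t q) p v = lift_der s p v + lift_der t p v"
proof -
  have c: "chart_at M p \<in> atlas M" "p \<in> fst (chart_at M p)"
    using chart_at openin_subset_carrier[OF U] p by auto
  note d = frechet_has_derivative[OF smooth_sec_rep_differentiable[OF U _ c(1) p c(2)]]
  show ?thesis
    unfolding lift_der_def sec_rep_add[abs_def]
    using frechet_derivative_eqI[OF has_derivative_add[OF d[OF s(1)] d[OF s(2)]]] by simp
qed

lemma lift_der_scaleR:
  assumes U: "open_in M U" and s: "smooth_section M U s" and p: "p \<in> U"
  shows "lift_der (\<lambda>q. a *\<^sub>R s q) p v = a *\<^sub>R lift_der s p v"
proof -
  have c: "chart_at M p \<in> atlas M" "p \<in> fst (chart_at M p)"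
    using chart_at openin_subset_carrier[OF U] p by auto
  note d = frechet_has_derivative[OF smooth_sec_rep_differentiable[OF U s c(1) p c(2)]]
  show ?thesis
    unfolding lift_der_def sec_rep_scaleR[abs_def]
    using frechet_derivative_eqI[OF has_derivative_scaleR_right[OF d, of a]] by simp
qed

lemma lift_der_zero: "lift_der (\<lambda>_. 0) p v = 0"
  by (simp add: lift_der_def sec_rep_def[abs_def] linear_0[OF linear_gcomp])

definition tangent_lift :: "('a \<Rightarrow> 'e gvec set) \<Rightarrow> 'a \<times> 'e \<Rightarrow> ('e \<times> 'e) gvec set" where
  "tangent_lift D z = {lift_section s t z |s t U. open_in M U \<and> fst z \<in> U \<and>
      section_of M D U s \<and> section_of M D U t}"

definition tangent_frame :: "(nat \<Rightarrow> 'a \<Rightarrow> 'e gvec) \<Rightarrow> nat \<Rightarrow> 'a \<times> 'e \<Rightarrow> ('e \<times> 'e) gvec" where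
  "tangent_frame e i = (if i < DIM('e) then lift_section (e i) (\<lambda>_. 0)
     else lift_section (\<lambda>_. 0) (e (i - DIM('e))))"

lemma complete_lift_eq: "complete_lift M s = lift_section s (\<lambda>_. 0)"
  by (simp add: fun_eq_iff lift_section_def vertical_lift_def vf_vlift_def form_vlift_def zero_prod_def)

lemma vertical_lift_eq: "vertical_lift M t = lift_section (\<lambda>_. 0) t"
proof
  fix z
  have "complete_lift M (\<lambda>_. 0) z = (0 :: ('e \<times> 'e) gvec)"
  proof (cases z)
    case (Pair p v)
    have "vf_rep M c (\<lambda>_. 0) = (\<lambda>_. 0)" "form_rep M c (\<lambda>_. 0) = (\<lambda>_. 0)" for c
      by (simp_all add: fun_eq_iff vf_rep_def form_rep_def vec_comp_def covec_comp_def)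
    then show ?thesis
      by (simp add: Pair complete_lift_def vf_clift_def form_clift_def Let_def zero_prod_def o_def)
  qed
  then show "vertical_lift M t z = lift_section (\<lambda>_. 0) t z" by (simp add: lift_section_def)
qed

context
  fixes D :: "'a \<Rightarrow> 'e gvec set"
  assumes D: "dirac_structure M D"
begin

lemma subspace_fibre: "q \<in> carrier M \<Longrightarrow> subspace (D q)"
  using isotropic_fibre[OF D] by (simp add: isotropic_def)

lemma section_of_zero: "open_in M U \<Longrightarrow> section_of M D U (\<lambda>_. 0)"
  using openin_subset_carrier[of U] subspace_fibre
  by (auto simp: section_of_def smooth_section_zero subspace_0)

lemma section_of_add:
  "open_in M U \<Longrightarrow> section_of M D U s \<Longrightarrow> section_of M D U t \<Longrightarrow>
    section_of M D U (\<lambda>q. s q + t q)"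
  using openin_subset_carrier[of U] subspace_fibre
  by (auto simp: section_of_def smooth_section_add subspace_add)

lemma section_of_scaleR:
  "open_in M U \<Longrightarrow> smooth_fun M U f \<Longrightarrow> section_of M D U s \<Longrightarrow>
    section_of M D U (\<lambda>q. f q *\<^sub>R s q)"
  using openin_subset_carrier[of U] subspace_fibre
  by (auto simp: section_of_def smooth_section_scaleR subspace_scale)

lemma tangent_liftE:
  assumes "a \<in> tangent_lift D (p, v)"
  obtains s t U where "a = lift_section s t (p, v)" "open_in M U" "p \<in> U"
    "section_of M D U s" "section_of M D U t"
  using assms unfolding tangent_lift_def by auto

lemma tangent_liftI:
  "open_in M U \<Longrightarrow> p \<in> U \<Longrightarrow> section_of M D U s \<Longrightarrow> section_of M D U t \<Longrightarrow>
    lift_section s t (p, v) \<in> tangent_lift D (p, v)"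
  unfolding tangent_lift_def by auto

text \<open>\<open>g(s\<^sup>C + t\<^sup>V, s'\<^sup>C + t'\<^sup>V)\<close> is the derivative of \<open>g(s,s')\<close> along \<open>v\<close> plus \<open>g(s,t') + g(t,s')\<close>.\<close>

lemma isotropic_tangent_lift:
  assumes p: "p \<in> carrier M"
  shows "isotropic (tangent_lift D (p, v))"
  unfolding isotropic_def
proof (intro conjI ballI subspaceI)
  show "0 \<in> tangent_lift D (p, v)"
    using tangent_liftI[OF openin_carrier p section_of_zero[OF openin_carrier] section_of_zero[OF openin_carrier], of v]
    by (simp add: lift_section_pair[OF openin_carrier smooth_section_zero[OF openin_carrier] p] lift_der_zero lift_pair_0)
next
  fix a b assume "a \<in> tangent_lift D (p, v)" "b \<in> tangent_lift D (p, v)"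
  then obtain s t U s' t' U' where a: "a = lift_section s t (p, v)" "open_in M U" "p \<in> U"
      "section_of M D U s" "section_of M D U t"
    and b: "b = lift_section s' t' (p, v)" "open_in M U'" "p \<in> U'"
      "section_of M D U' s'" "section_of M D U' t'"
    by (elim tangent_liftE)
  let ?U = "U \<inter> U'"
  have U: "open_in M ?U" "p \<in> ?U" using a b by auto
  have sec: "section_of M D ?U s" "section_of M D ?U t" "section_of M D ?U s'" "section_of M D ?U t'"
    using a b by (auto intro: section_of_subset)
  then have sm: "smooth_section M ?U s" "smooth_section M ?U s'" by (auto simp: section_of_def)
  note pair = lift_section_pair[OF U(1) _ U(2)]
  have "a + b = lift_section (\<lambda>q. s q + s' q) (\<lambda>q. t q + t' q) (p, v)"
    unfolding a b pair[OF sm(1)] pair[OF sm(2)] pair[OF smooth_section_add[OF U(1) sm]]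
      lift_der_add[OF U(1) sm U(2)] lift_pair_add[symmetric] by (simp add: algebra_simps)
  then show "a + b \<in> tangent_lift D (p, v)"
    using tangent_liftI[OF U section_of_add[OF U(1) sec(1,3)] section_of_add[OF U(1) sec(2,4)]] by simp
  let ?c = "chart_at M p"
  have c: "?c \<in> atlas M" "p \<in> fst ?c" using chart_at[OF p] by auto
  have S: "open (snd ?c ` (?U \<inter> fst ?c))" "snd ?c p \<in> snd ?c ` (?U \<inter> fst ?c)"
    using open_chart_image_of_open[OF c(1) U(1)] U c by auto
  have iso: "metric_E (sec_rep M ?c s y) (sec_rep M ?c s' y) = 0" if "y \<in> snd ?c ` (?U \<inter> fst ?c)" for y
    by (rule metric_sec_rep_sections[OF isotropic_fibre[OF D] sec(1,3) c(1) that])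
  note diff = smooth_sec_rep_differentiable[OF U(1) _ c(1) U(2) c(2)]
  have m: "metric_E (s p) (t' p) = 0" "metric_E (t p) (s' p) = 0"
    by (rule metric_sections[OF isotropic_fibre[OF D p] sec(1,4) U(2)]
        metric_sections[OF isotropic_fibre[OF D p] sec(2,3) U(2)])+
  have "metric_E (lift_der s p v) (s' p) = - metric_E (s p) (lift_der s' p v)"
    using isotropic_derivative[OF S iso diff[OF sm(1)] diff[OF sm(2)], of v]
    by (simp add: lift_der_def sec_rep_chart_at[OF p])
  then show "metric_E a b = 0"
    unfolding a b pair[OF sm(1)] pair[OF sm(2)] metric_lift_pair
    by (simp add: metric_E.add_left metric_E.add_right m)
next
  fix r a assume "a \<in> tangent_lift D (p, v)"
  then obtain s t U where a: "a = lift_section s t (p, v)" "open_in M U" "p \<in> U"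
      "section_of M D U s" "section_of M D U t"
    by (elim tangent_liftE)
  have sm: "smooth_section M U s" using a by (simp add: section_of_def)
  note pair = lift_section_pair[OF a(2) _ a(3)]
  have "r *\<^sub>R a = lift_section (\<lambda>q. r *\<^sub>R s q) (\<lambda>q. r *\<^sub>R t q) (p, v)"
    unfolding a(1) pair[OF sm] pair[OF smooth_section_scaleR[OF a(2) smooth_fun_const sm]]
      lift_der_scaleR[OF a(2) sm a(3)] lift_pair_scaleR[symmetric] by (simp add: algebra_simps)
  then show "r *\<^sub>R a \<in> tangent_lift D (p, v)"
    using tangent_liftI[OF a(2,3) section_of_scaleR[OF a(2) smooth_fun_const a(4)]
        section_of_scaleR[OF a(2) smooth_fun_const a(5)]] by simp
qed

lemma section_of_lift:
  assumes U: "open_in M U" and s: "section_of M D U s" and t: "section_of M D U t"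
  shows "section_of (tangent_bundle M) (tangent_lift D) (U \<times> UNIV) (lift_section s t)"
  using smooth_section_lift[OF U, of s t] tangent_liftI[OF U _ s t] s t
  by (auto simp: section_of_def)

lemma sum_split_double: "(\<Sum>i<n + n. f i) = (\<Sum>i<n. f i) + (\<Sum>i<n. f (n + i))" for f :: "nat \<Rightarrow> 'v::comm_monoid_add"
proof -
  have "(\<Sum>i<n + n. f i) = (\<Sum>i<n. f i) + (\<Sum>i=n..<n+n. f i)"
    by (simp add: sum.atLeastLessThan_concat lessThan_atLeast0)
  also have "(\<Sum>i=n..<n+n. f i) = (\<Sum>i<n. f (n + i))"
    using sum.shift_bounds_nat_ivl[of f 0 n n] by (simp add: lessThan_atLeast0 add.commute)
  finally show ?thesis .
qed

text \<open>The lifts of the frame are \<open>(e\<^sub>i, De\<^sub>i v)\<close> and \<open>(0, e\<^sub>i)\<close>: the first components show that the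
  coefficients of the complete lifts in a relation vanish, and then the second ones deal with the
  vertical lifts. The span of the frame has dimension \<open>2n\<close>, so it is maximal among isotropic spaces
  and cannot be smaller than the isotropic space \<open>tangent_lift D\<close>.\<close>

lemma tangent_frame_on:
  assumes fr: "frame_on D U e"
  shows "charted_manifold.frame_on (tangent_bundle M) (tangent_lift D) (U \<times> UNIV) (tangent_frame e)"
proof -
  interpret TM: charted_manifold "tangent_bundle M" by (rule charted_manifold_tangent_bundle)
  let ?n = "DIM('e)" and ?e = "tangent_frame e"
  have dim: "DIM('e \<times> 'e) = ?n + ?n" by simp
  have U: "open_in M U" using fr by (simp add: frame_on_def)
  have sec: "section_of (tangent_bundle M) (tangent_lift D) (U \<times> UNIV) (?e i)" if "i < ?n + ?n" for i
    using that frame_on_section[OF fr]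
    by (auto simp: tangent_frame_def intro!: section_of_lift U section_of_zero)
  have ind: "a i = 0"
    if p: "p \<in> U" and z: "(\<Sum>i<?n + ?n. a i *\<^sub>R ?e i (p, v)) = 0" and i: "i < ?n + ?n" for p v a i
  proof -
    have e1: "?e i (p, v) = lift_pair (e i p) (lift_der (e i) p v)" if "i < ?n" for i
      using that frame_on_section[OF fr that] lift_section_pair[OF U _ p, of "e i"]
      by (simp add: tangent_frame_def section_of_def)
    have e2: "?e (?n + i) (p, v) = lift_pair 0 (e i p)" for i
      using lift_section_pair[OF U smooth_section_zero[OF U] p, of "e i" v]
      by (simp add: tangent_frame_def lift_der_zero)
    have "(\<Sum>i<?n + ?n. a i *\<^sub>R ?e i (p, v)) =
        (\<Sum>i<?n. lift_pair (a i *\<^sub>R e i p) (a i *\<^sub>R lift_der (e i) p v))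
        + (\<Sum>i<?n. lift_pair (a (?n + i) *\<^sub>R 0) (a (?n + i) *\<^sub>R e i p))"
      unfolding sum_split_double lift_pair_scaleR by (intro arg_cong2[of _ _ _ _ "(+)"] sum.cong) (auto simp: e1 e2)
    also have "\<dots> = lift_pair (\<Sum>i<?n. a i *\<^sub>R e i p)
        ((\<Sum>i<?n. a i *\<^sub>R lift_der (e i) p v) + (\<Sum>i<?n. a (?n + i) *\<^sub>R e i p))"
      unfolding lift_pair_sum[symmetric] lift_pair_add[symmetric] by simp
    finally have sum0: "(\<Sum>i<?n. a i *\<^sub>R e i p) = 0"
      "(\<Sum>i<?n. a i *\<^sub>R lift_der (e i) p v) + (\<Sum>i<?n. a (?n + i) *\<^sub>R e i p) = 0"
      using z by (auto simp: lift_pair_eq_0)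
    have a0: "a i = 0" if "i < ?n" for i
      by (rule frame_on_independent[OF fr p sum0(1) that])
    then have "(\<Sum>i<?n. a (?n + i) *\<^sub>R e i p) = 0" using sum0(2) by simp
    from frame_on_independent[OF fr p this] have "a (?n + i) = 0" if "i < ?n" for i
      using that by simp
    from this[of "i - ?n"] a0[of i] show ?thesis using i by (cases "i < ?n") auto
  qed
  have sp: "span ((\<lambda>i. ?e i (p, v)) ` {..<?n + ?n}) = tangent_lift D (p, v)" if p: "p \<in> U" for p v
  proof -
    let ?L = "span ((\<lambda>i. ?e i (p, v)) ` {..<?n + ?n})"
    have iso: "isotropic (tangent_lift D (p, v))"
      using openin_subset_carrier[OF U] p by (intro isotropic_tangent_lift) auto
    have sub: "?L \<subseteq> tangent_lift D (p, v)"
      using sec p iso by (intro span_minimal) (auto simp: section_of_def isotropic_def)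
    have "gdim ?L = ?n + ?n"
    proof -
      have "inj_on (\<lambda>i. ?e i (p, v)) {..<?n + ?n} \<and> independent ((\<lambda>i. ?e i (p, v)) ` {..<?n + ?n})"
        using ind[OF p] by (subst independent_family_iff) auto
      then show ?thesis using gdim_frame[of "\<lambda>i. ?e i (p, v)" "{..<?n + ?n}"] by simp
    qed
    moreover have "isotropic ?L" using iso sub by (auto simp: isotropic_def)
    ultimately have "maximal_isotropic ?L" by (simp add: maximal_isotropic_iff)
    then show ?thesis using iso sub unfolding maximal_isotropic_def by blast
  qed
  show ?thesis
    unfolding TM.frame_on_def dim
    using openin_tangent_bundle[OF U] sec sp ind by (auto simp: section_of_def)
qed

lemma almost_dirac_tangent_lift: "almost_dirac (tangent_bundle M) (tangent_lift D)"
proof -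
  interpret TM: charted_manifold "tangent_bundle M" by (rule charted_manifold_tangent_bundle)
  show ?thesis
  proof (rule TM.frame_on_almost_diracI)
    fix z assume z: "z \<in> carrier (tangent_bundle M)"
    then have p: "fst z \<in> carrier M" by (auto simp: carrier_tangent_bundle)
    show "isotropic (tangent_lift D z)" using isotropic_tangent_lift[OF p, of "snd z"] by simp
    obtain U e where "fst z \<in> U" "frame_on D U e"
      using almost_dirac_frame[OF _ p] D by (auto simp: dirac_structure_def)
    then show "\<exists>U e. z \<in> U \<and> TM.frame_on (tangent_lift D) U e"
      using tangent_frame_on[of U e] by (intro exI[of _ "U \<times> UNIV"] exI[of _ "tangent_frame e"]) (auto simp: mem_Times_iff)
  qed
qed

text \<open>The bracket is tested against an arbitrary vector \<open>b\<close> of the fibre. At the point in question,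
  \<open>S\<close>, \<open>T\<close> and \<open>b\<close> are values of lifts.\<close>

lemma courant_bracket_in_tangent_lift:
  assumes H: "Hausdorff_space (manifold_top M)"
    and S: "section_of (tangent_bundle M) (tangent_lift D) (carrier (tangent_bundle M)) S"
    and T: "section_of (tangent_bundle M) (tangent_lift D) (carrier (tangent_bundle M)) T"
    and p: "p \<in> carrier M"
  shows "courant_bracket (tangent_bundle M) S T (p, v) \<in> tangent_lift D (p, v)"
proof (rule maximal_isotropic_perp)
  interpret TM: charted_manifold "tangent_bundle M" by (rule charted_manifold_tangent_bundle)
  let ?TM = "tangent_bundle M" and ?L = "tangent_lift D"
  have z: "(p, v) \<in> carrier ?TM" using p by (simp add: carrier_tangent_bundle)
  show "maximal_isotropic (?L (p, v))"
    using almost_dirac_tangent_lift z by (simp add: almost_dirac_def)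
  fix b assume "b \<in> ?L (p, v)"
  moreover have "S (p, v) \<in> ?L (p, v)" "T (p, v) \<in> ?L (p, v)" using S T z by (auto simp: section_of_def)
  ultimately obtain s1 t1 U1 s2 t2 U2 s3 t3 U3
    where 1: "S (p, v) = lift_section s1 t1 (p, v)" "open_in M U1" "p \<in> U1"
      "section_of M D U1 s1" "section_of M D U1 t1"
    and 2: "T (p, v) = lift_section s2 t2 (p, v)" "open_in M U2" "p \<in> U2"
      "section_of M D U2 s2" "section_of M D U2 t2"
    and 3: "b = lift_section s3 t3 (p, v)" "open_in M U3" "p \<in> U3"
      "section_of M D U3 s3" "section_of M D U3 t3"
    by (elim tangent_liftE)
  let ?c = "chart_at M p"
  define U where "U = U1 \<inter> U2 \<inter> U3"
  define c where "c = tangent_chart M ?c"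
  have c0: "?c \<in> atlas M" "p \<in> fst ?c" using chart_at[OF p] by auto
  have c: "c \<in> atlas ?TM" using c0 by (simp add: c_def atlas_tangent_bundle)
  have U: "open_in M U" "p \<in> U" using 1 2 3 by (auto simp: U_def)
  have sec: "section_of M D U s1" "section_of M D U s2" "section_of M D U s3"
    "section_of M D U t1" "section_of M D U t2" "section_of M D U t3"
    using 1 2 3 by (auto simp: U_def intro: section_of_subset)
  then have sm: "smooth_section M U s1" "smooth_section M U s2" "smooth_section M U s3"
    "smooth_section M U t1" "smooth_section M U t2" "smooth_section M U t3"
    by (auto simp: section_of_def)
  let ?O = "snd ?c ` (U \<inter> fst ?c)" and ?r = "sec_rep M ?c" and ?R = "sec_rep ?TM c"
  let ?z = "(snd ?c p, v)"
  have O: "open ?O" "snd ?c p \<in> ?O" using open_chart_image_of_open[OF c0(1) U(1)] U c0 by auto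
  have OU: "open (?O \<times> (UNIV :: 'e set))" "?z \<in> ?O \<times> UNIV" using O by (auto simp: open_Times)
  have img: "snd c ` ((U \<times> UNIV) \<inter> fst c) = ?O \<times> UNIV"
  proof -
    have "(U \<times> UNIV) \<inter> fst c = (U \<inter> fst ?c) \<times> UNIV" by (auto simp: c_def fst_tangent_chart)
    then show ?thesis using tangent_chart_image[OF c0(1), of "U \<inter> fst ?c"] by (simp add: c_def)
  qed
  have rs: "smooth_on ?O (?r u)" if "smooth_section M U u" for u
    using that c0 by (simp add: smooth_section_iff[OF U(1)])
  have Rlift: "?R (lift_section s t) y = coord_lift (?r s) (?r t) y"
    if "smooth_section M U s" "smooth_section M U t" "y \<in> ?O \<times> UNIV" for s t y
    using sec_rep_lift_section[OF U(1) that(1,2) c0(1), of "fst y" "snd y"] that(3)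
    by (auto simp: c_def)
  have UT: "open_in ?TM (U \<times> UNIV)" by (rule openin_tangent_bundle[OF U(1)])
  have secT: "section_of ?TM ?L (U \<times> UNIV) S" "section_of ?TM ?L (U \<times> UNIV) T"
    using S T TM.section_of_subset TM.openin_subset_carrier[OF UT] by blast+
  have iso: "metric_E (?R A y) (?R B y) = 0"
    if "section_of ?TM ?L (U \<times> UNIV) A" "section_of ?TM ?L (U \<times> UNIV) B" "y \<in> ?O \<times> UNIV" for A B y
    by (rule TM.metric_sec_rep_sections[OF _ that(1,2) c])
      (use that(3) img isotropic_tangent_lift in \<open>auto simp: carrier_tangent_bundle\<close>)
  have dR: "?R A differentiable (at ?z)" if "section_of ?TM ?L (U \<times> UNIV) A" for A
  proof -
    have "smooth_on (?O \<times> UNIV) (?R A)"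
      using that c img by (auto simp: section_of_def TM.smooth_section_iff[OF UT])
    then show ?thesis by (rule smooth_on_imp_differentiable[OF _ OU(2)])
  qed
  define l where "l s t = lift_section s t" for s t
  have secl: "section_of ?TM ?L (U \<times> UNIV) (l s t)" if "section_of M D U s" "section_of M D U t" for s t
    unfolding l_def by (rule section_of_lift[OF U(1) that])
  note L1 = secl[OF sec(1,4)] and L2 = secl[OF sec(2,5)] and L3 = secl[OF sec(3,6)]
  have at_z: "?R A ?z = A (p, v)" for A
    using TM.sec_rep_chart_at[OF z, of A]
    by (simp add: chart_at_tangent_bundle c_def snd_tangent_chart vec_comp_chart_at[OF p])
  have "courant_bracket ?TM S T (p, v) = coord_bracket (?R S) (?R T) ?z"
    using TM.courant_bracket_chart_at[OF z, of S T]
    by (simp add: chart_at_tangent_bundle c_def snd_tangent_chart vec_comp_chart_at[OF p])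
  then have "metric_E (courant_bracket ?TM S T (p, v)) b =
      metric_E (coord_bracket (?R S) (?R T) ?z) (?R (l s3 t3) ?z)"
    by (simp add: at_z 3 l_def)
  also have "\<dots> = courant_tensor (?R S) (?R T) (?R (l s3 t3)) ?z"
    by (rule metric_coord_bracket[OF OU dR[OF secT(1)] dR[OF secT(2)] dR[OF L3] iso[OF secT] iso[OF L3 secT(1)]])
  \<comment> \<open>\<open>S\<close> and \<open>T\<close> are exchanged for lifts with the same values at the point, one after the other.\<close>
  also have "\<dots> = courant_tensor (?R (l s1 t1)) (?R T) (?R (l s3 t3)) ?z"
    by (rule courant_tensor_cong1[OF OU dR[OF secT(1)] dR[OF L1] dR[OF secT(2)] iso[OF secT] iso[OF L1 secT(2)]])
      (simp_all add: at_z 1 l_def)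
  also have "\<dots> = courant_tensor (?R T) (?R (l s3 t3)) (?R (l s1 t1)) ?z"
    by (rule courant_tensor_cyclic)
  also have "\<dots> = courant_tensor (?R (l s2 t2)) (?R (l s3 t3)) (?R (l s1 t1)) ?z"
    by (rule courant_tensor_cong1[OF OU dR[OF secT(2)] dR[OF L2] dR[OF L3] iso[OF secT(2) L3] iso[OF L2 L3]])
      (simp_all add: at_z 2 l_def)
  also have "\<dots> = courant_tensor (coord_lift (?r s2) (?r t2)) (coord_lift (?r s3) (?r t3)) (coord_lift (?r s1) (?r t1)) ?z"
    by (rule courant_tensor_cong[OF OU]) (simp_all add: l_def Rlift sm)
  also have "\<dots> = 0"
    by (rule courant_tensor_lift[OF O(1) rs[OF sm(2)] rs[OF sm(3)] rs[OF sm(1)] rs[OF sm(5)] rs[OF sm(6)] rs[OF sm(4)] O(2)];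
      rule dirac_courant_tensor_zero[OF H D U(1) _ _ _ c0(1)]; (rule sec O | assumption))
  finally show "metric_E (courant_bracket ?TM S T (p, v)) b = 0" .
qed

lemma dirac_structure_tangent_lift:
  assumes H: "Hausdorff_space (manifold_top M)"
  shows "dirac_structure (tangent_bundle M) (tangent_lift D)"
  unfolding dirac_structure_def
proof (intro conjI allI impI almost_dirac_tangent_lift)
  interpret TM: charted_manifold "tangent_bundle M" by (rule charted_manifold_tangent_bundle)
  let ?sec = "section_of (tangent_bundle M) (tangent_lift D) (carrier (tangent_bundle M))"
  fix S T assume ST: "?sec S \<and> ?sec T"
  have "smooth_section (tangent_bundle M) (carrier (tangent_bundle M)) (courant_bracket (tangent_bundle M) S T)"
    using ST by (intro TM.smooth_section_courant_bracket TM.openin_carrier) (auto simp: section_of_def)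
  moreover have "courant_bracket (tangent_bundle M) S T z \<in> tangent_lift D z"
    if "z \<in> carrier (tangent_bundle M)" for z
    using courant_bracket_in_tangent_lift[OF H, of S T "fst z" "snd z"] ST that by (auto simp: carrier_tangent_bundle)
  ultimately show "?sec (courant_bracket (tangent_bundle M) S T)" by (simp add: section_of_def)
qed

end

end

section \<open>The sheaf spanned by the lifts\<close>

lemma sheaf_isomorphic_eq:
  assumes top: "\<And>U. open_in M U \<Longrightarrow> U \<subseteq> carrier M"
    and eq: "\<And>p. p \<in> carrier M \<Longrightarrow> S p = S' p"
  shows "sheaf_isomorphic M S S'"
  unfolding sheaf_isomorphic_def
proof (intro exI[of _ "\<lambda>p g. g"] conjI ballI allI impI)
  show "bij_betw (\<lambda>g. g) (S p) (S' p)" if "p \<in> carrier M" for p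
    using eq[OF that] by (simp add: bij_betw_def)
  fix U s p assume "open_in M U \<and> (\<forall>q\<in>U. germ M q s \<in> S q)" and "p \<in> U"
  then show "\<exists>W t. open_in M W \<and> p \<in> W \<and> W \<subseteq> U \<and> (\<forall>q\<in>W. germ M q s = germ M q t)"
    by blast
qed simp_all

lemma locally_free_cong:
  assumes top: "\<And>U. open_in M U \<Longrightarrow> U \<subseteq> carrier M"
    and eq: "\<And>p. p \<in> carrier M \<Longrightarrow> S p = S' p" and S: "locally_free M r S"
  shows "locally_free M r S'"
  unfolding locally_free_def
proof
  fix p assume "p \<in> carrier M"
  then obtain U e where U: "open_in M U" "p \<in> U"
    and e: "\<forall>q\<in>U. (\<forall>i<r. germ M q (e i) \<in> S q) \<and>
           bij_betw (\<lambda>\<phi>. germ_lincomb M q \<phi> (\<lambda>i. germ M q (e i)) r)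
             ({..<r} \<rightarrow>\<^sub>E function_germs M q) (S q)"
    using S unfolding locally_free_def by blast
  have "S q = S' q" if "q \<in> U" for q using eq top[OF U(1)] that by auto
  then show "\<exists>U e. open_in M U \<and> p \<in> U \<and>
        (\<forall>q\<in>U. (\<forall>i<r. germ M q (e i) \<in> S' q) \<and>
           bij_betw (\<lambda>\<phi>. germ_lincomb M q \<phi> (\<lambda>i. germ M q (e i)) r)
             ({..<r} \<rightarrow>\<^sub>E function_germs M q) (S' q))"
    using U e by (intro exI[of _ U] exI[of _ e]) auto
qed

context charted_manifold
begin

context
  fixes D :: "'a \<Rightarrow> 'e gvec set"
  assumes D: "dirac_structure M D"
begin

lemma section_germs_closed:
  assumes p: "p \<in> carrier M" and \<phi>: "\<phi> \<in> function_germs M p"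
    and g: "g \<in> section_germs M D p" and h: "h \<in> section_germs M D p"
  shows "germ_add (germ_scale \<phi> g) h \<in> section_germs M D p"
proof -
  obtain f U where f: "\<phi> = germ M p f" "open_in M U" "p \<in> U" "smooth_fun M U f"
    using \<phi> by (auto simp: function_germs_def)
  obtain s V where s: "g = germ M p s" "open_in M V" "p \<in> V" "section_of M D V s"
    using g by (auto simp: section_germs_def)
  obtain t W where t: "h = germ M p t" "open_in M W" "p \<in> W" "section_of M D W t"
    using h by (auto simp: section_germs_def)
  let ?U = "U \<inter> V \<inter> W"
  have U: "open_in M ?U" using f s t by auto
  have "section_of M D ?U (\<lambda>q. f q *\<^sub>R s q + t q)"
    using f s t
    by (intro section_of_add[OF D] section_of_scaleR[OF D] U)
      (auto intro: section_of_subset smooth_fun_subset)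
  moreover have "germ_add (germ_scale \<phi> g) h = germ M p (\<lambda>q. f q *\<^sub>R s q + t q)"
    by (simp add: f s t germ_scale_germ[OF p] germ_add_germ[OF p])
  ultimately show ?thesis
    unfolding section_germs_def using U f s t by (intro CollectI exI[of _ ?U] exI conjI) auto
qed

text \<open>A section of \<open>tangent_lift D\<close> is a combination, with smooth coefficients, of a frame of lifts.
  Conversely, lifts are sections, and sections form a module.\<close>

lemma tangent_lift_sheaf_eq:
  assumes H: "Hausdorff_space (manifold_top M)" and z: "z \<in> carrier (tangent_bundle M)"
  shows "tangent_lift_sheaf M D z = section_germs (tangent_bundle M) (tangent_lift D) z"
proof -
  interpret TM: charted_manifold "tangent_bundle M" by (rule charted_manifold_tangent_bundle)
  let ?TM = "tangent_bundle M" and ?L = "tangent_lift D" and ?n = "DIM('e)"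
  note DT = dirac_structure_tangent_lift[OF D H]
  obtain p v where pv: "z = (p, v)" by (cases z)
  have p: "p \<in> carrier M" using z by (simp add: pv carrier_tangent_bundle)
  define G where "G = {germ ?TM z (complete_lift M s) |s U.
         open_in M U \<and> fst z \<in> U \<and> section_of M D U s} \<union>
      {germ ?TM z (vertical_lift M s) |s U.
         open_in M U \<and> fst z \<in> U \<and> section_of M D U s}"
  have sheaf: "tangent_lift_sheaf M D z = germ_span ?TM z G"
    by (simp add: tangent_lift_sheaf_def G_def)
  have G: "G \<subseteq> section_germs ?TM ?L z"
  proof
    fix g assume "g \<in> G"
    then obtain s t U where U: "open_in M U" "p \<in> U" "section_of M D U s" "section_of M D U t"
      and g: "g = germ ?TM z (lift_section s t)"
      using section_of_zero[OF D] unfolding G_def complete_lift_eq vertical_lift_eq pv by auto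
    then show "g \<in> section_germs ?TM ?L z"
      unfolding section_germs_def pv
      by (intro CollectI exI conjI) (rule g[unfolded pv] openin_tangent_bundle[OF U(1)]
          section_of_lift[OF D U(1,3,4)] | simp)+
  qed
  have "g \<in> section_germs ?TM ?L z" if "g \<in> germ_span ?TM z G" for g
    using that
  proof induction
    case zero
    show ?case
      unfolding section_germs_def
      by (intro CollectI exI conjI) (rule refl TM.openin_carrier z TM.section_of_zero[OF DT TM.openin_carrier])+
  next
    case (add \<phi> g h)
    show ?case
      by (rule charted_manifold.section_germs_closed[OF charted_manifold_tangent_bundle DT z add(1) _ add.IH]) (use G add in auto)
  qed
  moreover have "g \<in> germ_span ?TM z G" if g: "g \<in> section_germs ?TM ?L z" for g
  proof -
    obtain s V where s: "g = germ ?TM z s" "open_in ?TM V" "z \<in> V" "section_of ?TM ?L V s"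
      using g by (auto simp: section_germs_def)
    obtain U e where U: "p \<in> U" and fr: "frame_on D U e"
      using almost_dirac_frame[OF _ p] D by (auto simp: dirac_structure_def)
    have opU: "open_in M U" using fr by (simp add: frame_on_def)
    have "z \<in> U \<times> UNIV" using U by (simp add: pv)
    then obtain W f where W: "open_in ?TM W" "z \<in> W"
      and f: "\<And>i. i < DIM('e \<times> 'e) \<Longrightarrow> smooth_fun ?TM W (f i)"
      and s_eq: "\<And>q. q \<in> W \<Longrightarrow> s q = (\<Sum>i<DIM('e \<times> 'e). f i q *\<^sub>R tangent_frame e i q)"
      by (rule TM.frame_coefficients[OF tangent_frame_on[OF D fr] s(2,4) _ s(3)]) blast
    have e: "germ ?TM z (tangent_frame e i) \<in> G" if "i < DIM('e \<times> 'e)" for i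
    proof (cases "i < ?n")
      case True
      then show ?thesis
        using frame_on_section[OF fr True] opU U
        unfolding G_def complete_lift_eq tangent_frame_def pv by auto
    next
      case False
      then have "i - ?n < ?n" using that by auto
      from frame_on_section[OF fr this] show ?thesis
        using opU U False unfolding G_def vertical_lift_eq tangent_frame_def pv by auto
    qed
    have "germ ?TM z (\<lambda>q. \<Sum>i<k. f i q *\<^sub>R tangent_frame e i q) \<in> germ_span ?TM z G"
      if "k \<le> DIM('e \<times> 'e)" for k
      using that
    proof (induction k)
      case 0
      show ?case using germ_span.zero by simp
    next
      case (Suc k)
      have "germ ?TM z (f k) \<in> function_germs ?TM z"
        unfolding function_germs_def using W f[of k] Suc.prems by auto
      from germ_span.add[OF this e[of k] Suc.IH] Suc.prems show ?case
        by (simp add: TM.germ_scale_germ[OF z] TM.germ_add_germ[OF z] add.commute)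
    qed
    from this[OF order_refl] show ?thesis
      unfolding s(1) using germ_eqI[OF W s_eq] by simp
  qed
  ultimately show ?thesis unfolding sheaf by blast
qed

end

end

theorem proposition3p1:
  fixes M :: "('a, 'e::euclidean_space) charted_space"
    and D :: "'a \<Rightarrow> 'e gvec set"
  assumes "smooth_manifold M"
    and "dirac_structure M D"
  shows "locally_free (tangent_bundle M) (2 * DIM('e)) (tangent_lift_sheaf M D) \<and>
    (\<exists>Dtg. dirac_structure (tangent_bundle M) Dtg \<and>
       (\<forall>z\<in>carrier (tangent_bundle M).
          tangent_lift_sheaf M D z = section_germs (tangent_bundle M) Dtg z) \<and>
       sheaf_isomorphic (tangent_bundle M) (tangent_lift_sheaf M D)
         (section_germs (tangent_bundle M) Dtg))"
proof -
  interpret charted_manifold M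
    using assms(1) by unfold_locales (auto simp: smooth_manifold_def)
  interpret TM: charted_manifold "tangent_bundle M" by (rule charted_manifold_tangent_bundle)
  let ?TM = "tangent_bundle M" and ?L = "tangent_lift D"
  have H: "Hausdorff_space (manifold_top M)" using assms(1) by (simp add: smooth_manifold_def)
  note dirac = dirac_structure_tangent_lift[OF assms(2) H]
  note eq = tangent_lift_sheaf_eq[OF assms(2) H]
  have "locally_free ?TM (2 * DIM('e)) (section_germs ?TM ?L)"
    using TM.locally_free_section_germs[of ?L] dirac by (simp add: dirac_structure_def mult_2)
  then have "locally_free ?TM (2 * DIM('e)) (tangent_lift_sheaf M D)"
    by (rule locally_free_cong[rotated 2]) (simp_all add: TM.openin_subset_carrier eq)
  moreover have "sheaf_isomorphic ?TM (tangent_lift_sheaf M D) (section_germs ?TM ?L)"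
    by (rule sheaf_isomorphic_eq[OF TM.openin_subset_carrier eq])
  ultimately show ?thesis using dirac eq by blast
qed

end
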